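(* Let $n$ be a positive integer, let $c=23n$ and let $p=\omega\left(\frac{\log n}{n}\right)$. Then w.h.p. a random edge-colored graph $G\sim\mathcal G_{c}(n,p)$ contains at least $t=(1-o(1))\frac{np}{46}$ edge-disjoint rainbow Hamilton cycles.
   Context: Asymptotic notation is as $n\to\infty$; $p=p(n)\in[0,1]$; $p=\omega(\log n/n)$ means $pn/\log n\to\infty$. "W.h.p." means with probability tending to $1$ as $n\to\infty$. For $p\in[0,1]$ and a positive integer $c$, $\mathcal G_c(n,p)$ is the probability space of edge-colored graphs on $n$ vertices obtained by keeping each edge of the complete graph $K_n$ independently with probability $p$ and then coloring each kept edge independently and uniformly at random with a color from $[c]=\{1,\dots,c\}$. A subgraph is rainbow if all of its edges have distinct colors. *)

theory Defs
  imports "HOL-Probability.Product_PMF" "HOL-Library.Disjoint_Sets"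
begin

text \<open>
  The vertices are \<open>0, \<dots>, n - 1\<close>. An edge-coloured graph maps each vertex set \<open>e\<close> to \<open>Some k\<close> if
  \<open>e\<close> is an edge of colour \<open>k\<close>, and to \<open>None\<close> if \<open>e\<close> is not an edge, so \<open>dom G\<close> is its edge set.
\<close>

type_synonym edge_coloured_graph = "nat set \<Rightarrow> nat option"

definition complete_graph_edges :: "nat \<Rightarrow> nat set set" where
  "complete_graph_edges n = {e. e \<subseteq> {..<n} \<and> card e = 2}"

definition random_edge :: "nat \<Rightarrow> real \<Rightarrow> nat option pmf" where
  "random_edge c p =
     bind_pmf (bernoulli_pmf p)
       (\<lambda>kept. if kept then map_pmf Some (pmf_of_set {1..c}) else return_pmf None)"

text \<open>Meaningful for \<open>c \<ge> 1\<close> and \<open>0 \<le> p \<le> 1\<close>.\<close>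

definition random_coloured_graph :: "nat \<Rightarrow> nat \<Rightarrow> real \<Rightarrow> edge_coloured_graph pmf" where
  "random_coloured_graph c n p = Pi_pmf (complete_graph_edges n) None (\<lambda>_. random_edge c p)"

definition cycle_edges :: "nat list \<Rightarrow> nat set set" where
  "cycle_edges vs = {{vs ! i, vs ! (Suc i mod length vs)} | i. i < length vs}"

text \<open>Cycles are subgraphs, hence identified with their edge sets: neither a starting point nor a
  direction is part of the data.\<close>

definition hamilton_cycle :: "nat \<Rightarrow> edge_coloured_graph \<Rightarrow> nat set set \<Rightarrow> bool" where
  "hamilton_cycle n G C \<longleftrightarrow>
     C \<subseteq> dom G \<and>
     (\<exists>vs. 3 \<le> length vs \<and> distinct vs \<and> set vs = {..<n} \<and> C = cycle_edges vs)"

definition rainbow :: "edge_coloured_graph \<Rightarrow> nat set set \<Rightarrow> bool" where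
  "rainbow G C \<longleftrightarrow> C \<subseteq> dom G \<and> inj_on G C"

definition rainbow_hamilton_packing ::
    "nat \<Rightarrow> edge_coloured_graph \<Rightarrow> nat set set set \<Rightarrow> bool" where
  "rainbow_hamilton_packing n G H \<longleftrightarrow>
     finite H \<and> disjoint H \<and> (\<forall>C\<in>H. hamilton_cycle n G C \<and> rainbow G C)"

end

theory Submission
  imports Defs "HOL-Combinatorics.Permutations" "HOL-Analysis.Harmonic_Numbers"
begin

text \<open>
  Orient \<open>K\<^sub>n\<close> so that every vertex owns about half of the pairs containing it. A pair is present with
  probability \<open>p\<close> independently, so permuting the heads of the pairs owned by a vertex preserves the
  distribution of the coloured graph. Hence one may first fix the graph, in which by Chernoff every
  vertex owns at least \<open>22 T\<close> edges and every colour occurs at most \<open>T\<close> times, where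
  \<open>T\<close> is about \<open>1.01 np / 46\<close>, and then permute the heads at random.

  Group the edges owned by a vertex into \<open>22\<close> blocks of size \<open>T\<close>. The bipartite multigraph between
  blocks and colours has maximal degree \<open>T\<close>, so by Koenig's theorem its edges have a proper colouring
  with \<open>T\<close> classes; each class meets every block once and repeats no colour. This splits the
  graph into \<open>T\<close> edge-disjoint rainbow \<open>22\<close>-outs. After permuting the heads, each of them is a uniformly random
  \<open>22\<close>-out along the orientation, which is Hamiltonian with high probability. By Markov's
  inequality at least \<open>np / 46\<close> of the \<open>T\<close> systems contain a Hamilton cycle.

  Hamiltonicity of the random \<open>22\<close>-out follows Fenner and Frieze: after deleting any one choice per
  vertex (the red choices) the graph is still an expander, so by Posa's rotation argument at least
  about \<open>n\<^sup>2 / 32\<close> pairs close one of its longest paths. If the graph is not Hamiltonian, the random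
  red choices avoid a given longest path with probability at least \<open>(10/11)\<^bsup>n/2\<^esup>\<close>, and then they all have
  to avoid those pairs, which has probability at most \<open>e\<^bsup>-n/16\<^esup>\<close>.
\<close>
section \<open>Edge colourings of bipartite multigraphs\<close>

text \<open>The obstacle is dependence: a decomposition guided by the colours fixes which arcs each
  system uses, so nothing random is left in it. The shuffle restores randomness afterwards. It is a
  symmetry of the model because every pair is owned by exactly one end, so separate permutations of
  the heads act together as a permutation of the pairs.

  The constants meet at \<open>X = np/46\<close>. A colour is expected on at most
  \<open>(n^2/2) * p / (23 n) = X\<close> edges, and a vertex owns about
  \<open>np/2 = 23 * X\<close>. With \<open>T\<close> near \<open>1.01 * X\<close>, the demand
  \<open>22 * T\<close>, near \<open>22.22 * X\<close>, stays below \<open>23 * X\<close>, and the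
  surplus \<open>T - X\<close> is what Markov's inequality may lose, so no error term remains in the
  end. The union bounds over \<open>n\<close> vertices and \<open>23 n\<close> colours have errors
  \<open>exp (- c * X)\<close> with tiny \<open>c\<close>; this is where \<open>np\<close> has to
  outgrow a large multiple of \<open>log n\<close>.

  The number 22 has to serve the expansion. The deleted choice is adversarial, so a bad cut is
  crossed by at most one choice per vertex instead of none, and the decay from the other 21 has to
  beat the number of pairs of vertex sets.\<close>

text \<open>The chain is generated with a direction: \<open>\<alpha>\<close> edges are walked from
  right to left, \<open>\<beta>\<close> edges from left to right. So a left vertex is only reached
  along an \<open>\<alpha>\<close> edge. This encodes the parity argument for bipartite graphs
  without extracting a path.\<close>

inductive_set kempe :: "'e set \<Rightarrow> ('e \<Rightarrow> 'l) \<Rightarrow> ('e \<Rightarrow> 'r) \<Rightarrow> ('e \<Rightarrow> 'k) \<Rightarrow> 'k \<Rightarrow> 'k \<Rightarrow> 'r \<Rightarrow> 'e set"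
  for X l r \<kappa> \<alpha> \<beta> b where
  start: "e \<in> X \<Longrightarrow> \<kappa> e = \<alpha> \<Longrightarrow> r e = b \<Longrightarrow> e \<in> kempe X l r \<kappa> \<alpha> \<beta> b"
| left: "e \<in> kempe X l r \<kappa> \<alpha> \<beta> b \<Longrightarrow> \<kappa> e = \<alpha> \<Longrightarrow> e' \<in> X \<Longrightarrow> \<kappa> e' = \<beta> \<Longrightarrow> l e' = l e \<Longrightarrow>
    e' \<in> kempe X l r \<kappa> \<alpha> \<beta> b"
| right: "e \<in> kempe X l r \<kappa> \<alpha> \<beta> b \<Longrightarrow> \<kappa> e = \<beta> \<Longrightarrow> e' \<in> X \<Longrightarrow> \<kappa> e' = \<alpha> \<Longrightarrow> r e' = r e \<Longrightarrow>
    e' \<in> kempe X l r \<kappa> \<alpha> \<beta> b"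

definition proper_colouring :: "'e set \<Rightarrow> ('e \<Rightarrow> 'l) \<Rightarrow> ('e \<Rightarrow> 'r) \<Rightarrow> ('e \<Rightarrow> 'k) \<Rightarrow> bool" where
  "proper_colouring X l r \<kappa> \<longleftrightarrow>
     (\<forall>e\<in>X. \<forall>e'\<in>X. \<kappa> e = \<kappa> e' \<longrightarrow> l e = l e' \<or> r e = r e' \<longrightarrow> e = e')"

text \<open>The chain is closed under passing to an adjacent edge of the other colour, so exchanging
  the colours on it stays proper. This frees \<open>\<alpha>\<close> at \<open>b\<close>, where
  \<open>\<beta>\<close> was missing, and leaves \<open>a\<close> alone: the chain could only reach
  \<open>a\<close> along an \<open>\<alpha>\<close> edge, and \<open>a\<close> has none.\<close>

lemma kempe_swap:
  assumes proper: "proper_colouring X l r \<kappa>" and ne: "\<alpha> \<noteq> \<beta>"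
    and a: "\<And>e. e \<in> X \<Longrightarrow> l e = a \<Longrightarrow> \<kappa> e \<noteq> \<alpha>"
    and b: "\<And>e. e \<in> X \<Longrightarrow> r e = b \<Longrightarrow> \<kappa> e \<noteq> \<beta>"
  defines "K \<equiv> kempe X l r \<kappa> \<alpha> \<beta> b"
  defines "\<kappa>' \<equiv> \<lambda>e. if e \<in> K then (if \<kappa> e = \<alpha> then \<beta> else \<alpha>) else \<kappa> e"
  shows "proper_colouring X l r \<kappa>'"
    and "\<And>e. e \<in> X \<Longrightarrow> l e = a \<Longrightarrow> \<kappa>' e \<noteq> \<alpha>"
    and "\<And>e. e \<in> X \<Longrightarrow> r e = b \<Longrightarrow> \<kappa>' e \<noteq> \<alpha>"
proof -
  have uniq: "\<And>e e'. e \<in> X \<Longrightarrow> e' \<in> X \<Longrightarrow> \<kappa> e = \<kappa> e' \<Longrightarrow> l e = l e' \<or> r e = r e' \<Longrightarrow> e = e'"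
    using proper unfolding proper_colouring_def by blast
  have K: "e \<in> X \<and> (\<kappa> e = \<alpha> \<or> \<kappa> e = \<beta>)" if "e \<in> K" for e
    using that unfolding K_def by cases auto
  \<comment> \<open>Closure against the direction of generation: the \<open>\<beta>\<close> edge
    that put \<open>e\<close> into the chain is, by properness, the only one at its right end, hence
    \<open>e'\<close>; at \<open>b\<close> there is none. \<open>leftK\<close> is the mirror
    image.\<close>
  have rightK: "e' \<in> K"
    if "e \<in> K" "\<kappa> e = \<alpha>" "e' \<in> X" "\<kappa> e' = \<beta>" "r e' = r e" for e e'
    using that(1)[unfolded K_def]
  proof cases
    case start
    then show ?thesis using b that by auto
  next
    case (right d)
    then have "d \<in> X" using K K_def by blast
    then have "d = e'" using uniq[of d e'] that right by auto
    then show ?thesis using right by (simp add: K_def)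
  qed (use that ne in auto)
  have leftK: "e' \<in> K"
    if "e \<in> K" "\<kappa> e = \<beta>" "e' \<in> X" "\<kappa> e' = \<alpha>" "l e' = l e" for e e'
    using that(1)[unfolded K_def]
  proof cases
    case (left d)
    then have "d \<in> X" using K K_def by blast
    then have "d = e'" using uniq[of d e'] that left by auto
    then show ?thesis using left by (simp add: K_def)
  qed (use that ne in auto)
  have closed: "e' \<in> K"
    if "e \<in> K" "e' \<in> X" "\<kappa> e' \<in> {\<alpha>, \<beta>}" "\<kappa> e' \<noteq> \<kappa> e" "l e' = l e \<or> r e' = r e" for e e'
  proof -
    have "\<kappa> e = \<alpha> \<and> \<kappa> e' = \<beta> \<or> \<kappa> e = \<beta> \<and> \<kappa> e' = \<alpha>" using K[OF that(1)] that ne by auto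
    then show ?thesis
      using that rightK[OF that(1)] leftK[OF that(1)] kempe.left[of e X l r \<kappa> \<alpha> \<beta> b e']
        kempe.right[of e X l r \<kappa> \<alpha> \<beta> b e'] unfolding K_def[symmetric] by blast
  qed
  show "proper_colouring X l r \<kappa>'"
    unfolding proper_colouring_def
  proof (intro ballI impI)
    fix e e' assume e: "e \<in> X" "e' \<in> X" "\<kappa>' e = \<kappa>' e'" "l e = l e' \<or> r e = r e'"
    have swapped: "\<kappa> e' = \<alpha> \<or> \<kappa> e' = \<beta>" "\<kappa> e \<noteq> \<kappa> e'"
      if "e \<in> K" "e' \<notin> K" "\<kappa>' e = \<kappa>' e'" for e e'
      using that K[OF that(1)] ne unfolding \<kappa>'_def by (auto split: if_splits)
    have transfer: "e' \<in> K"
      if "e \<in> K" "e' \<in> X" "\<kappa>' e = \<kappa>' e'" "l e' = l e \<or> r e' = r e" for e e'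
    proof (rule ccontr)
      assume "e' \<notin> K"
      then have "\<kappa> e' \<in> {\<alpha>, \<beta>}" "\<kappa> e' \<noteq> \<kappa> e" using swapped[OF that(1) _ that(3)] by auto
      then show False using closed[OF that(1,2) _ _ that(4)] \<open>e' \<notin> K\<close> by blast
    qed
    have "e \<in> K \<longleftrightarrow> e' \<in> K"
      using transfer[of e e'] transfer[of e' e] e by metis
    then have "\<kappa> e = \<kappa> e'"
      using e(3) K[of e] K[of e'] ne unfolding \<kappa>'_def by (auto split: if_splits)
    then show "e = e'" using uniq e by blast
  qed
  show "\<kappa>' e \<noteq> \<alpha>" if "e \<in> X" "l e = a" for e
  proof
    assume "\<kappa>' e = \<alpha>"
    then have e: "e \<in> K" "\<kappa> e = \<beta>"
      using a[OF that] K[of e] unfolding \<kappa>'_def by (auto split: if_splits)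
    from e(1) show False unfolding K_def
    proof cases
      case (left d)
      then have "d \<in> X" using K K_def by blast
      then show False using a[of d] left that by auto
    qed (use e ne in auto)
  qed
  show "\<kappa>' e \<noteq> \<alpha>" if "e \<in> X" "r e = b" for e
    using kempe.start[of e X \<kappa> \<alpha> r b l \<beta>] b[OF that] K[of e] that ne
    unfolding \<kappa>'_def K_def by (auto split: if_splits)
qed

text \<open>Edges are inserted one at a time. Each end of the new edge \<open>z\<close> carries at
  most \<open>T - 1\<close> coloured edges, so some \<open>\<alpha>\<close> is missing at the left
  end and some \<open>\<beta>\<close> at the right end; if they differ, a Kempe exchange makes
  \<open>\<alpha>\<close> missing at both.\<close>

theorem bipartite_edge_colouring:
  assumes "finite X"
    and "\<And>x. card {e \<in> X. l e = x} \<le> T" "\<And>y. card {e \<in> X. r e = y} \<le> T"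
  shows "\<exists>\<kappa>. \<kappa> ` X \<subseteq> {..<T::nat} \<and> proper_colouring X l r \<kappa>"
  using assms
proof (induction X rule: finite_induct)
  case empty
  then show ?case by (simp add: proper_colouring_def)
next
  case (insert z X)
  have le: "card {e \<in> X. P e} \<le> card {e \<in> insert z X. P e}" for P
    using insert.hyps by (intro card_mono) auto
  obtain \<kappa> where \<kappa>: "\<kappa> ` X \<subseteq> {..<T}" "proper_colouring X l r \<kappa>"
    using insert.IH insert.prems le by (meson le_trans)
  have missing: "\<exists>\<alpha><T. \<forall>e\<in>X. P e \<longrightarrow> \<kappa> e \<noteq> \<alpha>"
    if "card {e \<in> insert z X. P e} \<le> T" "P z" for P
  proof (rule ccontr)
    assume "\<not> ?thesis"
    then have "{..<T} \<subseteq> \<kappa> ` {e \<in> X. P e}" by fastforce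
    then have "T \<le> card (\<kappa> ` {e \<in> X. P e})"
      using insert.hyps by (metis card_lessThan card_mono finite_Collect_conjI finite_imageI Collect_mem_eq)
    also have "\<dots> \<le> card {e \<in> X. P e}" using insert.hyps by (intro card_image_le) auto
    also have "\<dots> < card (insert z {e \<in> X. P e})" using insert.hyps by auto
    also have "insert z {e \<in> X. P e} = {e \<in> insert z X. P e}" using that by auto
    finally show False using that by simp
  qed
  obtain \<alpha> where \<alpha>: "\<alpha> < T" "\<forall>e\<in>X. l e = l z \<longrightarrow> \<kappa> e \<noteq> \<alpha>"
    using missing[of "\<lambda>e. l e = l z"] insert.prems(1) by auto
  obtain \<beta> where \<beta>: "\<beta> < T" "\<forall>e\<in>X. r e = r z \<longrightarrow> \<kappa> e \<noteq> \<beta>"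
    using missing[of "\<lambda>e. r e = r z"] insert.prems(2) by auto
  obtain \<kappa>' where \<kappa>': "\<kappa>' ` X \<subseteq> {..<T}" "proper_colouring X l r \<kappa>'"
    "\<And>e. e \<in> X \<Longrightarrow> l e = l z \<Longrightarrow> \<kappa>' e \<noteq> \<alpha>" "\<And>e. e \<in> X \<Longrightarrow> r e = r z \<Longrightarrow> \<kappa>' e \<noteq> \<alpha>"
  proof (cases "\<alpha> = \<beta>")
    case True
    then show ?thesis using that[of \<kappa>] \<kappa> \<alpha> \<beta> by auto
  next
    case False
    show ?thesis
    proof (rule that)
      show "(\<lambda>e. if e \<in> kempe X l r \<kappa> \<alpha> \<beta> (r z) then if \<kappa> e = \<alpha> then \<beta> else \<alpha> else \<kappa> e) ` X \<subseteq> {..<T}"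
        using \<kappa> \<alpha> \<beta> by auto
    qed (use kempe_swap[OF \<kappa>(2) False, of "l z" "r z"] \<alpha> \<beta> in auto)
  qed
  have "proper_colouring (insert z X) l r (\<kappa>'(z := \<alpha>))"
    unfolding proper_colouring_def
  proof (intro ballI impI)
    fix e e'
    assume *: "e \<in> insert z X" "e' \<in> insert z X" "(\<kappa>'(z := \<alpha>)) e = (\<kappa>'(z := \<alpha>)) e'"
      "l e = l e' \<or> r e = r e'"
    consider "e = z" "e' = z" | "e = z" "e' \<noteq> z" "e' \<in> X" | "e \<noteq> z" "e' = z" "e \<in> X"
      | "e \<noteq> z" "e' \<noteq> z" "e \<in> X" "e' \<in> X" using * by blast
    then show "e = e'"
    proof cases
      case 2
      then show ?thesis using \<kappa>'(3)[of e'] \<kappa>'(4)[of e'] *(3,4) by auto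
    next
      case 3
      then show ?thesis using \<kappa>'(3)[of e] \<kappa>'(4)[of e] *(3,4) by auto
    next
      case 4
      then have "\<kappa>' e = \<kappa>' e'" using *(3) by simp
      then show ?thesis using \<kappa>'(2) 4 *(4) unfolding proper_colouring_def by blast
    qed auto
  qed
  moreover have "(\<kappa>'(z := \<alpha>)) ` insert z X \<subseteq> {..<T}"
    using \<kappa>' \<alpha> insert.hyps by (auto split: if_splits)
  ultimately show ?case by blast
qed

section \<open>Paths and rotations\<close>

fun path_edges :: "'a list \<Rightarrow> 'a set set" where
  "path_edges (x # y # xs) = insert {x, y} (path_edges (y # xs))"
| "path_edges _ = {}"

lemma path_edges_append:
  assumes "xs \<noteq> []" "ys \<noteq> []"
  shows "path_edges (xs @ ys) = path_edges xs \<union> path_edges ys \<union> {{last xs, hd ys}}"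
  using assms
proof (induction xs rule: path_edges.induct)
  case (1 x y zs)
  then show ?case by auto
next
  case ("2_2" v)
  then show ?case by (cases ys) auto
qed auto

lemma path_edges_rev: "path_edges (rev xs) = path_edges xs"
proof (induction xs rule: path_edges.induct)
  case (1 x y xs)
  have "path_edges (rev (y # xs) @ [x]) = path_edges (rev (y # xs)) \<union> {{y, x}}"
    using path_edges_append[of "rev (y # xs)" "[x]"] by simp
  then show ?case using 1 by (simp add: insert_commute)
qed auto

lemma path_edges_subset: "e \<in> path_edges xs \<Longrightarrow> e \<subseteq> set xs"
  by (induction xs rule: path_edges.induct) auto

lemma finite_path_edges [simp]: "finite (path_edges xs)"
  by (induction xs rule: path_edges.induct) auto

lemma card_path_edges: "card (path_edges xs) \<le> length xs - 1"
proof (induction xs rule: path_edges.induct)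
  case (1 x y xs)
  then show ?case
    by (simp add: card_insert_if)
qed auto

lemma card_path_edges_hd:
  assumes "distinct xs" "xs \<noteq> []"
  shows "card {e \<in> path_edges xs. hd xs \<in> e} \<le> 1"
proof (cases xs rule: path_edges.cases)
  case (1 x y zs)
  have "{e \<in> path_edges xs. hd xs \<in> e} \<subseteq> {{x, y}}"
    using 1 assms(1) path_edges_subset[of _ "y # zs"] by auto
  then show ?thesis using card_mono[of "{{x,y}}"] by fastforce
qed (use assms in auto)

lemma card_path_edges_last:
  assumes "distinct xs" "xs \<noteq> []"
  shows "card {e \<in> path_edges xs. last xs \<in> e} \<le> 1"
  using card_path_edges_hd[of "rev xs"] assms by (simp add: path_edges_rev hd_rev)

lemma card_path_edges_at:
  assumes "distinct xs"
  shows "card {e \<in> path_edges xs. v \<in> e} \<le> 2"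
proof (cases "v \<in> set xs")
  case True
  then obtain ys zs where xs: "xs = ys @ v # zs" by (meson split_list)
  show ?thesis
  proof (cases "ys = []")
    case True
    then show ?thesis using card_path_edges_hd[OF assms] xs by auto
  next
    case False
    then have "path_edges xs = path_edges (ys @ [v]) \<union> path_edges (v # zs)"
      using path_edges_append[of ys "v # zs"] path_edges_append[of ys "[v]"] xs by auto
    then have "{e \<in> path_edges xs. v \<in> e} =
        {e \<in> path_edges (ys @ [v]). last (ys @ [v]) \<in> e} \<union> {e \<in> path_edges (v # zs). hd (v # zs) \<in> e}"
      by auto
    also have "card \<dots> \<le> 1 + 1"
      using card_path_edges_last[of "ys @ [v]"] card_path_edges_hd[of "v # zs"] assms xs
      by (intro order.trans[OF card_Un_le] add_mono) auto
    finally show ?thesis by simp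
  qed
next
  case False
  then have "{e \<in> path_edges xs. v \<in> e} = {}"
    using path_edges_subset by fastforce
  then show ?thesis by (simp only: card.empty)
qed

section \<open>Longest paths, expanders and Posa rotations\<close>

definition is_path :: "'a set \<Rightarrow> 'a set set \<Rightarrow> 'a list \<Rightarrow> bool" where
  "is_path V E xs \<longleftrightarrow> xs \<noteq> [] \<and> distinct xs \<and> set xs \<subseteq> V \<and> path_edges xs \<subseteq> E"

definition longest_path :: "'a set \<Rightarrow> 'a set set \<Rightarrow> 'a list \<Rightarrow> bool" where
  "longest_path V E xs \<longleftrightarrow>
     is_path V E xs \<and> (\<forall>ys. is_path V E ys \<longrightarrow> length ys \<le> length xs)"

definition nbhd :: "'a set \<Rightarrow> 'a set set \<Rightarrow> 'a set \<Rightarrow> 'a set" where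
  "nbhd V E S = {w \<in> V. \<exists>s\<in>S. {s, w} \<in> E}"

text \<open>The factor 3 asks for \<open>2 * card S\<close> new vertices, which is just what the
  strict bound in \<open>card_path_neighbours\<close> contradicts.\<close>

definition expander :: "'a set \<Rightarrow> 'a set set \<Rightarrow> bool" where
  "expander V E \<longleftrightarrow>
     (\<forall>S\<subseteq>V. S \<noteq> {} \<longrightarrow> 4 * card S \<le> card V \<longrightarrow> 3 * card S \<le> card (S \<union> nbhd V E S))"

lemma expander_mono: 
  assumes "expander V E" "E \<subseteq> E'" "finite V"
  shows "expander V E'"
  unfolding expander_def
proof (intro allI impI)
  fix S assume S: "S \<subseteq> V" "S \<noteq> {}" "4 * card S \<le> card V"
  then have "3 * card S \<le> card (S \<union> nbhd V E S)"
    using assms(1) unfolding expander_def by auto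
  also have "\<dots> \<le> card (S \<union> nbhd V E' S)"
    using assms(2,3) S(1) by (intro card_mono) (auto simp: nbhd_def finite_subset)
  finally show "3 * card S \<le> card (S \<union> nbhd V E' S)" .
qed

lemma longest_path_exists:
  assumes "finite V" "V \<noteq> {}"
  obtains xs where "longest_path V E xs"
proof -
  obtain v where v: "v \<in> V" using assms by auto
  have "is_path V E [v]" using v by (simp add: is_path_def)
  moreover have "\<And>ys. is_path V E ys \<Longrightarrow> length ys < Suc (card V)"
    unfolding is_path_def using assms(1) by (metis card_mono distinct_card le_imp_less_Suc)
  ultimately obtain xs where "is_path V E xs" "\<forall>ys. is_path V E ys \<longrightarrow> length ys \<le> length xs"
    using ex_has_greatest_nat[of "is_path V E" "[v]" length "Suc (card V)"] by (metis less_imp_le)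
  then show ?thesis using that unfolding longest_path_def by blast
qed

lemma longest_path_rev: "longest_path V E xs \<Longrightarrow> longest_path V E (rev xs)"
  by (auto simp: longest_path_def is_path_def[of _ _ xs] is_path_def[of _ _ "rev xs"] path_edges_rev)

lemma longest_path_extend:
  assumes "longest_path V E xs" "{last xs, y} \<in> E" "y \<in> V"
  shows "y \<in> set xs"
proof (rule ccontr)
  assume "y \<notin> set xs"
  then have "is_path V E (xs @ [y])"
    using assms path_edges_append[of xs "[y]"] unfolding longest_path_def is_path_def by auto
  then show False using assms(1) unfolding longest_path_def by fastforce
qed

text \<open>Joining the last vertex to \<open>y\<close> and dropping the edge from \<open>y\<close>
  to \<open>hd zs\<close> makes \<open>hd zs\<close> the new last vertex, while the first vertex
  stays fixed.\<close>

inductive_set rotations :: "'a set set \<Rightarrow> 'a list \<Rightarrow> 'a list set" for E P where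
  start: "P \<in> rotations E P"
| rotate: "ys @ y # zs \<in> rotations E P \<Longrightarrow> zs \<noteq> [] \<Longrightarrow> {last zs, y} \<in> E \<Longrightarrow>
    ys @ y # rev zs \<in> rotations E P"

lemma path_edges_rotate:
  assumes "distinct (ys @ y # zs)" "zs \<noteq> []"
  shows "path_edges (ys @ y # rev zs) =
    path_edges (ys @ y # zs) - {{y, hd zs}} \<union> {{last zs, y}}"
proof -
  have split: "path_edges (ys @ y # ws) = path_edges (ys @ [y]) \<union> path_edges ws \<union> {{y, hd ws}}"
    if "ws \<noteq> []" for ws
    using path_edges_append[of "ys @ [y]" ws] that by simp
  have "hd zs \<notin> set (ys @ [y])"
    using assms hd_in_set[OF assms(2)] by (auto simp del: hd_in_set)
  then have "{y, hd zs} \<notin> path_edges (ys @ [y])"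
    using path_edges_subset[of "{y, hd zs}" "ys @ [y]"] by blast
  moreover have "{y, hd zs} \<notin> path_edges zs"
    using path_edges_subset[of "{y, hd zs}" "zs"] assms by auto
  ultimately show ?thesis
    using split[of zs] split[of "rev zs"] assms(2) by (auto simp: path_edges_rev hd_rev insert_commute)
qed

lemma rotations_longest:
  assumes "Q \<in> rotations E P" "longest_path V E P"
  shows "longest_path V E Q \<and> hd Q = hd P"
  using assms
proof (induction rule: rotations.induct)
  case (rotate ys y zs)
  then have IH: "longest_path V E (ys @ y # zs)" "hd (ys @ y # zs) = hd P" by auto
  then have "path_edges (ys @ y # rev zs) \<subseteq> E"
    using path_edges_rotate[of ys y zs] rotate.hyps unfolding longest_path_def is_path_def by auto
  then show ?case using IH unfolding longest_path_def is_path_def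
    by (cases ys) auto
qed auto

text \<open>Posa's argument: an edge of \<open>P\<close> can only be removed by a rotation that makes one of its
  ends the endpoint of the path, so it survives at every vertex outside \<open>R\<close> and its
  \<open>P\<close>-neighbours.\<close>

lemma posa_neighbourhood:
  assumes longest: "longest_path V E P"
  defines "R \<equiv> last ` rotations E P"
  shows "nbhd V E R \<subseteq> R \<union> {v. \<exists>r\<in>R. {v, r} \<in> path_edges P}"
proof
  fix y assume "y \<in> nbhd V E R"
  then obtain Q where Q: "Q \<in> rotations E P" "{last Q, y} \<in> E" and yV: "y \<in> V"
    unfolding nbhd_def R_def by auto
  have keep: "{e \<in> path_edges Q. v \<in> e} = {e \<in> path_edges P. v \<in> e}"
    if "Q \<in> rotations E P" "v \<notin> R" and free: "\<And>r. r \<in> R \<Longrightarrow> {v, r} \<notin> path_edges P" for Q v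
    using that(1)
  proof (induction rule: rotations.induct)
    case (rotate ys y zs)
    have d: "distinct (ys @ y # zs)"
      using rotations_longest[OF rotate.hyps(1) longest] unfolding longest_path_def is_path_def by auto
    have "ys @ y # rev zs \<in> rotations E P"
      using rotate.hyps by (rule rotations.rotate)
    then have h: "hd zs \<in> R" unfolding R_def using rotate.hyps(2)
      by (metis (no_types, lifting) image_eqI last.simps last_appendR last_rev list.distinct(1) rev_is_Nil_conv)
    have l: "last zs \<in> R" unfolding R_def using rotate.hyps(1,2)
      by (metis (no_types, lifting) image_eqI last.simps last_appendR list.distinct(1))
    \<comment> \<open>If \<open>v\<close> were the pivot, the dropped edge to \<open>hd zs\<close>
      would by induction be an edge of \<open>P\<close>, and \<open>v\<close> would be a
      \<open>P\<close>-neighbour of the endpoint \<open>hd zs\<close>.\<close>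
    have "v \<noteq> y"
    proof
      assume "v = y"
      moreover have "{y, hd zs} \<in> path_edges (ys @ y # zs)"
        using path_edges_append[of "ys @ [y]" zs] rotate.hyps(2) by auto
      ultimately have "{v, hd zs} \<in> path_edges P" using rotate.IH by auto
      then show False using free h by blast
    qed
    moreover have "v \<noteq> hd zs" "v \<noteq> last zs" using h l that(2) by auto
    ultimately show ?case
      using path_edges_rotate[OF d rotate.hyps(2)] rotate.IH by auto
  qed auto
  show "y \<in> R \<union> {v. \<exists>r\<in>R. {v, r} \<in> path_edges P}"
  proof (rule ccontr)
    assume "\<not> ?thesis"
    then have y: "y \<notin> R" "\<And>r. r \<in> R \<Longrightarrow> {y, r} \<notin> path_edges P" by auto
    have LQ: "longest_path V E Q" using rotations_longest[OF Q(1) longest] by simp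
    then have "y \<in> set Q" using longest_path_extend Q(2) yV by metis
    then obtain ys zs where split: "Q = ys @ y # zs" by (meson split_list)
    have "last Q \<in> R" unfolding R_def using Q by auto
    then have zs: "zs \<noteq> []" using y(1) split by auto
    have "ys @ y # rev zs \<in> rotations E P"
      using Q split zs by (intro rotations.rotate) auto
    then have h: "hd zs \<in> R" unfolding R_def using zs
      by (metis (no_types, lifting) image_eqI last.simps last_appendR last_rev list.distinct(1) rev_is_Nil_conv)
    have "{y, hd zs} \<in> path_edges Q"
      using path_edges_append[of "ys @ [y]" zs] zs split by auto
    then have "{y, hd zs} \<in> path_edges P" using keep[OF Q(1) y] by auto
    then show False using y h by blast
  qed
qed

text \<open>A vertex has at most two neighbours on a path but the last vertex at most one; this
  single saving makes the inequality strict.\<close>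

lemma card_path_neighbours:
  assumes "distinct P" "P \<noteq> []" "finite R" "last P \<in> R"
  shows "card {v. \<exists>r\<in>R. {v, r} \<in> path_edges P} < 2 * card R"
proof -
  define N where "N r = {v. {v, r} \<in> path_edges P}" for r
  have N: "card (N r) \<le> card {e \<in> path_edges P. r \<in> e}" for r
    unfolding N_def
    by (rule card_inj_on_le[where f = "\<lambda>v. {v, r}"]) (auto simp: inj_on_def doubleton_eq_iff)
  have "{v. \<exists>r\<in>R. {v, r} \<in> path_edges P} = N (last P) \<union> (\<Union>r\<in>R - {last P}. N r)"
    unfolding N_def using assms(4) by auto
  also have "card \<dots> \<le> card (N (last P)) + (\<Sum>r\<in>R - {last P}. card (N r))"
    using assms(3) by (intro order.trans[OF card_Un_le] add_left_mono card_UN_le) auto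
  also have "\<dots> \<le> 1 + (\<Sum>r\<in>R - {last P}. 2)"
    using N card_path_edges_last[OF assms(1,2)] card_path_edges_at[OF assms(1)]
    by (intro add_mono sum_mono) (meson order_trans)+
  also have "\<dots> < 2 * card R"
    using assms(3,4) card_Suc_Diff1[of R "last P"] by simp
  finally show ?thesis .
qed

text \<open>If the set \<open>R\<close> of endpoints reached by rotations had at most a quarter of
  the vertices, expansion would give \<open>3 * card R\<close> vertices in \<open>R\<close> and its
  neighbourhood, while Posa's inclusion allows fewer. The conclusion passes to all ends of longest
  paths with this head, because that relation is symmetric.\<close>

lemma posa_endpoints:
  assumes "finite V" "expander V E" "longest_path V E P"
  shows "card V < 4 * card {b. \<exists>Q. longest_path V E Q \<and> hd Q = hd P \<and> last Q = b}"
    (is "_ < 4 * card ?B")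
proof -
  define R where "R = last ` rotations E P"
  have RB: "R \<subseteq> ?B" unfolding R_def using rotations_longest[OF _ assms(3)] by auto
  have BV: "?B \<subseteq> V" unfolding longest_path_def is_path_def using last_in_set by blast
  have RV: "R \<subseteq> V" using RB BV by (rule order_trans)
  then have fin: "finite R" using assms(1) by (rule finite_subset)
  have lP: "last P \<in> R" unfolding R_def using rotations.start by auto
  have dP: "distinct P" "P \<noteq> []" using assms(3) unfolding longest_path_def is_path_def by auto
  have "\<not> 4 * card R \<le> card V"
  proof
    assume small: "4 * card R \<le> card V"
    have *: "R \<union> nbhd V E R \<subseteq> R \<union> {v. \<exists>r\<in>R. {v, r} \<in> path_edges P}"
      using posa_neighbourhood[OF assms(3)] R_def by blast
    have fin2: "finite {v. \<exists>r\<in>R. {v, r} \<in> path_edges P}"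
    proof (rule finite_subset)
      show "{v. \<exists>r\<in>R. {v, r} \<in> path_edges P} \<subseteq> set P"
        using path_edges_subset by fastforce
    qed simp
    have "3 * card R \<le> card (R \<union> nbhd V E R)"
      using assms(2) RV small lP unfolding expander_def by blast
    also have "\<dots> \<le> card R + card {v. \<exists>r\<in>R. {v, r} \<in> path_edges P}"
      using fin fin2 * by (meson card_Un_le card_mono finite_UnI order_trans)
    also have "\<dots> < 3 * card R" using card_path_neighbours[OF dP fin lP] by simp
    finally show False by simp
  qed
  moreover have "card R \<le> card ?B" using RB BV assms(1) by (meson card_mono finite_subset)
  ultimately show ?thesis by linarith
qed

text \<open>A small nonempty set has to triple, so it is not closed. A larger closed set contains a
  subset of size \<open>card V div 4\<close>, whose expansion stays inside it.\<close>

lemma expander_closed: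
  assumes "finite V" "expander V E" "X \<subseteq> V" "X \<noteq> {}" "nbhd V E X \<subseteq> X"
  shows "3 * (card V div 4) \<le> card X"
proof (cases "4 * card X \<le> card V")
  case True
  have "X \<union> nbhd V E X = X" using assms by auto
  then show ?thesis
    using assms True unfolding expander_def
    by (metis (no_types, lifting) card_gt_0_iff finite_subset linorder_not_le mult_less_cancel2 mult_1 one_less_numeral_iff semiring_norm(77))
next
  case False
  then have "card V div 4 \<le> card X" by linarith
  then obtain Y where Y: "Y \<subseteq> X" "card Y = card V div 4"
    by (meson assms(1,3) obtain_subset_with_card_n)
  show ?thesis
  proof (cases "Y = {}")
    case False
    have "3 * card Y \<le> card (Y \<union> nbhd V E Y)"
    proof -
      have "4 * card Y \<le> card V" using Y(2) by simp
      moreover have "Y \<subseteq> V" using Y(1) assms(3) by blast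
      ultimately show ?thesis using assms(2) False unfolding expander_def by blast
    qed
    also have "\<dots> \<le> card X"
    proof (rule card_mono)
      show "finite X" using assms(1,3) by (rule rev_finite_subset)
      show "Y \<union> nbhd V E Y \<subseteq> X" using Y assms(5) unfolding nbhd_def by auto
    qed
    finally show ?thesis using Y by simp
  qed (use Y in auto)
qed

text \<open>Otherwise \<open>X\<close> and its complement are both closed, and
  \<open>6 * (card V div 4)\<close> exceeds \<open>card V\<close> as soon as \<open>card V\<close>
  is at least 10.\<close>

lemma expander_connected:
  assumes "finite V" "expander V E" "X \<subset> V" "X \<noteq> {}" "10 \<le> card V"
  obtains y z where "y \<in> X" "z \<in> V - X" "{y, z} \<in> E"
proof -
  have "\<not> (nbhd V E X \<subseteq> X)"
  proof
    assume cl: "nbhd V E X \<subseteq> X"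
    then have "nbhd V E (V - X) \<subseteq> V - X"
      unfolding nbhd_def by (auto, metis (mono_tags, lifting) insert_commute mem_Collect_eq subsetD)
    then have "3 * (card V div 4) \<le> card (V - X)"
      using assms by (intro expander_closed) auto
    moreover have "3 * (card V div 4) \<le> card X"
      using assms cl by (intro expander_closed) auto
    moreover have "card V = card X + card (V - X)"
      using assms(1,3) by (metis card_Diff_subset card_mono finite_subset le_add_diff_inverse psubset_imp_subset)
    ultimately show False using assms(5) by linarith
  qed
  then show ?thesis using that unfolding nbhd_def by auto
qed

lemma cycle_edges_eq:
  assumes "vs \<noteq> []"
  shows "cycle_edges vs = path_edges vs \<union> {{last vs, hd vs}}"
proof -
  have p: "path_edges vs = {{vs ! i, vs ! Suc i} | i. Suc i < length vs}" for vs :: "nat list"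
  proof (induction vs rule: path_edges.induct)
    case (1 x y xs)
    have "{{(x # y # xs) ! i, (x # y # xs) ! Suc i} |i. Suc i < length (x # y # xs)} =
      insert {x, y} {{(y # xs) ! i, (y # xs) ! Suc i} |i. Suc i < length (y # xs)}" (is "?A = ?B")
    proof
      show "?A \<subseteq> ?B"
      proof
        fix e assume "e \<in> ?A"
        then obtain i where "e = {(x # y # xs) ! i, (x # y # xs) ! Suc i}" "Suc i < length (x # y # xs)" by blast
        then show "e \<in> ?B" by (cases i) auto
      qed
      show "?B \<subseteq> ?A"
      proof
        fix e assume "e \<in> ?B"
        then consider "e = {x, y}"
          | i where "e = {(y # xs) ! i, (y # xs) ! Suc i}" "Suc i < length (y # xs)" by blast
        then show "e \<in> ?A"
        proof cases
          case 1
          then show ?thesis by (intro CollectI exI[of _ 0]) simp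
        next
          case (2 i)
          then show ?thesis by (intro CollectI exI[of _ "Suc i"]) simp
        qed
      qed
    qed
    then show ?case using 1 by simp
  qed auto
  define m where "m = length vs - 1"
  have m: "length vs = Suc m" using assms unfolding m_def by (cases vs) auto
  have "{{vs ! i, vs ! (Suc i mod Suc m)} | i. i < Suc m} =
      (\<lambda>i. {vs ! i, vs ! (Suc i mod Suc m)}) ` {..<Suc m}" by auto
  also have "\<dots> = {{vs ! m, vs ! 0}} \<union> (\<lambda>i. {vs ! i, vs ! (Suc i mod Suc m)}) ` {..<m}"
    unfolding lessThan_Suc by simp
  also have "(\<lambda>i. {vs ! i, vs ! (Suc i mod Suc m)}) ` {..<m} = (\<lambda>i. {vs ! i, vs ! Suc i}) ` {..<m}"
    by (intro image_cong) auto
  also have "\<dots> = {{vs ! i, vs ! Suc i} | i. i < m}" by auto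
  finally have "{{vs ! i, vs ! (Suc i mod Suc m)} | i. i < Suc m} =
        {{vs ! i, vs ! Suc i} | i. i < m} \<union> {{vs ! m, vs ! 0}}" by (simp only: Un_commute)
  then show ?thesis
    unfolding cycle_edges_def p using assms m by (simp add: last_conv_nth hd_conv_nth)
qed

definition hamiltonian :: "nat \<Rightarrow> nat set set \<Rightarrow> bool" where
  "hamiltonian n E \<longleftrightarrow>
     (\<exists>vs. 3 \<le> length vs \<and> distinct vs \<and> set vs = {..<n} \<and> cycle_edges vs \<subseteq> E)"

text \<open>If the cycle obtained misses a vertex, some edge leaves it by connectedness; opening the
  cycle there gives a longest path that can be extended.\<close>

lemma longest_path_closed_hamiltonian:
  assumes "10 \<le> n" "expander {..<n} E" "longest_path {..<n} E P" "{last P, hd P} \<in> E"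
  shows "hamiltonian n E"
proof (cases "set P = {..<n}")
  case True
  then have "length P = n" using assms(3) distinct_card[of P] unfolding longest_path_def is_path_def by auto
  then show ?thesis
    unfolding hamiltonian_def using assms True cycle_edges_eq[of P]
    by (intro exI[of _ P]) (auto simp: longest_path_def is_path_def)
next
  case False
  have P: "P \<noteq> []" "distinct P" "set P \<subseteq> {..<n}" "path_edges P \<subseteq> E"
    using assms(3) unfolding longest_path_def is_path_def by auto
  have "set P \<subset> {..<n}" using P False by blast
  then obtain y z where yz: "y \<in> set P" "z \<in> {..<n} - set P" "{y, z} \<in> E"
    using expander_connected[of "{..<n}" E "set P"] P assms by auto
  then obtain as bs where split: "P = as @ y # bs" by (meson split_list)
  \<comment> \<open>The cycle cut open just after \<open>y\<close>; the closing edge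
    \<open>{last P, hd P}\<close> joins \<open>bs\<close> to the rest.\<close>
  have "is_path {..<n} E (bs @ as @ [y])"
    using P split assms(4) path_edges_append[of "as @ [y]" bs] path_edges_append[of bs "as @ [y]"]
    unfolding is_path_def by (cases "bs = []") (auto simp: hd_append)
  then have "longest_path {..<n} E (bs @ as @ [y])"
    using assms(3) split unfolding longest_path_def by auto
  then have "z \<in> set (bs @ as @ [y])" using longest_path_extend yz by fastforce
  then show ?thesis using yz split by auto
qed

section \<open>Random choices along an orientation of the complete graph\<close>

text \<open>An explicit almost regular tournament: a pair belongs to its smaller vertex if the sum
  is even and to its larger one otherwise, so a vertex owns between \<open>n/2 - 1\<close> and
  \<open>n/2\<close> pairs.\<close>

definition heads :: "nat \<Rightarrow> nat \<Rightarrow> nat set" where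
  "heads n u = {w. w < n \<and> (u < w \<and> even (u + w) \<or> w < u \<and> odd (u + w))}"

lemma finite_heads [simp]: "finite (heads n u)"
  by (rule finite_subset[of _ "{..<n}"]) (auto simp: heads_def)

lemma heads_less: "w \<in> heads n u \<Longrightarrow> w < n"
  and heads_neq: "w \<in> heads n u \<Longrightarrow> w \<noteq> u"
  by (auto simp: heads_def)

lemma heads_tournament:
  assumes "u < n" "w < n" "u \<noteq> w"
  shows "w \<in> heads n u \<longleftrightarrow> u \<notin> heads n w"
  using assms by (auto simp: heads_def add.commute)

lemma card_less_Suc_filter:
  "card {w. w < Suc m \<and> P w} = card {w. w < m \<and> P w} + (if P m then 1 else 0)"
proof (cases "P m")
  case True
  then have "{w. w < Suc m \<and> P w} = insert m {w. w < m \<and> P w}" by (auto simp: less_Suc_eq)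
  then show ?thesis using True by simp
next
  case False
  then have "{w. w < Suc m \<and> P w} = {w. w < m \<and> P w}" using less_Suc_eq by blast
  then show ?thesis using False by simp
qed

lemma card_heads:
  assumes "u < n"
  shows "card (heads n u) = (n - 1 - u) div 2 + (u + 1) div 2"
proof -
  have lower: "card {w. w < m \<and> odd (u + w)} = (if even u then m div 2 else (m + 1) div 2)" for m
  proof (induction m)
    case (Suc m)
    show ?case unfolding card_less_Suc_filter Suc by (cases "even u"; cases "even m") auto
  qed auto
  have upper: "card {w. w < u + 1 + m \<and> u < w \<and> even (u + w)} = m div 2" for m
  proof (induction m)
    case 0
    have "{w. w < u + 1 + 0 \<and> u < w \<and> even (u + w)} = {}" by auto
    then show ?case by (simp only: card.empty)
  next
    case (Suc m)
    show ?case unfolding add_Suc_right card_less_Suc_filter Suc by (cases "even m") auto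
  qed
  have "heads n u = {w. w < n \<and> u < w \<and> even (u + w)} \<union> {w. w < u \<and> odd (u + w)}"
    unfolding heads_def using less_trans[OF _ assms] by blast
  moreover have "{w. w < n \<and> u < w \<and> even (u + w)} \<inter> {w. w < u \<and> odd (u + w)} = {}" by blast
  ultimately have *: "card (heads n u) =
      card {w. w < n \<and> u < w \<and> even (u + w)} + card {w. w < u \<and> odd (u + w)}"
    by (simp add: card_Un_disjoint)
  have "u + 1 + (n - 1 - u) = n" using assms by simp
  then have "card {w. w < n \<and> u < w \<and> even (u + w)} = (n - 1 - u) div 2"
    using upper[of "n - 1 - u"] by (simp only:)
  moreover have "card {w. w < u \<and> odd (u + w)} = (u + 1) div 2"
    unfolding lower by (cases "even u") (auto elim: evenE)
  ultimately show ?thesis unfolding * by (simp only:)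
qed

lemma card_heads_le: "u < n \<Longrightarrow> 2 * card (heads n u) \<le> n"
  and card_heads_ge: "u < n \<Longrightarrow> n \<le> 2 * card (heads n u) + 2"
  by (simp_all add: card_heads)

text \<open>Choices with replacement, so that slots are independent; probabilities are proportions
  of this finite set.\<close>

definition picks :: "nat \<Rightarrow> nat \<Rightarrow> (nat \<Rightarrow> nat \<Rightarrow> nat) set" where
  "picks n k = (\<Pi>\<^sub>E u\<in>{..<n}. \<Pi>\<^sub>E i\<in>{..<k}. heads n u)"

text \<open>\<open>I u\<close> holds the slots kept at \<open>u\<close>: all of them, or all but a
  red one.\<close>

definition picked_graph :: "nat \<Rightarrow> (nat \<Rightarrow> nat set) \<Rightarrow> (nat \<Rightarrow> nat \<Rightarrow> nat) \<Rightarrow> nat set set" where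
  "picked_graph n I f = {{u, f u i} | u i. u < n \<and> i \<in> I u}"

lemma finite_picks [simp]: "finite (picks n k)"
  unfolding picks_def by (intro finite_PiE ballI) auto

lemma card_picks: "card (picks n k) = (\<Prod>u<n. card (heads n u) ^ k)"
  unfolding picks_def by (simp add: card_PiE)

lemma picks_heads: "f \<in> picks n k \<Longrightarrow> u < n \<Longrightarrow> i < k \<Longrightarrow> f u i \<in> heads n u"
  unfolding picks_def by (meson PiE_mem lessThan_iff)

lemma picked_graph_mono: "(\<And>u. u < n \<Longrightarrow> I u \<subseteq> J u) \<Longrightarrow> picked_graph n I f \<subseteq> picked_graph n J f"
  unfolding picked_graph_def by blast

text \<open>Adding an edge from \<open>u\<close> to one of its booster heads closes a longest path.\<close>

definition booster_heads :: "nat \<Rightarrow> nat set set \<Rightarrow> nat \<Rightarrow> nat set" where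
  "booster_heads n E u = {w \<in> heads n u. \<exists>P. longest_path {..<n} E P \<and> hd P = u \<and> last P = w}"

text \<open>Posa's bound is used twice: a longest path with head \<open>a\<close> has more than
  \<open>n/4\<close> possible ends, and by reversal each of them is itself a head with more than
  \<open>n/4\<close> ends. Of these more than \<open>n^2/16\<close> ordered pairs, at least half are
  owned by their first vertex.\<close>

lemma card_boosters:
  assumes "10 \<le> n" "expander {..<n} E"
  shows "n\<^sup>2 \<le> 32 * (\<Sum>u<n. card (booster_heads n E u))"
proof -
  define V where "V = {..<n}"
  have V: "finite V" "card V = n" "V \<noteq> {}" using assms(1) by (auto simp: V_def lessThan_empty_iff)
  define Q where "Q a = {b. \<exists>P. longest_path V E P \<and> hd P = a \<and> last P = b}" for a
  have Qsym: "b \<in> Q a \<Longrightarrow> a \<in> Q b" for a b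
  proof -
    assume "b \<in> Q a"
    then obtain P where P: "longest_path V E P" "hd P = a" "last P = b" unfolding Q_def by auto
    then have "longest_path V E (rev P)" "hd (rev P) = b" "last (rev P) = a"
      using longest_path_rev by (auto simp: hd_rev last_rev)
    then show "a \<in> Q b" unfolding Q_def by blast
  qed
  have QV: "Q a \<subseteq> V" for a
    unfolding Q_def longest_path_def is_path_def using last_in_set by blast
  have Qcard: "n < 4 * card (Q a)" if "Q a \<noteq> {}" for a
  proof -
    obtain P where "longest_path V E P" "hd P = a" using \<open>Q a \<noteq> {}\<close> unfolding Q_def by auto
    then show ?thesis
      using posa_endpoints[of V E P] V assms(2) unfolding Q_def V_def by auto
  qed
  define A where "A = {a \<in> V. Q a \<noteq> {}}"
  \<comment> \<open>The tournament only decides pairs of distinct vertices. Equal ends force a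
    one-vertex path; all longest paths have the same length, but \<open>a\<close> also starts one
    with a different end.\<close>
  have irrefl: "a \<notin> Q a" for a
  proof
    assume "a \<in> Q a"
    then obtain P where P: "longest_path V E P" "hd P = a" "last P = a" unfolding Q_def by auto
    have "\<not> Q a \<subseteq> {a}"
    proof
      assume "Q a \<subseteq> {a}"
      then have "card (Q a) \<le> 1" using card_mono[of "{a}" "Q a"] by simp
      moreover have "n < 4 * card (Q a)" using \<open>a \<in> Q a\<close> by (intro Qcard) blast
      ultimately show False using assms(1) by linarith
    qed
    then obtain b where "b \<in> Q a" "b \<noteq> a" by blast
    then obtain P' where "longest_path V E P'" "hd P' = a" "last P' = b" unfolding Q_def by auto
    then have P': "longest_path V E P'" "hd P' \<noteq> last P'" using \<open>b \<noteq> a\<close> by auto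
    from P'(2) have "length P' \<noteq> 1" by (auto simp: length_Suc_conv)
    moreover have "length P' = length P"
      using P(1) P'(1) unfolding longest_path_def by (blast intro: le_antisym)
    moreover have "P \<noteq> []" and "distinct P" using P(1) unfolding longest_path_def is_path_def by blast+
    ultimately obtain x y zs where "P = x # y # zs" by (cases P rule: path_edges.cases) auto
    then show False using P \<open>distinct P\<close> last_in_set[of "y # zs"] by auto
  qed
  obtain P0 where "longest_path V E P0" using longest_path_exists V by blast
  then have ne: "Q (hd P0) \<noteq> {}" unfolding Q_def by auto
  have "Q (hd P0) \<subseteq> A" unfolding A_def using Qsym QV by blast
  then have "card (Q (hd P0)) \<le> card A" using V unfolding A_def by (intro card_mono) auto
  then have A: "n < 4 * card A" using Qcard[OF ne] by linarith
  have "n * n \<le> (4 * card A) * n" using A by simp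
  also have "\<dots> = 4 * (\<Sum>a\<in>A. n)" by simp
  also have "\<dots> \<le> 4 * (\<Sum>a\<in>A. 4 * card (Q a))"
    using Qcard unfolding A_def by (intro mult_left_mono sum_mono) (auto intro: less_imp_le)
  also have "\<dots> = 16 * (\<Sum>a\<in>A. card (Q a))" by (simp add: sum_distrib_left)
  also have "\<dots> \<le> 16 * (\<Sum>a\<in>V. card (Q a))"
    using V unfolding A_def by (intro mult_left_mono sum_mono2) auto
  also have "(\<Sum>a\<in>V. card (Q a)) = card (Sigma V Q)"
    using V(1) finite_subset[OF QV V(1)] by (simp add: card_SigmaI)
  also have "Sigma V Q = (SIGMA a:V. Q a \<inter> heads n a) \<union> (SIGMA a:V. Q a \<inter> heads n a)\<inverse>"
  proof -
    have "b \<in> heads n a \<or> a \<in> heads n b" if "a \<in> V" "b \<in> Q a" for a b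
      using heads_tournament[of a n b] irrefl that QV unfolding V_def by blast
    then show ?thesis using Qsym QV by blast
  qed
  also have "card \<dots> \<le> card (SIGMA a:V. Q a \<inter> heads n a) + card ((SIGMA a:V. Q a \<inter> heads n a)\<inverse>)"
    by (rule card_Un_le)
  also have "\<dots> = 2 * (\<Sum>a\<in>V. card (Q a \<inter> heads n a))"
    using V by (subst card_inverse) simp
  also have "\<dots> = 2 * (\<Sum>u<n. card (booster_heads n E u))"
    unfolding booster_heads_def Q_def V_def by (intro arg_cong[of _ _ "(*) 2"] sum.cong arg_cong[of _ _ card]) auto
  finally show ?thesis by (simp add: power2_eq_square)
qed

text \<open>Each edge of \<open>P\<close> is charged to one slot producing it. At a vertex
  \<open>c \<le> 2\<close> slots are charged, with total at most \<open>n\<close>, and any of the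
  \<open>k - c\<close> others may be red. Multiply
  \<open>(k - c)^2 \<ge> k^2 * ((k - 2) / k)^c\<close> over the vertices; squaring avoids
  half-integral powers.\<close>

lemma picked_path_avoids:
  assumes f: "f \<in> picks n k" and P: "longest_path {..<n} (picked_graph n (\<lambda>_. {..<k}) f) P"
    and "3 \<le> k"
  defines "R \<equiv> {r \<in> {..<n} \<rightarrow>\<^sub>E {..<k}. path_edges P \<subseteq> picked_graph n (\<lambda>u. {..<k} - {r u}) f}"
  shows "(k * (k - 2)) ^ n \<le> (card R)\<^sup>2"
proof -
  have "\<exists>x. e = {fst x, f (fst x) (snd x)} \<and> fst x < n \<and> snd x < k" if "e \<in> path_edges P" for e
  proof -
    have "e \<in> picked_graph n (\<lambda>_. {..<k}) f"
      using P that unfolding longest_path_def is_path_def by blast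
    then obtain u i where "e = {u, f u i}" "u < n" "i < k" unfolding picked_graph_def by auto
    then show ?thesis by (intro exI[of _ "(u, i)"]) simp
  qed
  then obtain slot where slot: "\<And>e. e \<in> path_edges P \<Longrightarrow>
      e = {fst (slot e), f (fst (slot e)) (snd (slot e))} \<and> fst (slot e) < n \<and> snd (slot e) < k"
    by metis
  define own where "own u = {e \<in> path_edges P. fst (slot e) = u}" for u
  define used where "used u = (snd \<circ> slot) ` own u" for u
  have fin: "finite (own u)" for u unfolding own_def by simp
  have dP: "distinct P" "set P \<subseteq> {..<n}" using P unfolding longest_path_def is_path_def by auto
  have used_own: "card (used u) \<le> card (own u)" for u
    unfolding used_def using fin by (rule card_image_le)
  have "own u \<subseteq> {e \<in> path_edges P. u \<in> e}" for u using slot unfolding own_def by fastforce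
  then have "card (own u) \<le> card {e \<in> path_edges P. u \<in> e}" for u by (intro card_mono) auto
  then have used2: "card (used u) \<le> 2" for u
    using used_own card_path_edges_at[OF dP(1)] by (meson le_trans)
  have "(\<Sum>u<n. card (used u)) \<le> (\<Sum>u<n. card (own u))" by (intro sum_mono used_own)
  also have "\<dots> = card (\<Union>u<n. own u)"
    by (rule card_UN_disjoint[symmetric]) (auto simp: own_def)
  also have "\<dots> \<le> card (path_edges P)" by (intro card_mono) (auto simp: own_def)
  also have "\<dots> \<le> length P" using card_path_edges[of P] by simp
  also have "\<dots> \<le> n" using dP by (metis card_lessThan card_mono distinct_card finite_lessThan)
  finally have usedn: "(\<Sum>u<n. card (used u)) \<le> n" .
  have "(\<Pi>\<^sub>E u\<in>{..<n}. {..<k} - used u) \<subseteq> R"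
  proof
    fix r assume r: "r \<in> (\<Pi>\<^sub>E u\<in>{..<n}. {..<k} - used u)"
    have "e \<in> picked_graph n (\<lambda>u. {..<k} - {r u}) f" if e: "e \<in> path_edges P" for e
    proof -
      have "snd (slot e) \<in> used (fst (slot e))" unfolding used_def own_def using e by auto
      then have "snd (slot e) \<noteq> r (fst (slot e))" using r slot[OF e] by (auto simp: PiE_def Pi_def)
      then show ?thesis using slot[OF e] unfolding picked_graph_def by blast
    qed
    then show "r \<in> R" unfolding R_def using r by (auto simp: PiE_def Pi_def)
  qed
  moreover have "finite R" unfolding R_def by (simp add: finite_PiE)
  ultimately have "card (\<Pi>\<^sub>E u\<in>{..<n}. {..<k} - used u) \<le> card R" by (rule card_mono[rotated])
  moreover have "card ({..<k} - used u) = k - card (used u)" for u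
  proof -
    have "used u \<subseteq> {..<k}" unfolding used_def own_def using slot by fastforce
    then show ?thesis by (simp add: card_Diff_subset finite_subset)
  qed
  ultimately have R: "(\<Prod>u<n. k - card (used u)) \<le> card R" by (simp add: card_PiE)
  let ?q = "real (k - 2) / real k"
  have q: "0 \<le> ?q" "?q \<le> 1" using assms(3) by (auto simp: field_simps)
  have "real ((k * (k - 2)) ^ n) = (real k ^ 2 * ?q) ^ n"
    using assms(3) by (simp add: power2_eq_square)
  also have "\<dots> = (real k ^ 2) ^ n * ?q ^ n" by (rule power_mult_distrib)
  also have "\<dots> \<le> (real k ^ 2) ^ n * ?q ^ (\<Sum>u<n. card (used u))"
    using power_decreasing[OF usedn q] by (intro mult_left_mono) auto
  also have "\<dots> = (\<Prod>u<n. real k ^ 2 * ?q ^ card (used u))"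
    by (simp add: prod.distrib power_sum)
  also have "\<dots> \<le> (\<Prod>u<n. real (k - card (used u)) ^ 2)"
  proof (intro prod_mono conjI)
    fix u
    consider "card (used u) = 0" | "card (used u) = 1" | "card (used u) = 2"
      using used2[of u] by linarith
    then show "real k ^ 2 * ?q ^ card (used u) \<le> real (k - card (used u)) ^ 2"
    proof cases
      case 2
      then show ?thesis using assms(3)
        by (simp add: of_nat_diff power2_eq_square field_simps)
    next
      case 3
      then show ?thesis using assms(3) by (simp add: power2_eq_square)
    qed simp
  qed simp
  also have "\<dots> = (real (\<Prod>u<n. k - card (used u)))\<^sup>2" by (simp add: prod_power_distrib)
  also have "\<dots> \<le> (real (card R))\<^sup>2"
    using R by (intro power_mono) (auto simp: of_nat_le_iff simp del: of_nat_prod)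
  finally show ?thesis by (simp only: of_nat_power[symmetric] of_nat_le_iff)
qed

lemma card_le_fibres:
  fixes c :: real
  assumes "finite A" "\<And>g. card {f \<in> A. \<rho> f = g} \<le> c" "card (\<rho> ` A) \<le> m" "0 \<le> c"
  shows "card A \<le> m * c"
proof -
  have "A = (\<Union>g\<in>\<rho> ` A. {f \<in> A. \<rho> f = g})" by auto
  then have "card A \<le> (\<Sum>g\<in>\<rho> ` A. card {f \<in> A. \<rho> f = g})"
    using card_UN_le[of "\<rho> ` A" "\<lambda>g. {f \<in> A. \<rho> f = g}"] assms(1) by simp
  then have "real (card A) \<le> (\<Sum>g\<in>\<rho> ` A. real (card {f \<in> A. \<rho> f = g}))"
    by (metis of_nat_le_iff of_nat_sum)
  also have "\<dots> \<le> (\<Sum>g\<in>\<rho> ` A. c)" by (intro sum_mono assms(2))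
  also have "\<dots> \<le> m * c" using assms(3,4) by (simp add: mult_right_mono)
  finally show ?thesis .
qed

text \<open>By \<open>1 - x \<le> exp (- x)\<close> the proportion is at most \<open>exp\<close> of
  minus the sum of \<open>card (B u) / card (heads n u)\<close>. Since there are at most
  \<open>n/2\<close> heads, the sum is at least \<open>(2/n) * (n^2/32) = n/16\<close>.\<close>

lemma prod_avoiding_le:
  assumes "10 \<le> n" "\<And>u. u < n \<Longrightarrow> B u \<subseteq> heads n u" "n\<^sup>2 \<le> 32 * (\<Sum>u<n. card (B u))"
  shows "real (\<Prod>u<n. card (heads n u - B u)) \<le> exp (- real n / 16) * (\<Prod>u<n. real (card (heads n u)))"
proof -
  have pos: "0 < card (heads n u)" if "u < n" for u using card_heads_ge[OF that] assms(1) by linarith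
  have "real (card (heads n u - B u)) \<le> exp (- (2 * card (B u) / n)) * card (heads n u)" if u: "u < n" for u
  proof -
    let ?m = "real (card (heads n u))" and ?b = "real (card (B u))"
    have m: "0 < ?m" "2 * ?m \<le> n" using pos[OF u] card_heads_le[OF u] by linarith+
    have ne: "heads n u \<noteq> {}" using pos[OF u] by auto
    have "card (B u) \<le> card (heads n u)" using assms(2)[OF u] by (intro card_mono) auto
    then have "real (card (heads n u - B u)) = (1 - ?b / ?m) * ?m"
      using assms(2)[OF u] m ne finite_subset[OF assms(2)[OF u]]
      by (simp add: card_Diff_subset of_nat_diff left_diff_distrib)
    also have "\<dots> \<le> exp (- (?b / ?m)) * ?m"
      using exp_ge_add_one_self[of "- (?b / ?m)"] m by (intro mult_right_mono) auto
    also have "\<dots> \<le> exp (- (2 * ?b / n)) * ?m"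
    proof -
      have "2 * ?b / n \<le> 2 * ?b / (2 * ?m)" using m by (intro divide_left_mono) auto
      then show ?thesis using m by (intro mult_right_mono) auto
    qed
    finally show ?thesis by simp
  qed
  then have "real (\<Prod>u<n. card (heads n u - B u)) \<le> (\<Prod>u<n. exp (- (2 * card (B u) / n)) * card (heads n u))"
    unfolding of_nat_prod by (intro prod_mono) auto
  also have "\<dots> = exp (- (\<Sum>u<n. 2 * card (B u) / n)) * (\<Prod>u<n. real (card (heads n u)))"
    by (simp add: prod.distrib exp_sum sum_negf[symmetric])
  also have "\<dots> \<le> exp (- real n / 16) * (\<Prod>u<n. real (card (heads n u)))"
  proof -
    have "real (n\<^sup>2) \<le> real (32 * (\<Sum>u<n. card (B u)))" using assms(3) by (simp only: of_nat_le_iff)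
    then have "real n / 16 \<le> (\<Sum>u<n. 2 * card (B u) / n)"
      using assms(1) by (simp add: sum_divide_distrib[symmetric] sum_distrib_left[symmetric] field_simps power2_eq_square)
    then show ?thesis by (intro mult_right_mono prod_nonneg) auto
  qed
  finally show ?thesis .
qed

text \<open>The Fenner--Frieze colouring argument: a vertex picks one of its \<open>k\<close> choices to be red. If the
  red choices miss a longest path, then each of them misses the boosters of the remaining graph.\<close>

lemma card_red_avoiding:
  assumes n: "10 \<le> n" and k: "1 \<le> k" and r: "r \<in> {..<n} \<rightarrow>\<^sub>E {..<k}"
  defines "H \<equiv> picked_graph n (\<lambda>_. {..<k})" and "H' \<equiv> picked_graph n (\<lambda>u. {..<k} - {r u})"
  defines "X \<equiv> {f \<in> picks n k. \<not> hamiltonian n (H f) \<and> expander {..<n} (H' f) \<and>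
    (\<exists>P. longest_path {..<n} (H f) P \<and> path_edges P \<subseteq> H' f)}"
  shows "card X \<le> exp (- real n / 16) * card (picks n k)"
proof -
  \<comment> \<open>\<open>\<rho>\<close> forgets the red choices. The graph \<open>H' f\<close> and
    its boosters depend on \<open>\<rho> f\<close> only, so within a fibre the sets to be avoided
    are fixed and only the red choices vary.\<close>
  define \<rho> where "\<rho> f = (\<lambda>u\<in>{..<n}. restrict (f u) ({..<k} - {r u}))" for f :: "nat \<Rightarrow> nat \<Rightarrow> nat"
  let ?M = "\<Prod>u<n. real (card (heads n u))"
  have rk: "r u < k" if "u < n" for u using r that by auto
  have finX: "finite X" unfolding X_def by simp
  have sub: "H' f \<subseteq> H f" for f unfolding H_def H'_def by (rule picked_graph_mono) auto
  have \<rho>_eq: "f u i = g u i" if "\<rho> f = \<rho> g" "u < n" "i < k" "i \<noteq> r u" for f g u i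
  proof -
    have "\<rho> f u i = \<rho> g u i" by (simp add: that(1))
    then show ?thesis using that(2-4) unfolding \<rho>_def by simp
  qed
  have H'_\<rho>: "H' f = H' g" if "\<rho> f = \<rho> g" for f g
  proof -
    have "(u < n \<and> i \<in> {..<k} - {r u}) \<and> e = {u, f u i} \<longleftrightarrow>
        (u < n \<and> i \<in> {..<k} - {r u}) \<and> e = {u, g u i}" for u i e
      using \<rho>_eq[OF that, of u i] by auto
    then have "\<And>e. (\<exists>u i. e = {u, f u i} \<and> u < n \<and> i \<in> {..<k} - {r u}) \<longleftrightarrow>
        (\<exists>u i. e = {u, g u i} \<and> u < n \<and> i \<in> {..<k} - {r u})" by blast
    then show ?thesis unfolding H'_def picked_graph_def by simp
  qed
  \<comment> \<open>Some longest path of \<open>H f\<close> survives in \<open>H' f\<close>, so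
    longest paths of \<open>H' f\<close> are longest in \<open>H f\<close> too; a red choice of a
    booster head would close one and make \<open>H f\<close> Hamiltonian.\<close>
  have avoid: "f u (r u) \<notin> booster_heads n (H' f) u" if f: "f \<in> X" and u: "u < n" for f u
  proof
    assume "f u (r u) \<in> booster_heads n (H' f) u"
    then obtain P where P: "longest_path {..<n} (H' f) P" "hd P = u" "last P = f u (r u)"
      unfolding booster_heads_def by auto
    obtain P' where P': "longest_path {..<n} (H f) P'" "path_edges P' \<subseteq> H' f"
      using f unfolding X_def by auto
    then have "length P' \<le> length P"
      using P(1) unfolding longest_path_def is_path_def by auto
    then have "longest_path {..<n} (H f) P"
      using P(1) P'(1) sub unfolding longest_path_def is_path_def by (meson order_trans)
    moreover have "{last P, hd P} \<in> H f"
      using P u rk[OF u] unfolding H_def picked_graph_def by (auto simp: insert_commute)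
    moreover have "expander {..<n} (H f)" using f expander_mono[OF _ sub] unfolding X_def by auto
    ultimately show False
      using longest_path_closed_hamiltonian[OF n] f unfolding X_def by blast
  qed
  have "card X \<le> (\<Prod>u<n. card (heads n u) ^ (k - 1)) * (exp (- real n / 16) * ?M)"
  proof (rule card_le_fibres[where \<rho> = \<rho>])
    show "finite X" by (rule finX)
    show "0 \<le> exp (- real n / 16) * ?M" by (intro mult_nonneg_nonneg prod_nonneg) auto
    have "\<rho> f \<in> (\<Pi>\<^sub>E u\<in>{..<n}. \<Pi>\<^sub>E i\<in>{..<k} - {r u}. heads n u)" if "f \<in> X" for f
    proof -
      have "f u i \<in> heads n u" if "u < n" "i < k" for u i
        using picks_heads[of f n k u i] \<open>f \<in> X\<close> that unfolding X_def by blast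
      then show ?thesis unfolding \<rho>_def by (intro restrict_PiE_iff[THEN iffD2] ballI) simp
    qed
    then have "\<rho> ` X \<subseteq> (\<Pi>\<^sub>E u\<in>{..<n}. \<Pi>\<^sub>E i\<in>{..<k} - {r u}. heads n u)" by blast
    then have "card (\<rho> ` X) \<le> card (\<Pi>\<^sub>E u\<in>{..<n}. \<Pi>\<^sub>E i\<in>{..<k} - {r u}. heads n u)"
      by (intro card_mono finite_PiE ballI) auto
    also have "\<dots> = (\<Prod>u<n. card (heads n u) ^ (k - 1))"
      using rk by (simp add: card_PiE)
    finally show "card (\<rho> ` X) \<le> (\<Prod>u<n. card (heads n u) ^ (k - 1))" .
    fix g
    show "real (card {f \<in> X. \<rho> f = g}) \<le> exp (- real n / 16) * ?M"
    proof (cases "{f \<in> X. \<rho> f = g} = {}")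
      case True
      then have "card {f \<in> X. \<rho> f = g} = 0" by (simp only: card.empty)
      then show ?thesis using \<open>0 \<le> exp (- real n / 16) * ?M\<close> by simp
    next
      case False
      then obtain f0 where f0: "f0 \<in> X" "\<rho> f0 = g" by auto
      define B where "B = booster_heads n (H' f0)"
      have "card {f \<in> X. \<rho> f = g} \<le> card (\<Pi>\<^sub>E u\<in>{..<n}. heads n u - B u)"
      proof (rule card_inj_on_le[where f = "\<lambda>f. \<lambda>u\<in>{..<n}. f u (r u)"])
        show "inj_on (\<lambda>f. \<lambda>u\<in>{..<n}. f u (r u)) {f \<in> X. \<rho> f = g}"
        proof (rule inj_onI)
          fix f f' assume f: "f \<in> {f \<in> X. \<rho> f = g}" "f' \<in> {f \<in> X. \<rho> f = g}"
            and eq: "(\<lambda>u\<in>{..<n}. f u (r u)) = (\<lambda>u\<in>{..<n}. f' u (r u))"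
          have P: "f \<in> picks n k" "f' \<in> picks n k" using f unfolding X_def by auto
          show "f = f'"
          proof (rule PiE_ext[OF P[unfolded picks_def]])
            fix u assume u: "u \<in> {..<n}"
            have C: "f u i = f' u i" if "i \<in> {..<k}" for i
            proof (cases "i = r u")
              case True
              then show ?thesis using fun_cong[OF eq, of u] u by simp
            next
              case False
              have "\<rho> f = \<rho> f'" using f by simp
              then show ?thesis using u that False by (intro \<rho>_eq) auto
            qed
            show "f u = f' u"
              by (rule PiE_ext[OF PiE_mem[OF P(1)[unfolded picks_def] u] PiE_mem[OF P(2)[unfolded picks_def] u] C])
          qed
        qed
        show "(\<lambda>f. \<lambda>u\<in>{..<n}. f u (r u)) ` {f \<in> X. \<rho> f = g} \<subseteq> (\<Pi>\<^sub>E u\<in>{..<n}. heads n u - B u)"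
        proof (intro image_subsetI PiE_I)
          fix f u assume f: "f \<in> {f \<in> X. \<rho> f = g}" and u: "u \<in> {..<n}"
          have "H' f = H' f0" using f f0 by (intro H'_\<rho>) simp
          moreover have "f u (r u) \<in> heads n u"
              using f u rk[of u] picks_heads[of f n k u "r u"] unfolding X_def by simp
          ultimately show "(\<lambda>u\<in>{..<n}. f u (r u)) u \<in> heads n u - B u"
            using avoid[of f u] f u unfolding B_def by simp
        qed auto
        show "finite (\<Pi>\<^sub>E u\<in>{..<n}. heads n u - B u)" by (intro finite_PiE) auto
      qed
      also have "\<dots> = (\<Prod>u<n. card (heads n u - B u))" by (simp add: card_PiE)
      finally have "real (card {f \<in> X. \<rho> f = g}) \<le> real (\<Prod>u<n. card (heads n u - B u))"
        by (simp only: of_nat_le_iff)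
      also have "\<dots> \<le> exp (- real n / 16) * ?M"
        using n card_boosters[OF n, of "H' f0"] f0 unfolding X_def
        by (intro prod_avoiding_le) (auto simp: B_def booster_heads_def)
      finally show ?thesis .
    qed
  qed
  also have "\<dots> = exp (- real n / 16) * (\<Prod>u<n. real (card (heads n u)) ^ (k - 1) * card (heads n u))"
    by (simp add: prod.distrib)
  also have "\<dots> = exp (- real n / 16) * card (picks n k)"
    using k unfolding card_picks by (simp add: power_Suc2[symmetric])
  finally show ?thesis .
qed

text \<open>Count pairs \<open>(f, r)\<close> such that deleting the red slots \<open>r\<close>
  spares a longest path: every \<open>f\<close> in \<open>X\<close> has at least \<open>q\<close>
  such \<open>r\<close> by \<open>picked_path_avoids\<close>, every \<open>r\<close> has few such
  \<open>f\<close> by \<open>card_red_avoiding\<close>. As \<open>q\<close> is a square root, the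
  result is stated for squares.\<close>

lemma card_nonhamiltonian_expander:
  assumes n: "10 \<le> n" and k: "3 \<le> k"
  defines "X \<equiv> {f \<in> picks n k. \<not> hamiltonian n (picked_graph n (\<lambda>_. {..<k}) f) \<and>
    (\<forall>r\<in>{..<n} \<rightarrow>\<^sub>E {..<k}. expander {..<n} (picked_graph n (\<lambda>u. {..<k} - {r u}) f))}"
  shows "(real (card X))\<^sup>2 * (1 - 2 / real k) ^ n \<le> exp (- real n / 8) * (real (card (picks n k)))\<^sup>2"
proof -
  let ?H = "picked_graph n (\<lambda>_. {..<k})" and ?H' = "\<lambda>r. picked_graph n (\<lambda>u. {..<k} - {r u})"
  define R where "R = ({..<n} \<rightarrow>\<^sub>E {..<k})"
  define good where "good f r \<longleftrightarrow> (\<exists>P. longest_path {..<n} (?H f) P \<and> path_edges P \<subseteq> ?H' r f)" for f r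
  define q where "q = sqrt (real (k * (k - 2)) ^ n)"
  have finR: "finite R" unfolding R_def by (simp add: finite_PiE)
  have finX: "finite X" unfolding X_def by simp
  have ge: "q \<le> card {r \<in> R. good f r}" if "f \<in> X" for f
  proof -
    obtain P where P: "longest_path {..<n} (?H f) P"
      using longest_path_exists[of "{..<n}"] n by (auto simp: lessThan_empty_iff)
    have "(k * (k - 2)) ^ n \<le> (card {r \<in> R. path_edges P \<subseteq> ?H' r f})\<^sup>2"
      using picked_path_avoids[OF _ P k] that unfolding X_def R_def by auto
    also have "\<dots> \<le> (card {r \<in> R. good f r})\<^sup>2"
      unfolding good_def using P finR by (intro power_mono card_mono) auto
    finally have "real ((k * (k - 2)) ^ n) \<le> real ((card {r \<in> R. good f r})\<^sup>2)"
      by (simp only: of_nat_le_iff)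
    then show ?thesis unfolding q_def by (intro real_le_lsqrt) auto
  qed
  have "q * card X = (\<Sum>f\<in>X. q)" by simp
  also have "\<dots> \<le> (\<Sum>f\<in>X. real (card {r \<in> R. good f r}))" by (intro sum_mono ge)
  also have "\<dots> = (\<Sum>r\<in>R. real (card {f \<in> X. good f r}))"
    using sum_multicount_gen[OF finX finR, of "\<lambda>f r. good f r" "\<lambda>r. card {f \<in> X. good f r}"]
    by (simp flip: of_nat_sum)
  also have "\<dots> \<le> (\<Sum>r\<in>R. exp (- real n / 16) * card (picks n k))"
  proof (intro sum_mono)
    fix r assume r: "r \<in> R"
    have "real (card {f \<in> X. good f r}) \<le> real (card {f \<in> picks n k. \<not> hamiltonian n (?H f) \<and>
        expander {..<n} (?H' r f) \<and> (\<exists>P. longest_path {..<n} (?H f) P \<and> path_edges P \<subseteq> ?H' r f)})"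
      using r unfolding good_def X_def R_def of_nat_le_iff by (intro card_mono) auto
    also have "\<dots> \<le> exp (- real n / 16) * card (picks n k)"
      using r k unfolding R_def by (intro card_red_avoiding[OF n]) auto
    finally show "real (card {f \<in> X. good f r}) \<le> exp (- real n / 16) * card (picks n k)" .
  qed
  also have "\<dots> = real k ^ n * (exp (- real n / 16) * card (picks n k))"
    unfolding R_def by (simp add: card_PiE)
  finally have "(q * card X)\<^sup>2 \<le> (real k ^ n * (exp (- real n / 16) * card (picks n k)))\<^sup>2"
    by (intro power_mono) (auto simp: q_def)
  moreover have "(q * card X)\<^sup>2 = (real k ^ n)\<^sup>2 * ((real (card X))\<^sup>2 * (1 - 2 / real k) ^ n)"
  proof -
    have "real (k * (k - 2)) = real k ^ 2 * (1 - 2 / real k)"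
      using k by (simp add: of_nat_diff field_simps power2_eq_square)
    then have "q\<^sup>2 = (real k ^ n)\<^sup>2 * (1 - 2 / real k) ^ n"
      using k unfolding q_def by (simp add: power_mult_distrib power_mult[symmetric] mult.commute)
    then show ?thesis by (simp add: power_mult_distrib)
  qed
  moreover have "(real k ^ n * (exp (- real n / 16) * card (picks n k)))\<^sup>2 =
      (real k ^ n)\<^sup>2 * (exp (- real n / 8) * (real (card (picks n k)))\<^sup>2)"
    by (simp add: power_mult_distrib exp_double[symmetric] power2_eq_square exp_add[symmetric])
  ultimately show ?thesis using k by (simp add: mult_le_cancel_left_pos)
qed

section \<open>Expansion after deleting one choice per vertex\<close>

text \<open>With \<open>T = S \<union> D\<close>, the choices of \<open>u\<close> in \<open>stuck_heads n S D u\<close> are those that would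
  create an edge between \<open>S\<close> and the complement of \<open>T\<close>.\<close>

definition stuck_heads :: "nat \<Rightarrow> nat set \<Rightarrow> nat set \<Rightarrow> nat \<Rightarrow> nat set" where
  "stuck_heads n S D u =
     (if u \<in> S then heads n u - (S \<union> D) else if u \<in> D then {} else heads n u \<inter> S)"

text \<open>One choice per vertex is tolerated because it may be the deleted one. The condition thus
  does not mention the deletion, and the union bound runs over \<open>S\<close> and \<open>D\<close>
  but not over the \<open>k ^ n\<close> deletions.\<close>

definition stuck :: "nat \<Rightarrow> nat \<Rightarrow> nat set \<Rightarrow> nat set \<Rightarrow> (nat \<Rightarrow> nat \<Rightarrow> nat) set" where
  "stuck n k S D =
     {f \<in> picks n k. \<forall>u<n. card {i. i < k \<and> f u i \<in> stuck_heads n S D u} \<le> 1}"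

lemma stuck_heads_subset: "stuck_heads n S D u \<subseteq> heads n u"
  unfolding stuck_heads_def by auto

text \<open>A non-expanding \<open>S\<close> has fewer than \<open>2 * card S\<close> outer
  neighbours after the deletion; every choice joining \<open>S\<close> to any other outside vertex
  is the red one. The neighbours are padded to a set \<open>D\<close> of exact size, for which
  \<open>4 * card S \<le> n\<close> leaves room.\<close>

lemma nonexpander_stuck:
  assumes f: "f \<in> picks n k"
    and nonexp: "\<not> expander {..<n} (picked_graph n (\<lambda>u. {..<k} - {r u}) f)"
  obtains S D where "S \<subseteq> {..<n}" "D \<subseteq> {..<n}" "S \<inter> D = {}" "S \<noteq> {}" "4 * card S \<le> n"
    "card D = 2 * card S" "f \<in> stuck n k S D"
proof -
  let ?H = "picked_graph n (\<lambda>u. {..<k} - {r u}) f"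
  obtain S where S: "S \<subseteq> {..<n}" "S \<noteq> {}" "4 * card S \<le> n"
    and small: "card (S \<union> nbhd {..<n} ?H S) < 3 * card S"
    using nonexp unfolding expander_def by (auto simp: not_le)
  let ?N = "nbhd {..<n} ?H S"
  have finS: "finite S" using S(1) finite_subset by blast
  have N: "?N \<subseteq> {..<n}" unfolding nbhd_def by auto
  have finN: "finite ?N" using N finite_subset by blast
  have "card (S \<union> (?N - S)) = card S + card (?N - S)"
    using finS finN by (intro card_Un_disjoint) auto
  then have "card (?N - S) \<le> 2 * card S" using small by (simp add: Un_Diff_cancel)
  moreover have "2 * card S \<le> card ({..<n} - S)"
    using S finS by (simp add: card_Diff_subset)
  moreover have "?N - S \<subseteq> {..<n} - S" using N by auto
  ultimately obtain D where D: "?N - S \<subseteq> D" "D \<subseteq> {..<n} - S" "card D = 2 * card S"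
    using exists_subset_between[of "?N - S" "2 * card S" "{..<n} - S"] by auto
  have "card {i. i < k \<and> f u i \<in> stuck_heads n S D u} \<le> 1" if u: "u < n" for u
  proof -
    have "i = r u" if i: "i < k" "f u i \<in> stuck_heads n S D u" for i
    proof (rule ccontr)
      assume "i \<noteq> r u"
      then have e: "{u, f u i} \<in> ?H" unfolding picked_graph_def using u i(1) by blast
      have fn: "f u i < n" using picks_heads[OF f u i(1)] heads_less by blast
      show False
      proof (cases "u \<in> S")
        case True
        then have "f u i \<in> ?N" unfolding nbhd_def using e fn by blast
        then show False using i(2) D(1) True unfolding stuck_heads_def by auto
      next
        case False
        then have "f u i \<in> S" "u \<notin> D" using i(2) unfolding stuck_heads_def by (auto split: if_splits)
        moreover from this have "u \<in> ?N"
          using e u unfolding nbhd_def by (auto simp: insert_commute)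
        ultimately show False using D(1) False by auto
      qed
    qed
    then have "{i. i < k \<and> f u i \<in> stuck_heads n S D u} \<subseteq> {r u}" by blast
    then show ?thesis using card_mono[of "{r u}"] by fastforce
  qed
  then have "f \<in> stuck n k S D" unfolding stuck_def using f by simp
  then show ?thesis using that[of S D] S D by auto
qed

section \<open>Probability that a fixed pair of sets is stuck\<close>

text \<open>The right side is the binomial probability
  \<open>(1 - \<xi>)^k + k * \<xi> * (1 - \<xi>)^(k - 1)\<close> of at most one hit, factored; the
  box \<open>G i\<close> collects the draws whose only hit is in slot \<open>i\<close>.\<close>

lemma card_at_most_one:
  assumes "finite M" "F \<subseteq> M" "M \<noteq> {}" "1 \<le> k"
  defines "\<xi> \<equiv> real (card F) / card M"
  shows "real (card {h \<in> {..<k} \<rightarrow>\<^sub>E M. card {i. i < k \<and> h i \<in> F} \<le> 1})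
    \<le> real (card M) ^ k * ((1 - \<xi>) ^ (k - 1) * (1 + real (k - 1) * \<xi>))"
proof -
  define G where "G i j = (if j = i then F else M - F)" for i j :: nat
  have finF: "finite F" using assms finite_subset by blast
  have m: "0 < card M" using assms by (simp add: card_gt_0_iff)
  have sub: "{h \<in> {..<k} \<rightarrow>\<^sub>E M. card {i. i < k \<and> h i \<in> F} \<le> 1} \<subseteq>
      ({..<k} \<rightarrow>\<^sub>E M - F) \<union> (\<Union>i<k. \<Pi>\<^sub>E j\<in>{..<k}. G i j)" (is "?L \<subseteq> _")
  proof
    fix h assume h: "h \<in> ?L"
    then have hM: "\<And>j. j < k \<Longrightarrow> h j \<in> M" "\<And>j. \<not> j < k \<Longrightarrow> h j = undefined"
      by (auto dest: PiE_mem PiE_arb)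
    show "h \<in> ({..<k} \<rightarrow>\<^sub>E M - F) \<union> (\<Union>i<k. \<Pi>\<^sub>E j\<in>{..<k}. G i j)"
    proof (cases "\<exists>i<k. h i \<in> F")
      case True
      then obtain i where i: "i < k" "h i \<in> F" by auto
      have uniq: "j = i" if "j < k" "h j \<in> F" for j
      proof -
        have "card {i, j} \<le> card {i. i < k \<and> h i \<in> F}" using i that by (intro card_mono) auto
        then have "card {i, j} \<le> 1" using h by simp
        then show ?thesis by (auto simp: card_insert_if split: if_splits)
      qed
      have "h \<in> (\<Pi>\<^sub>E j\<in>{..<k}. G i j)"
      proof (rule PiE_I)
        fix j assume "j \<in> {..<k}"
        then have "j < k" by simp
        then have "h j \<in> M" using hM(1) by blast
        moreover have "h j \<notin> F" if "j \<noteq> i" using uniq \<open>j < k\<close> that by blast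
        ultimately show "h j \<in> G i j" using i(2) unfolding G_def by simp
      qed (use hM(2) in simp)
      then show ?thesis using i(1) by blast
    next
      case False
      have "h \<in> {..<k} \<rightarrow>\<^sub>E M - F"
        using False hM by (intro PiE_I) auto
      then show ?thesis by blast
    qed
  qed
  have card_G: "card (\<Pi>\<^sub>E j\<in>{..<k}. G i j) = card F * card (M - F) ^ (k - 1)" if "i < k" for i
  proof -
    have "(\<Prod>j<k. card (G i j)) = card (G i i) * (\<Prod>j\<in>{..<k} - {i}. card (G i j))"
      using that by (intro prod.remove) auto
    also have "(\<Prod>j\<in>{..<k} - {i}. card (G i j)) = (\<Prod>j\<in>{..<k} - {i}. card (M - F))"
      by (intro prod.cong) (auto simp: G_def)
    finally show ?thesis using that by (simp add: card_PiE G_def)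
  qed
  have "card ?L \<le> card (({..<k} \<rightarrow>\<^sub>E M - F) \<union> (\<Union>i<k. \<Pi>\<^sub>E j\<in>{..<k}. G i j))"
    using assms finF by (intro card_mono[OF _ sub] finite_UnI finite_UN_I finite_PiE) (auto simp: G_def)
  also have "\<dots> \<le> card ({..<k} \<rightarrow>\<^sub>E M - F) + (\<Sum>i<k. card (\<Pi>\<^sub>E j\<in>{..<k}. G i j))"
    by (intro order.trans[OF card_Un_le] add_left_mono card_UN_le) auto
  also have "\<dots> = card (M - F) ^ k + k * (card F * card (M - F) ^ (k - 1))"
    by (simp add: card_funcsetE card_G)
  finally have "real (card ?L) \<le> real (card (M - F)) ^ k + k * (card F * real (card (M - F)) ^ (k - 1))"
    using of_nat_mono[where 'a = real] by fastforce
  also have "real (card (M - F)) = card M * (1 - \<xi>)"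
    using assms(2) m finF card_mono[OF assms(1,2)]
    by (simp add: card_Diff_subset of_nat_diff \<xi>_def right_diff_distrib)
  also have "real (card F) = card M * \<xi>" using m by (simp add: \<xi>_def)
  also have "(card M * (1 - \<xi>)) ^ k + k * (card M * \<xi> * (card M * (1 - \<xi>)) ^ (k - 1)) =
      real (card M) ^ k * ((1 - \<xi>) ^ (k - 1) * (1 + real (k - 1) * \<xi>))"
  proof -
    obtain l where "k = Suc l" using assms(4) by (cases k) auto
    have gen: "c * (1 - x) * (A * B) + real (Suc l) * (c * x * (A * B)) = c * A * (B * (1 + real l * x))"
      for c x A B :: real by (simp add: algebra_simps)
    show ?thesis unfolding \<open>k = Suc l\<close> power_Suc power_mult_distrib diff_Suc_1 by (rule gen)
  qed
  finally show ?thesis .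
qed

lemma card_stuck_le:
  fixes g :: "nat \<Rightarrow> real"
  assumes "3 \<le> n"
    and bound: "\<And>u. u < n \<Longrightarrow>
      real (card {h \<in> {..<k} \<rightarrow>\<^sub>E heads n u. card {i. i < k \<and> h i \<in> stuck_heads n S D u} \<le> 1})
        \<le> real (card (heads n u)) ^ k * g u"
  shows "real (card (stuck n k S D)) \<le> card (picks n k) * (\<Prod>u<n. g u)"
proof -
  define L where "L u = {h \<in> {..<k} \<rightarrow>\<^sub>E heads n u. card {i. i < k \<and> h i \<in> stuck_heads n S D u} \<le> 1}" for u
  have finL: "finite (L u)" for u
    unfolding L_def by (intro finite_subset[OF _ finite_PiE[of "{..<k}" "\<lambda>_. heads n u"]]) auto
  have "stuck n k S D \<subseteq> (\<Pi>\<^sub>E u\<in>{..<n}. L u)"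
  proof
    fix f assume f: "f \<in> stuck n k S D"
    then have P: "f \<in> (\<Pi>\<^sub>E u\<in>{..<n}. {..<k} \<rightarrow>\<^sub>E heads n u)" unfolding stuck_def picks_def by blast
    show "f \<in> (\<Pi>\<^sub>E u\<in>{..<n}. L u)"
    proof (rule PiE_I)
      fix u assume "u \<in> {..<n}"
      then show "f u \<in> L u" using f PiE_mem[OF P] unfolding stuck_def L_def by simp
    next
      fix u assume "u \<notin> {..<n}"
      then show "f u = undefined" by (rule PiE_arb[OF P])
    qed
  qed
  then have "card (stuck n k S D) \<le> card (\<Pi>\<^sub>E u\<in>{..<n}. L u)"
    using finL by (intro card_mono finite_PiE) auto
  then have "card (stuck n k S D) \<le> (\<Prod>u<n. card (L u))" by (simp add: card_PiE)
  then have "real (card (stuck n k S D)) \<le> (\<Prod>u<n. real (card (L u)))"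
    by (simp only: of_nat_prod[symmetric] of_nat_le_iff)
  also have "\<dots> \<le> (\<Prod>u<n. real (card (heads n u)) ^ k * g u)"
    using bound unfolding L_def by (intro prod_mono) auto
  also have "\<dots> = card (picks n k) * (\<Prod>u<n. g u)" by (simp add: prod.distrib card_picks)
  finally show ?thesis .
qed

text \<open>Only the vertices of \<open>S\<close> are used: all but one of the choices of each fall
  among the at most \<open>3 * card S\<close> vertices of \<open>S \<union> D\<close>, out of at
  least \<open>(n - 2) / 2\<close> heads. The factor \<open>k\<close> bounds
  \<open>1 + (k - 1) * \<xi>\<close>.\<close>

lemma card_stuck_small:
  assumes n: "3 \<le> n" and k: "1 \<le> k" and S: "S \<subseteq> {..<n}" and D: "D \<subseteq> {..<n}" "card D = 2 * card S"
  shows "real (card (stuck n k S D)) \<le>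
    card (picks n k) * (k * (6 * card S / (real n - 2)) ^ (k - 1)) ^ card S"
proof -
  let ?y = "6 * card S / (real n - 2)"
  define g where "g u = (if u \<in> S then k * ?y ^ (k - 1) else 1)" for u
  have fin: "finite S" "finite D" using S D finite_subset by blast+
  have "real (card (stuck n k S D)) \<le> card (picks n k) * (\<Prod>u<n. g u)"
  proof (rule card_stuck_le[OF n])
    fix u assume u: "u < n"
    let ?F = "stuck_heads n S D u" and ?M = "heads n u"
    let ?L = "{h \<in> {..<k} \<rightarrow>\<^sub>E ?M. card {i. i < k \<and> h i \<in> ?F} \<le> 1}"
    have m: "real n - 2 \<le> 2 * real (card ?M)" using card_heads_ge[OF u] by linarith
    then have mpos: "0 < card ?M" using n by (cases "card ?M") auto
    then have ne: "?M \<noteq> {}" by auto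
    show "real (card ?L) \<le> real (card ?M) ^ k * g u"
    proof (cases "u \<in> S")
      case True
      let ?\<xi> = "real (card ?F) / card ?M"
      have "card ?F \<le> card ?M" using stuck_heads_subset by (intro card_mono) auto
      then have \<xi>: "0 \<le> ?\<xi>" "?\<xi> \<le> 1" using mpos by auto
      have "?M \<subseteq> ?F \<union> (S \<union> D)" using True unfolding stuck_heads_def by auto
      then have "card ?M \<le> card (?F \<union> (S \<union> D))"
        using fin finite_subset[OF stuck_heads_subset] by (intro card_mono) auto
      also have "\<dots> \<le> card ?F + card (S \<union> D)" by (rule card_Un_le)
      also have "card (S \<union> D) \<le> 3 * card S" using card_Un_le[of S D] D by simp
      finally have "real (card ?M) - card ?F \<le> 3 * card S" by linarith
      then have "(real (card ?M) - card ?F) / card ?M \<le> 3 * card S / card ?M"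
        by (intro divide_right_mono) auto
      then have "1 - ?\<xi> \<le> 3 * card S / card ?M" using ne by (simp add: diff_divide_distrib)
      also have "\<dots> = 6 * card S / (2 * card ?M)" by simp
      also have "\<dots> \<le> ?y" using m n by (intro divide_left_mono) auto
      finally have "(1 - ?\<xi>) ^ (k - 1) \<le> ?y ^ (k - 1)" using \<xi> by (intro power_mono) auto
      moreover have "1 + real (k - 1) * ?\<xi> \<le> k"
        using mult_left_mono[OF \<xi>(2), of "real (k - 1)"] k by (simp add: of_nat_diff)
      moreover have "0 \<le> ?y ^ (k - 1)" using n by simp
      moreover have "0 \<le> 1 + real (k - 1) * ?\<xi>" using \<xi>(1) by simp
      ultimately have "(1 - ?\<xi>) ^ (k - 1) * (1 + real (k - 1) * ?\<xi>) \<le> ?y ^ (k - 1) * k"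
        by (rule mult_mono)
      then have "real (card ?M) ^ k * ((1 - ?\<xi>) ^ (k - 1) * (1 + real (k - 1) * ?\<xi>)) \<le> real (card ?M) ^ k * g u"
        using True by (intro mult_left_mono) (auto simp: g_def mult.commute)
      then show ?thesis
        using card_at_most_one[OF finite_heads stuck_heads_subset ne k, of S D] by linarith
    next
      case False
      have "card ?L \<le> card ({..<k} \<rightarrow>\<^sub>E ?M)" by (intro card_mono finite_PiE) auto
      then have "card ?L \<le> card ?M ^ k" by (simp add: card_funcsetE)
      then show ?thesis using False by (simp add: g_def flip: of_nat_power)
    qed
  qed
  also have "(\<Prod>u<n. g u) = (k * ?y ^ (k - 1)) ^ card S"
  proof -
    have "(\<Prod>u<n. g u) = (\<Prod>u\<in>S. k * ?y ^ (k - 1))"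
      unfolding g_def using S by (subst prod.inter_restrict[symmetric]) (auto simp: Int_absorb1)
    then show ?thesis by simp
  qed
  finally show ?thesis .
qed

text \<open>A pair between \<open>S\<close> and the complement of \<open>S \<union> D\<close> is
  owned by exactly one end, so it is counted once.\<close>

lemma sum_card_stuck_heads:
  assumes "S \<subseteq> {..<n}" "D \<subseteq> {..<n}" "S \<inter> D = {}"
  shows "(\<Sum>u\<in>{..<n} - D. card (stuck_heads n S D u)) = card S * (n - card S - card D)"
proof -
  define W where "W = {..<n} - (S \<union> D)"
  have fin: "finite S" "finite D" "finite W" using assms finite_subset unfolding W_def by blast+
  have W: "card W = n - card S - card D"
    unfolding W_def using assms fin by (simp add: card_Diff_subset card_Un_disjoint)
  have count: "card (heads n u \<inter> A) = (\<Sum>w\<in>A. of_bool (w \<in> heads n u))" if "finite A" for A u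
    using that by (simp add: sum.If_cases of_bool_def Int_commute Collect_mem_eq)
  have "{..<n} - D = S \<union> W" "S \<inter> W = {}" unfolding W_def using assms by auto
  then have "(\<Sum>u\<in>{..<n} - D. card (stuck_heads n S D u)) =
      (\<Sum>u\<in>S. card (stuck_heads n S D u)) + (\<Sum>u\<in>W. card (stuck_heads n S D u))"
    using fin by (simp add: sum.union_disjoint)
  also have "(\<Sum>u\<in>S. card (stuck_heads n S D u)) = (\<Sum>u\<in>S. card (heads n u \<inter> W))"
    unfolding stuck_heads_def W_def
    by (intro sum.cong arg_cong[of _ _ card]) (auto dest: heads_less)
  also have "(\<Sum>u\<in>W. card (stuck_heads n S D u)) = (\<Sum>u\<in>W. card (heads n u \<inter> S))"
    unfolding stuck_heads_def W_def by (intro sum.cong) auto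
  also have "(\<Sum>u\<in>S. card (heads n u \<inter> W)) + (\<Sum>u\<in>W. card (heads n u \<inter> S)) =
      (\<Sum>u\<in>S. \<Sum>w\<in>W. of_bool (w \<in> heads n u)) + (\<Sum>u\<in>S. \<Sum>w\<in>W. of_bool (u \<in> heads n w))"
    using fin by (simp only: count sum.swap[of _ S W])
  also have "\<dots> = (\<Sum>u\<in>S. \<Sum>w\<in>W. of_bool (w \<in> heads n u) + of_bool (u \<in> heads n w))"
    by (simp add: sum.distrib)
  also have "\<dots> = (\<Sum>u\<in>S. \<Sum>w\<in>W. 1)"
  proof (intro sum.cong refl)
    fix u w assume "u \<in> S" "w \<in> W"
    then have "u < n" "w < n" "u \<noteq> w" using assms unfolding W_def by auto
    then show "of_bool (w \<in> heads n u) + of_bool (u \<in> heads n w) = (1::nat)"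
      using heads_tournament[of u n w] by (cases "w \<in> heads n u") simp_all
  qed
  finally show ?thesis using W by simp
qed

text \<open>Here the vertices outside \<open>S \<union> D\<close> contribute as well. The
  probability \<open>(1 - x)^21 * (1 + 21 * x)\<close> at a vertex is bounded by the exponential of
  a linear function of \<open>x\<close>, so that only the sum of the \<open>x u\<close> matters,
  which \<open>sum_card_stuck_heads\<close> controls.\<close>

lemma card_stuck_large:
  assumes n: "3 \<le> n" and S: "S \<subseteq> {..<n}" and D: "D \<subseteq> {..<n}" "card D = 2 * card S" "S \<inter> D = {}"
  shows "real (card (stuck n 22 S D)) \<le> card (picks n 22) *
    exp ((ln 4 - 3/4) * (real n - 2 * card S) - 63/2 * (card S * (real n - 3 * card S)) / n)"
proof -
  define x where "x u = real (card (stuck_heads n S D u)) / card (heads n u)" for u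
  define g where "g u = (if u \<in> D then 1 else exp (ln 4 - 3/4 - 63/4 * x u))" for u
  have fin: "finite S" "finite D" using S D finite_subset by blast+
  have mpos: "0 < card (heads n u)" if "u < n" for u using card_heads_ge[OF that] n by linarith
  have x: "0 \<le> x u" "x u \<le> 1" if "u < n" for u
    unfolding x_def using mpos[OF that] card_mono[OF finite_heads stuck_heads_subset[of n S D u]]
    by auto
  have "real (card (stuck n 22 S D)) \<le> card (picks n 22) * (\<Prod>u<n. g u)"
  proof (rule card_stuck_le[OF n])
    fix u assume u: "u < n"
    let ?F = "stuck_heads n S D u" and ?M = "heads n u"
    let ?L = "{h \<in> {..<22} \<rightarrow>\<^sub>E ?M. card {i. i < (22::nat) \<and> h i \<in> ?F} \<le> 1}"
    show "real (card ?L) \<le> real (card ?M) ^ 22 * g u"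
    proof (cases "u \<in> D")
      case False
      have ne: "?M \<noteq> {}" using mpos[OF u] by auto
      have "(1 - x u) ^ 21 \<le> exp (- x u) ^ 21"
        using exp_ge_add_one_self[of "- x u"] x[OF u] by (intro power_mono) auto
      also have "\<dots> = exp (- 21 * x u)" by (simp flip: exp_of_nat_mult)
      finally have 1: "(1 - x u) ^ 21 \<le> exp (- 21 * x u)" .
      \<comment> \<open>Tangent of \<open>exp\<close>, touching where \<open>21 * x u = 3\<close>.
        It leaves three quarters of the decay \<open>exp (- 21 * x u)\<close>, hence
        \<open>63/4\<close>, for a constant factor \<open>4 * exp (- 3/4)\<close> per
        vertex.\<close>
      have 2: "1 + 21 * x u \<le> exp (ln 4) * exp ((21 * x u - 3) / 4)"
      proof -
        have "exp (ln 4) = (4::real)" by simp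
        moreover have "1 + 21 * x u \<le> 4 * exp ((21 * x u - 3) / 4)"
        proof -
          have "1 + 21 * x u \<le> 4 * E" if "1 + (21 * x u - 3) / 4 \<le> E" for E :: real using that by argo
          then show ?thesis using exp_ge_add_one_self by blast
        qed
        ultimately show ?thesis by (simp only:)
      qed
      have "(1 - x u) ^ 21 * (1 + 21 * x u) \<le> exp (- 21 * x u) * (exp (ln 4) * exp ((21 * x u - 3) / 4))"
        using 1 2 x[OF u] by (intro mult_mono) auto
      also have "\<dots> = exp (ln 4 - 3/4 - 63/4 * x u)"
        unfolding exp_add[symmetric] by (rule arg_cong[of _ _ exp]) (simp add: field_simps)
      finally have "real (card ?M) ^ 22 * ((1 - x u) ^ 21 * (1 + 21 * x u)) \<le> real (card ?M) ^ 22 * g u"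
        using False by (intro mult_left_mono) (auto simp: g_def)
      moreover have "real (card ?L) \<le> real (card ?M) ^ 22 * ((1 - x u) ^ 21 * (1 + 21 * x u))"
        using card_at_most_one[OF finite_heads stuck_heads_subset ne, of 22 S D] unfolding x_def by simp
      ultimately show ?thesis by linarith
    next
      case True
      have "card ?L \<le> card ({..<22::nat} \<rightarrow>\<^sub>E ?M)" by (intro card_mono finite_PiE) auto
      then have "card ?L \<le> card ?M ^ 22" by (simp add: card_funcsetE)
      then have "real (card ?L) \<le> real (card ?M ^ 22)" by (simp only: of_nat_le_iff)
      then show ?thesis using True by (simp add: g_def)
    qed
  qed
  also have "(\<Prod>u<n. g u) \<le>
    exp ((ln 4 - 3/4) * (real n - 2 * card S) - 63/2 * (card S * (real n - 3 * card S)) / n)"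
  proof -
    have "3 * card S \<le> n"
    proof -
      have "card S + card D = card (S \<union> D)" using fin D by (simp add: card_Un_disjoint)
      also have "\<dots> \<le> n" using S D card_mono[of "{..<n}" "S \<union> D"] by simp
      finally show ?thesis using D by simp
    qed
    then have sum: "(\<Sum>u\<in>{..<n} - D. real (card (stuck_heads n S D u))) = card S * (real n - 3 * card S)"
      using sum_card_stuck_heads[OF S D(1,3)] D(2)
      by (simp add: of_nat_diff algebra_simps flip: of_nat_sum)
    have "card S * (real n - 3 * card S) * (2 / n) = (\<Sum>u\<in>{..<n} - D. card (stuck_heads n S D u) * (2 / n))"
      by (simp only: sum_distrib_right[symmetric] sum)
    also have "\<dots> \<le> (\<Sum>u\<in>{..<n} - D. x u)"
    proof (intro sum_mono)
      fix u assume "u \<in> {..<n} - D"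
      then have u: "u < n" by simp
      have "2 * real (card (heads n u)) \<le> n" using card_heads_le[OF u] by linarith
      then have "2 / real n \<le> 1 / card (heads n u)" using mpos[OF u] by (simp add: field_simps)
      then show "card (stuck_heads n S D u) * (2 / n) \<le> x u"
        unfolding x_def using mult_left_mono[of "2 / real n" "1 / card (heads n u)" "card (stuck_heads n S D u)"]
        by simp
    qed
    finally have sx: "card S * (real n - 3 * card S) * (2 / n) \<le> (\<Sum>u\<in>{..<n} - D. x u)" .
    have "(\<Prod>u<n. g u) = (\<Prod>u\<in>{..<n} - D. exp (ln 4 - 3/4 - 63/4 * x u))"
      unfolding g_def by (intro prod.mono_neutral_cong_right) auto
    also have "\<dots> = exp ((ln 4 - 3/4) * card ({..<n} - D) - 63/4 * (\<Sum>u\<in>{..<n} - D. x u))"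
    proof -
      have "(\<Sum>u\<in>{..<n} - D. ln 4 - 3/4 - 63/4 * x u) =
          (ln 4 - 3/4) * card ({..<n} - D) - 63/4 * (\<Sum>u\<in>{..<n} - D. x u)"
        unfolding sum_subtractf sum_distrib_left sum_constant by (simp add: algebra_simps)
      then show ?thesis by (simp add: exp_sum[symmetric])
    qed
    also have "\<dots> \<le> exp ((ln 4 - 3/4) * (real n - 2 * card S) - 63/2 * (card S * (real n - 3 * card S)) / n)"
    proof -
      have "card ({..<n} - D) = n - 2 * card S" using D fin by (simp add: card_Diff_subset)
      then have "real (card ({..<n} - D)) = real n - 2 * card S" using \<open>3 * card S \<le> n\<close> by (simp add: of_nat_diff)
      moreover have "63/2 * (card S * (real n - 3 * card S)) / n \<le> 63/4 * (\<Sum>u\<in>{..<n} - D. x u)"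
        using mult_left_mono[OF sx, of "63/4"] by simp
      ultimately show ?thesis by simp
    qed
    finally show ?thesis .
  qed
  finally show ?thesis by (simp add: mult_left_mono)
qed

section \<open>Numerical estimates and the union bound\<close>

text \<open>\<open>s ^ s / fact s\<close> is one term of the series of \<open>exp s\<close>, and
  \<open>exp 1 \<le> 3\<close>.\<close>

lemma binomial_le_power: 
  assumes "1 \<le> s"
  shows "real (m choose s) \<le> (3 * real m / real s) ^ s"
proof -
  have "real (m choose s) * fact s \<le> real m ^ s"
    using binomial_fact_pow[of m s] by (metis of_nat_fact of_nat_le_iff of_nat_mult of_nat_power)
  moreover have "real s ^ s \<le> 3 ^ s * fact s"
  proof -
    have "real s ^ s / fact s \<le> exp (real s)"
      using sum_le_suminf[OF summable_exp_generic[of "real s"], of "{s}"]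
      by (simp add: exp_def scaleR_conv_of_real divide_inverse mult.commute)
    also have "\<dots> = exp 1 ^ s" by (simp flip: exp_of_nat_mult)
    also have "\<dots> \<le> 3 ^ s" using exp_le by (intro power_mono) auto
    finally show ?thesis by (simp add: field_simps)
  qed
  ultimately have "real (m choose s) * fact s * real s ^ s \<le> real m ^ s * (3 ^ s * fact s)"
    by (intro mult_mono) auto
  then have "real (m choose s) * real s ^ s \<le> real m ^ s * 3 ^ s" by simp
  then show ?thesis using assms by (simp add: power_divide power_mult_distrib field_simps)
qed

text \<open>With \<open>x = s / n\<close> the base of the \<open>s\<close>-th power is of order
  \<open>x^18\<close>, and for \<open>x \<le> 1/12\<close> it is at most
  \<open>3 * x \<le> 1/4\<close>. One factor \<open>3 * x\<close> is split off to supply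
  \<open>1 / n\<close>, and \<open>s \<le> 2^(s - 1)\<close> absorbs the \<open>s\<close> left over.
  The constant \<open>6.04\<close> exceeds \<open>6 * n / (n - 2)\<close> for
  \<open>n \<ge> 400\<close>.\<close>

lemma small_sets_term:
  fixes n s :: nat
  assumes n: "400 \<le> n" and s: "1 \<le> s" "12 * s \<le> n"
  shows "real (n choose s) * real (n choose (2 * s)) * (real 22 * (6 * real s / (real n - 2)) ^ (22 - 1)) ^ s
    \<le> 3 / real n * (1 / 2) ^ (s - 1)"
proof -
  define x where "x = real s / real n"
  have x: "0 < x" "x \<le> 1/12" using n s by (auto simp: x_def field_simps)
  have y: "6 * real s / (real n - 2) \<le> 6.04 * x" "0 \<le> 6 * real s / (real n - 2)"
  proof -
    have "6 * real n \<le> 6.04 * (real n - 2)" using n by simp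
    then have "real s * (6 * real n) \<le> real s * (6.04 * (real n - 2))" by (intro mult_left_mono) auto
    then show "6 * real s / (real n - 2) \<le> 6.04 * x" using n unfolding x_def by (simp add: field_simps)
    show "0 \<le> 6 * real s / (real n - 2)" using n by simp
  qed
  let ?q = "3 / x * (3 / (2 * x))\<^sup>2 * (22 * (6.04 * x) ^ 21)"
  have "real (n choose s) \<le> (3 / x) ^ s"
    using binomial_le_power[OF s(1), of n] by (simp add: x_def)
  moreover have "real (n choose (2 * s)) \<le> ((3 / (2 * x))\<^sup>2) ^ s"
    using binomial_le_power[of "2 * s" n] s by (simp add: x_def power_mult[symmetric])
  moreover have "(real 22 * (6 * real s / (real n - 2)) ^ (22 - 1)) ^ s \<le> (22 * (6.04 * x) ^ 21) ^ s"
    using y by (intro power_mono mult_mono) auto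
  ultimately have "real (n choose s) * real (n choose (2 * s)) * (real 22 * (6 * real s / (real n - 2)) ^ (22 - 1)) ^ s
      \<le> (3 / x) ^ s * ((3 / (2 * x))\<^sup>2) ^ s * (22 * (6.04 * x) ^ 21) ^ s"
    using x y n by (intro mult_mono) auto
  also have "\<dots> = ?q ^ s" by (simp only: power_mult_distrib)
  also have "?q = 297 / 2 * 6.04 ^ 21 * x ^ 18"
  proof -
    have "x ^ 21 = x ^ 3 * x ^ 18" by (simp flip: power_add)
    then show ?thesis using x(1)
      by (simp add: power_mult_distrib power_divide power2_eq_square power3_eq_cube)
  qed
  also have "(297 / 2 * 6.04 ^ 21 * x ^ 18) ^ s \<le> (3 * x) ^ s"
  proof (rule power_mono)
    have "x ^ 18 = x ^ 17 * x" by (simp flip: power_Suc2)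
    also have "\<dots> \<le> (1/12) ^ 17 * x" using x by (intro mult_right_mono power_mono) auto
    finally have "297 / 2 * 6.04 ^ 21 * x ^ 18 \<le> 297 / 2 * 6.04 ^ 21 * ((1/12) ^ 17 * x)"
      by (intro mult_left_mono) auto
    also have "\<dots> = (297 / 2 * 6.04 ^ 21 * (1/12) ^ 17) * x" by simp
    also have "\<dots> \<le> 3 * x" using x by (intro mult_right_mono) (auto simp: field_simps)
    finally show "297 / 2 * 6.04 ^ 21 * x ^ 18 \<le> 3 * x" .
  qed (use x in simp)
  also have "(3 * x) ^ s = 3 * x * (3 * x) ^ (s - 1)" using s by (cases s) auto
  also have "\<dots> \<le> 3 * x * (1/4) ^ (s - 1)" using x by (intro mult_left_mono power_mono) auto
  also have "\<dots> = 3 / real n * (real s * (1/2) ^ (s - 1)) * (1/2) ^ (s - 1)"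
    by (simp add: x_def power_mult_distrib[symmetric])
  also have "\<dots> \<le> 3 / real n * 1 * (1/2) ^ (s - 1)"
  proof -
    have "s \<le> 2 ^ (s - 1)" using s(1)
    proof (induction s rule: dec_induct)
      case (step m)
      then show ?case by (cases m) auto
    qed simp
    then have "real s \<le> 2 ^ (s - 1)" by (metis of_nat_le_iff of_nat_numeral of_nat_power)
    then have "real s * (1/2) ^ (s - 1) \<le> 1" by (simp add: power_divide field_simps)
    then show ?thesis by (intro mult_right_mono mult_left_mono) auto
  qed
  finally show ?thesis by simp
qed

text \<open>The concave function \<open>s * (n - 3 * s)\<close> equals \<open>n^2/16\<close> at both
  ends \<open>n/12\<close> and \<open>n/4\<close> of the range, so it is at least that between them.
  With \<open>ln 4 \<le> 25/18\<close> the exponent is at most \<open>n\<close> times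
  \<open>(25/18) * (11/6) - 5/8 - 63/32\<close>, which is about \<open>-0.047\<close>.\<close>

lemma large_sets_term:
  fixes n s :: nat
  assumes n: "1 \<le> n" and s: "n \<le> 12 * s" "4 * s \<le> n"
  shows "4 ^ n * exp ((ln 4 - 3/4) * (real n - 2 * real s) - 63/2 * (real s * (real n - 3 * real s)) / real n)
    \<le> exp (- real n / 25)"
proof -
  have s': "real n \<le> 12 * real s" "4 * real s \<le> real n" using s by linarith+
  have "ln (4::real) = 2 * ln 2" using ln_realpow[of 2 2] by simp
  then have ln4: "ln (4::real) \<le> 25/18" "3/4 \<le> ln (4::real)"
    using ln2_le_25_over_36 ln2_ge_two_thirds by auto
  have "(ln 4 - 3/4) * (real n - 2 * real s) \<le> (ln 4 - 3/4) * (5/6 * real n)"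
    using s' ln4 by (intro mult_left_mono) auto
  moreover have "0 \<le> (12 * real s - real n) * (real n - 4 * real s)" using s' by simp
  then have "(real n)\<^sup>2 / 16 \<le> real s * (real n - 3 * real s)"
    by (simp add: algebra_simps power2_eq_square)
  then have "63/2 * (real n / 16) \<le> 63/2 * (real s * (real n - 3 * real s)) / real n"
    using n by (simp add: field_simps power2_eq_square)
  moreover have "ln 4 * real n \<le> 25/18 * real n" using ln4 by (intro mult_right_mono) auto
  ultimately have "ln 4 * real n + ((ln 4 - 3/4) * (real n - 2 * real s) -
      63/2 * (real s * (real n - 3 * real s)) / real n) \<le> - real n / 25"
  proof -
    have "l * m + (X - Y) \<le> - m / 25"
      if "X \<le> (l - 3/4) * (5/6 * m)" "63/2 * (m / 16) \<le> Y" "l * m \<le> 25/18 * m" "0 \<le> m"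
      for l m X Y :: real
      using that by (simp add: algebra_simps)
    from this[OF \<open>(ln 4 - 3/4) * (real n - 2 * real s) \<le> (ln 4 - 3/4) * (5/6 * real n)\<close>
        \<open>63/2 * (real n / 16) \<le> 63/2 * (real s * (real n - 3 * real s)) / real n\<close>
        \<open>ln 4 * real n \<le> 25/18 * real n\<close>]
    show ?thesis by simp
  qed
  moreover have "(4::real) ^ n = exp (ln 4 * real n)"
    by (simp add: exp_of_nat2_mult)
  ultimately show ?thesis by (simp flip: exp_add)
qed

lemma card_nonexpander:
  assumes n: "400 \<le> n"
  shows "real (card {f \<in> picks n 22. \<exists>r. \<not> expander {..<n} (picked_graph n (\<lambda>u. {..<22} - {r u}) f)})
    \<le> card (picks n 22) * (6 / real n + exp (- real n / 25))" (is "real (card ?X) \<le> _")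
proof -
  define N where "N = card (picks n 22)"
  define sets where "sets s = {S. S \<subseteq> {..<n} \<and> card S = s}" for s
  \<comment> \<open>Small pairs are counted by size through binomials, without asking for
    disjointness; for large ones the crude \<open>4 ^ n\<close> suffices.\<close>
  define small where "small = (SIGMA s:{1..n div 12}. sets s \<times> sets (2 * s))"
  define large where "large = {(S, D). S \<subseteq> {..<n} \<and> D \<subseteq> {..<n} \<and> S \<inter> D = {} \<and>
    n \<le> 12 * card S \<and> 4 * card S \<le> n \<and> card D = 2 * card S}"
  have fin_sets: "finite (sets s)" for s
    unfolding sets_def by (rule finite_subset[of _ "Pow {..<n}"]) auto
  have card_sets: "card (sets s) = n choose s" for s
    unfolding sets_def using n_subsets[of "{..<n}" s] by simp
  have large_sub: "large \<subseteq> Pow {..<n} \<times> Pow {..<n}" unfolding large_def by auto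
  then have fin_large: "finite large" using finite_subset by blast
  have "card large \<le> card (Pow {..<n} \<times> Pow {..<n})" using large_sub by (intro card_mono) auto
  also have "\<dots> = 4 ^ n" by (simp add: card_cartesian_product card_Pow power_mult_distrib[symmetric])
  finally have card_large: "card large \<le> 4 ^ n" .
  have sub: "?X \<subseteq> (\<Union>(s, S, D)\<in>small. stuck n 22 S D) \<union> (\<Union>(S, D)\<in>large. stuck n 22 S D)"
  proof
    fix f assume "f \<in> ?X"
    then obtain r where "f \<in> picks n 22" "\<not> expander {..<n} (picked_graph n (\<lambda>u. {..<22} - {r u}) f)"
      by auto
    then obtain S D where SD: "S \<subseteq> {..<n}" "D \<subseteq> {..<n}" "S \<inter> D = {}" "S \<noteq> {}" "4 * card S \<le> n"
      "card D = 2 * card S" "f \<in> stuck n 22 S D"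
      using nonexpander_stuck by metis
    have "1 \<le> card S" using SD(1,4) by (metis One_nat_def Suc_leI card_gt_0_iff finite_lessThan finite_subset)
    show "f \<in> (\<Union>(s, S, D)\<in>small. stuck n 22 S D) \<union> (\<Union>(S, D)\<in>large. stuck n 22 S D)"
    proof (cases "n \<le> 12 * card S")
      case True
      then have "(S, D) \<in> large" unfolding large_def using SD by simp
      then show ?thesis using SD(7) by blast
    next
      case False
      then have "card S \<le> n div 12" by linarith
      then have "(card S, S, D) \<in> small"
        unfolding small_def sets_def using SD \<open>1 \<le> card S\<close> by simp
      then show ?thesis using SD(7) by blast
    qed
  qed
  have fin_small: "finite small" unfolding small_def using fin_sets by (intro finite_SigmaI) auto
  have fin_stuck: "finite (stuck n 22 S D)" for S D unfolding stuck_def by simp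
  have "card ?X \<le> card ((\<Union>(s, S, D)\<in>small. stuck n 22 S D) \<union> (\<Union>(S, D)\<in>large. stuck n 22 S D))"
    using fin_small fin_large fin_stuck by (intro card_mono[OF _ sub]) auto
  also have "\<dots> \<le> card (\<Union>(s, S, D)\<in>small. stuck n 22 S D) + card (\<Union>(S, D)\<in>large. stuck n 22 S D)"
    by (rule card_Un_le)
  finally have *: "real (card ?X) \<le> real (card (\<Union>(s, S, D)\<in>small. stuck n 22 S D)) +
      real (card (\<Union>(S, D)\<in>large. stuck n 22 S D))" by linarith
  have "card (\<Union>(s, S, D)\<in>small. stuck n 22 S D) \<le> (\<Sum>(s, S, D)\<in>small. card (stuck n 22 S D))"
    using card_UN_le[OF fin_small, of "\<lambda>(s, S, D). stuck n 22 S D"] by (simp add: case_prod_beta)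
  then have "real (card (\<Union>(s, S, D)\<in>small. stuck n 22 S D)) \<le>
      real (\<Sum>(s, S, D)\<in>small. card (stuck n 22 S D))" by (simp only: of_nat_le_iff)
  also have "\<dots> = (\<Sum>x\<in>small. real (card (stuck n 22 (fst (snd x)) (snd (snd x)))))"
    by (simp add: case_prod_beta)
  also have "\<dots> \<le> (\<Sum>x\<in>small. N * (real 22 * (6 * real (fst x) / (real n - 2)) ^ (22 - 1)) ^ fst x)"
  proof (rule sum_mono)
    fix x assume "x \<in> small"
    then obtain s S D where x: "x = (s, S, D)" "S \<subseteq> {..<n}" "card S = s" "D \<subseteq> {..<n}" "card D = 2 * s"
      unfolding small_def sets_def by auto
    then show "real (card (stuck n 22 (fst (snd x)) (snd (snd x)))) \<le>
        N * (real 22 * (6 * real (fst x) / (real n - 2)) ^ (22 - 1)) ^ fst x"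
      using card_stuck_small[of n 22 S D] n unfolding N_def by simp
  qed
  also have "\<dots> = (\<Sum>s\<in>{1..n div 12}. N * (real (n choose s) * real (n choose (2 * s)) *
      (real 22 * (6 * real s / (real n - 2)) ^ (22 - 1)) ^ s))"
  proof -
    have "(\<Sum>x\<in>small. G (fst x)) = (\<Sum>s\<in>{1..n div 12}. \<Sum>y\<in>sets s \<times> sets (2 * s). G s)"
      for G :: "nat \<Rightarrow> real"
      unfolding small_def using fin_sets
        sum.Sigma[of "{1..n div 12}" "\<lambda>s. sets s \<times> sets (2 * s)" "\<lambda>s _. G s"]
      by (simp add: case_prod_beta)
    also have "(\<Sum>s\<in>{1..n div 12}. \<Sum>y\<in>sets s \<times> sets (2 * s). G s) =
        (\<Sum>s\<in>{1..n div 12}. real (n choose s) * real (n choose (2 * s)) * G s)" for G :: "nat \<Rightarrow> real"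
      by (simp add: card_cartesian_product card_sets)
    finally have *: "(\<Sum>x\<in>small. G (fst x)) =
        (\<Sum>s\<in>{1..n div 12}. real (n choose s) * real (n choose (2 * s)) * G s)" for G :: "nat \<Rightarrow> real" .
    show ?thesis
      by (rule trans[OF *[of "\<lambda>s. N * (real 22 * (6 * real s / (real n - 2)) ^ (22 - 1)) ^ s"]])
        (intro sum.cong refl, simp only: ac_simps)
  qed
  also have "\<dots> \<le> (\<Sum>s\<in>{1..n div 12}. N * (3 / real n * (1 / 2) ^ (s - 1)))"
    using n by (intro sum_mono mult_left_mono small_sets_term) auto
  also have "\<dots> = N * (3 / real n * (\<Sum>s\<in>{1..n div 12}. (1 / 2) ^ (s - 1)))"
    by (simp add: sum_distrib_left)
  also have "\<dots> \<le> N * (3 / real n * 2)"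
  proof -
    have "(\<Sum>s\<in>{1..n div 12}. (1 / 2 :: real) ^ (s - 1)) = (\<Sum>s<n div 12. (1 / 2) ^ s)"
      by (rule sum.reindex_bij_witness[of _ Suc "\<lambda>s. s - 1"]) auto
    also have "\<dots> \<le> 2" by (simp add: geometric_sum)
    finally show ?thesis by (intro mult_left_mono) auto
  qed
  finally have small: "real (card (\<Union>(s, S, D)\<in>small. stuck n 22 S D)) \<le> N * (6 / real n)" by simp
  have "card (\<Union>(S, D)\<in>large. stuck n 22 S D) \<le> (\<Sum>(S, D)\<in>large. card (stuck n 22 S D))"
    using card_UN_le[OF fin_large, of "\<lambda>(S, D). stuck n 22 S D"] by (simp add: case_prod_beta)
  then have "real (card (\<Union>(S, D)\<in>large. stuck n 22 S D)) \<le> real (\<Sum>(S, D)\<in>large. card (stuck n 22 S D))"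
    by (simp only: of_nat_le_iff)
  also have "\<dots> = (\<Sum>x\<in>large. real (card (stuck n 22 (fst x) (snd x))))"
    by (simp add: case_prod_beta)
  also have "\<dots> \<le> (\<Sum>x\<in>large. N * (exp (- real n / 25) / 4 ^ n))"
  proof (rule sum_mono)
    fix x assume "x \<in> large"
    then obtain S D where x: "x = (S, D)" "S \<subseteq> {..<n}" "D \<subseteq> {..<n}" "S \<inter> D = {}"
      "n \<le> 12 * card S" "4 * card S \<le> n" "card D = 2 * card S"
      unfolding large_def by auto
    have "real (card (stuck n 22 S D)) \<le> N *
      exp ((ln 4 - 3/4) * (real n - 2 * card S) - 63/2 * (card S * (real n - 3 * card S)) / n)"
      unfolding N_def using n x by (intro card_stuck_large) auto
    also have "\<dots> \<le> N * (exp (- real n / 25) / 4 ^ n)"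
      using large_sets_term[of n "card S"] x n by (intro mult_left_mono) (auto simp: field_simps)
    finally show "real (card (stuck n 22 (fst x) (snd x))) \<le> N * (exp (- real n / 25) / 4 ^ n)"
      by (simp add: x)
  qed
  also have "\<dots> = real (card large) * (N * (exp (- real n / 25) / 4 ^ n))" by simp
  also have "\<dots> \<le> 4 ^ n * (N * (exp (- real n / 25) / 4 ^ n))"
  proof (rule mult_right_mono)
    show "real (card large) \<le> 4 ^ n"
      using card_large by (metis of_nat_le_iff of_nat_numeral of_nat_power)
  qed simp
  finally have "real (card (\<Union>(S, D)\<in>large. stuck n 22 S D)) \<le> N * exp (- real n / 25)" by simp
  with * small show ?thesis unfolding N_def by (simp add: distrib_left)
qed

lemma card_nonhamiltonian_picks:
  assumes n: "400 \<le> n"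
  shows "real (card {f \<in> picks n 22. \<not> hamiltonian n (picked_graph n (\<lambda>_. {..<22}) f)})
    \<le> card (picks n 22) * (6 / real n + exp (- real n / 25) + sqrt ((44 / 45) ^ n))" (is "real (card ?X) \<le> _")
proof -
  define Y where "Y = {f \<in> picks n 22. \<exists>r. \<not> expander {..<n} (picked_graph n (\<lambda>u. {..<22} - {r u}) f)}"
  define Z where "Z = {f \<in> picks n 22. \<not> hamiltonian n (picked_graph n (\<lambda>_. {..<22}) f) \<and>
    (\<forall>r\<in>{..<n} \<rightarrow>\<^sub>E {..<22}. expander {..<n} (picked_graph n (\<lambda>u. {..<22} - {r u}) f))}"
  have "(real (card Z))\<^sup>2 * (1 - 2 / real 22) ^ n \<le> exp (- real n / 8) * (real (card (picks n 22)))\<^sup>2"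
    unfolding Z_def using n by (intro card_nonhamiltonian_expander) auto
  then have "(real (card Z))\<^sup>2 \<le> (11 / 10) ^ n * exp (- real n / 8) * (real (card (picks n 22)))\<^sup>2"
    by (simp add: field_simps power_divide)
  also have "(11 / 10) ^ n * exp (- real n / 8) \<le> (44 / 45 :: real) ^ n"
  proof -
    \<comment> \<open>\<open>exp (1/8) \<ge> 9/8\<close> and \<open>(11/10) * (8/9) = 44/45\<close>.
      In the squared count, the gain \<open>exp (- n/8)\<close> from the boosters outweighs the loss
      \<open>(10/11)^n\<close> for sparing a longest path.\<close>
    have "(11 / 10) * exp (- 1 / 8) \<le> (44 / 45 :: real)"
      using exp_ge_add_one_self[of "1 / 8 :: real"] by (simp add: exp_minus field_simps)
    then have "((11 / 10) * exp (- 1 / 8)) ^ n \<le> (44 / 45 :: real) ^ n" by (intro power_mono) auto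
    moreover have "exp (- 1 / 8) ^ n = exp (- real n / 8)" by (simp flip: exp_of_nat_mult)
    ultimately show ?thesis by (simp only: power_mult_distrib)
  qed
  finally have "(real (card Z))\<^sup>2 \<le> (44 / 45) ^ n * (real (card (picks n 22)))\<^sup>2"
    by (simp add: mult_right_mono)
  then have "real (card Z) \<le> sqrt ((44 / 45) ^ n * (real (card (picks n 22)))\<^sup>2)"
    by (rule real_le_rsqrt)
  then have Z: "real (card Z) \<le> card (picks n 22) * sqrt ((44 / 45) ^ n)"
    by (simp add: real_sqrt_mult mult.commute)
  have "?X \<subseteq> Y \<union> Z" unfolding Y_def Z_def by auto
  then have "card ?X \<le> card (Y \<union> Z)" by (intro card_mono) (auto simp: Y_def Z_def)
  also have "\<dots> \<le> card Y + card Z" by (rule card_Un_le)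
  finally have "real (card ?X) \<le> real (card Y) + real (card Z)" by linarith
  then show ?thesis using Z card_nonexpander[OF n] unfolding Y_def by (simp add: distrib_left)
qed

section \<open>Shuffling the heads\<close>

definition head_perms :: "nat \<Rightarrow> (nat \<Rightarrow> nat \<Rightarrow> nat) set" where
  "head_perms n = (\<Pi>\<^sub>E u\<in>{..<n}. {\<pi>. \<pi> permutes heads n u})"

lemma finite_head_perms [simp]: "finite (head_perms n)"
  unfolding head_perms_def by (intro finite_PiE ballI) (auto simp: finite_permutations)

lemma card_head_perms: "card (head_perms n) = (\<Prod>u<n. fact (card (heads n u)))"
  unfolding head_perms_def by (simp add: card_PiE card_permutations)

lemma head_perms_permutes: "\<sigma> \<in> head_perms n \<Longrightarrow> u < n \<Longrightarrow> \<sigma> u permutes heads n u"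
  unfolding head_perms_def using PiE_mem by fastforce

text \<open>Composing with the inverse of one solution turns all solutions into permutations that
  fix the \<open>k\<close> points \<open>a i\<close>.\<close>

lemma card_permutes_prescribed:
  assumes "finite M" "inj_on a {..<k}" "a ` {..<k} \<subseteq> M"
  shows "card {\<pi>. \<pi> permutes M \<and> (\<forall>i<k. \<pi> (a i) = b i)} \<le> fact (card M - k)"
proof (cases "{\<pi>. \<pi> permutes M \<and> (\<forall>i<k. \<pi> (a i) = b i)} = {}")
  case False
  then obtain \<rho> where \<rho>: "\<rho> permutes M" "\<And>i. i < k \<Longrightarrow> \<rho> (a i) = b i" by auto
  have "card {\<pi>. \<pi> permutes M \<and> (\<forall>i<k. \<pi> (a i) = b i)} \<le> card {\<pi>. \<pi> permutes M - a ` {..<k}}"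
  proof (rule card_inj_on_le[where f = "\<lambda>\<pi>. inv \<rho> \<circ> \<pi>"])
    show "inj_on (\<lambda>\<pi>. inv \<rho> \<circ> \<pi>) {\<pi>. \<pi> permutes M \<and> (\<forall>i<k. \<pi> (a i) = b i)}"
    proof (rule inj_onI)
      fix \<pi> \<pi>' :: "'a \<Rightarrow> 'a" assume "inv \<rho> \<circ> \<pi> = inv \<rho> \<circ> \<pi>'"
      then have "\<rho> \<circ> (inv \<rho> \<circ> \<pi>) = \<rho> \<circ> (inv \<rho> \<circ> \<pi>')" by simp
      then show "\<pi> = \<pi>'" using permutes_inv_o(1)[OF \<rho>(1)] by (simp flip: o_assoc add: o_assoc)
    qed
    show "(\<lambda>\<pi>. inv \<rho> \<circ> \<pi>) ` {\<pi>. \<pi> permutes M \<and> (\<forall>i<k. \<pi> (a i) = b i)} \<subseteq> {\<pi>. \<pi> permutes M - a ` {..<k}}"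
    proof (intro image_subsetI CollectI)
      fix \<pi> assume \<pi>: "\<pi> \<in> {\<pi>. \<pi> permutes M \<and> (\<forall>i<k. \<pi> (a i) = b i)}"
      have perm: "inv \<rho> \<circ> \<pi> permutes M"
        using \<pi> \<rho>(1) by (auto intro: permutes_compose permutes_inv)
      moreover have "(inv \<rho> \<circ> \<pi>) x = x" if nx: "x \<notin> M - a ` {..<k}" for x
      proof (cases "x \<in> M")
        case True
        then obtain i where i: "i < k" "x = a i" using nx by blast
        then have "\<pi> x = \<rho> x" using \<pi> \<rho>(2) by auto
        then show ?thesis using permutes_inverses(2)[OF \<rho>(1)] by simp
      next
        case False
        then show ?thesis using perm permutes_not_in by metis
      qed
      ultimately show "inv \<rho> \<circ> \<pi> permutes M - a ` {..<k}"
        unfolding permutes_def by blast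
    qed
    show "finite {\<pi>. \<pi> permutes M - a ` {..<k}}" using assms(1) by (intro finite_permutations) auto
  qed
  also have "\<dots> = fact (card M - k)"
    using assms by (subst card_permutations[OF refl]) (auto simp: card_Diff_subset card_image)
  finally show ?thesis .
next
  case True
  then show ?thesis by (simp only: card.empty)
qed

lemma fact_lower_bound:
  assumes "k \<le> m"
  shows "(m - k) ^ k * fact (m - k) \<le> (fact m :: nat)"
proof -
  have "(m - k) ^ j * fact (m - k) \<le> (fact (m - k + j) :: nat)" for j
  proof (induction j)
    case (Suc j)
    have "(m - k) ^ Suc j * fact (m - k) = (m - k) * ((m - k) ^ j * fact (m - k))" by simp
    also have "\<dots> \<le> (m - k + Suc j) * fact (m - k + j)" using Suc by (intro mult_mono) auto
    finally show ?case by simp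
  qed simp
  from this[of k] show ?thesis using assms by simp
qed

text \<open>Sampling without replacement has bounded density with respect to sampling with
  replacement, because only boundedly many samples are drawn at each vertex.\<close>

lemma card_head_perms_into:
  assumes n: "400 \<le> n" and X: "X \<subseteq> picks n 22"
    and a: "\<And>u. u < n \<Longrightarrow> inj_on (a u) {..<22}" "\<And>u i. u < n \<Longrightarrow> i < 22 \<Longrightarrow> a u i \<in> heads n u"
  shows "real (card {\<sigma> \<in> head_perms n. (\<lambda>u\<in>{..<n}. \<lambda>i\<in>{..<22}. \<sigma> u (a u i)) \<in> X}) * card (picks n 22)
    \<le> exp 1936 * card X * card (head_perms n)"
proof -
  define F where "F \<sigma> = (\<lambda>u\<in>{..<n}. \<lambda>i\<in>{..<22}. \<sigma> u (a u i))" for \<sigma> :: "nat \<Rightarrow> nat \<Rightarrow> nat"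
  define m where "m u = card (heads n u)" for u
  let ?Y = "{\<sigma> \<in> head_perms n. F \<sigma> \<in> X}"
  have finX: "finite X" by (rule finite_subset[OF X]) simp
  have m: "real n / 4 \<le> real (m u) - 22" "22 \<le> m u" if "u < n" for u
    using card_heads_ge[OF that] n unfolding m_def by linarith+
  have fiber: "card {\<sigma> \<in> ?Y. F \<sigma> = f} \<le> (\<Prod>u<n. fact (m u - 22))" for f
  proof -
    have "{\<sigma> \<in> ?Y. F \<sigma> = f} \<subseteq>
        (\<Pi>\<^sub>E u\<in>{..<n}. {\<pi>. \<pi> permutes heads n u \<and> (\<forall>i<22. \<pi> (a u i) = f u i)})" (is "_ \<subseteq> ?P")
    proof
      fix \<sigma> assume \<sigma>: "\<sigma> \<in> {\<sigma> \<in> ?Y. F \<sigma> = f}"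
      then have s: "\<sigma> \<in> head_perms n" by simp
      show "\<sigma> \<in> ?P"
      proof (rule PiE_I)
        fix u assume "u \<in> {..<n}"
        then have u: "u < n" by simp
        have "\<sigma> u (a u i) = f u i" if "i < 22" for i
        proof -
          have "F \<sigma> u i = f u i" using \<sigma> by simp
          then show ?thesis using u that unfolding F_def by simp
        qed
        then show "\<sigma> u \<in> {\<pi>. \<pi> permutes heads n u \<and> (\<forall>i<22. \<pi> (a u i) = f u i)}"
          using head_perms_permutes[OF s u] by simp
      next
        fix u assume "u \<notin> {..<n}"
        then show "\<sigma> u = undefined" using s unfolding head_perms_def by (rule PiE_arb[rotated])
      qed
    qed
    moreover have "finite ?P"
      by (intro finite_PiE ballI) (auto intro: finite_subset[OF _ finite_permutations[OF finite_heads]])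
    ultimately have "card {\<sigma> \<in> ?Y. F \<sigma> = f} \<le> card ?P" by (rule card_mono[rotated])
    also have "\<dots> = (\<Prod>u<n. card {\<pi>. \<pi> permutes heads n u \<and> (\<forall>i<22. \<pi> (a u i) = f u i)})"
      by (simp add: card_PiE)
    also have "\<dots> \<le> (\<Prod>u<n. fact (m u - 22))"
      unfolding m_def using a by (intro prod_mono conjI card_permutes_prescribed) auto
    finally show ?thesis .
  qed
  have "real (card ?Y) \<le> card X * (\<Prod>u<n. fact (m u - 22) :: real)"
  proof (rule card_le_fibres[where \<rho> = F])
    show "finite ?Y" by simp
    show "card (F ` ?Y) \<le> card X" using finX by (intro card_mono) auto
    show "real (card {\<sigma> \<in> ?Y. F \<sigma> = f}) \<le> (\<Prod>u<n. fact (m u - 22) :: real)" for f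
    proof -
      have "real (card {\<sigma> \<in> ?Y. F \<sigma> = f}) \<le> real (\<Prod>u<n. fact (m u - 22))"
        using fiber[of f] by (simp only: of_nat_le_iff)
      then show ?thesis by simp
    qed
  qed (intro prod_nonneg, simp)
  then have "real (card ?Y) * card (picks n 22) \<le>
      (card X * (\<Prod>u<n. fact (m u - 22) :: real)) * (\<Prod>u<n. real (m u) ^ 22)"
    unfolding card_picks m_def[symmetric] by (simp add: mult_right_mono prod_nonneg)
  also have "\<dots> = card X * (\<Prod>u<n. fact (m u - 22) * real (m u) ^ 22)"
    by (simp add: prod.distrib)
  \<comment> \<open>The density at one vertex is at most
    \<open>(m / (m - 22))^22 \<le> exp (484 / (m - 22))\<close>, and \<open>m - 22 \<ge> n/4\<close>
    makes this \<open>exp (1936 / n)\<close>; over \<open>n\<close> vertices it multiplies to a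
    constant.\<close>
  also have "\<dots> \<le> card X * (\<Prod>u<n. exp (1936 / real n) * fact (m u))"
  proof (intro mult_left_mono prod_mono conjI)
    fix u assume "u \<in> {..<n}"
    then have u: "u < n" by simp
    let ?d = "real (m u) - 22"
    have d: "0 < ?d" "real n / 4 \<le> ?d" using m[OF u] n by linarith+
    have "real (m u) = ?d * (1 + 22 / ?d)" using d by (simp add: field_simps)
    also have "\<dots> \<le> ?d * exp (22 / ?d)" using d exp_ge_add_one_self by (intro mult_left_mono) auto
    finally have "real (m u) ^ 22 \<le> (?d * exp (22 / ?d)) ^ 22" by (intro power_mono) auto
    also have "\<dots> = ?d ^ 22 * exp (484 / ?d)"
      by (simp add: power_mult_distrib flip: exp_of_nat_mult)
    also have "\<dots> \<le> ?d ^ 22 * exp (1936 / real n)"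
    proof -
      have "484 / ?d \<le> 484 / (real n / 4)" using d n by (intro divide_left_mono) auto
      then show ?thesis using d by (intro mult_left_mono) auto
    qed
    finally have "fact (m u - 22) * real (m u) ^ 22 \<le> fact (m u - 22) * (?d ^ 22 * exp (1936 / real n))"
      by (intro mult_left_mono) auto
    also have "\<dots> = exp (1936 / real n) * real ((m u - 22) ^ 22 * fact (m u - 22))"
      using m(2)[OF u] by (simp add: of_nat_diff)
    also have "\<dots> \<le> exp (1936 / real n) * real (fact (m u))"
      using fact_lower_bound[OF m(2)[OF u]] by (intro mult_left_mono) (simp_all only: of_nat_le_iff, simp)
    finally show "fact (m u - 22) * real (m u) ^ 22 \<le> exp (1936 / real n) * fact (m u)" by simp
  qed auto
  also have "(\<Prod>u<n. exp (1936 / real n) * fact (m u)) = exp 1936 * card (head_perms n)"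
    using n by (simp add: prod.distrib card_head_perms m_def flip: exp_of_nat_mult)
  finally show ?thesis unfolding F_def by (simp only: ac_simps)
qed

section \<open>Disjoint rainbow systems of choices\<close>

definition arcs :: "nat \<Rightarrow> (nat \<times> nat) set" where
  "arcs n = (SIGMA u:{..<n}. heads n u)"

text \<open>The colour of the edge \<open>{u, w}\<close> owned by \<open>u\<close> is \<open>g (u, w)\<close>.\<close>

definition balanced :: "nat \<Rightarrow> nat \<Rightarrow> nat \<Rightarrow> (nat \<times> nat \<Rightarrow> nat option) \<Rightarrow> bool" where
  "balanced n k T g \<longleftrightarrow>
     (\<forall>u<n. k * T \<le> card {w \<in> heads n u. g (u, w) \<noteq> None}) \<and>
     (\<forall>c. card {x \<in> arcs n. g x = Some c} \<le> T)"

lemma finite_arcs [simp]: "finite (arcs n)"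
  unfolding arcs_def by (intro finite_SigmaI) auto

text \<open>Koenig's theorem for the slots \<open>(u, j)\<close>, with left end the block
  \<open>(u, j div T)\<close> and right end the colour of the arc in the slot. A block has
  \<open>T\<close> slots and there are \<open>T\<close> classes, so each class takes exactly one
  slot from every block, and properness at the right ends makes it rainbow.\<close>

lemma balanced_decomposition:
  assumes "balanced n k T g"
  obtains a :: "nat \<Rightarrow> nat \<Rightarrow> nat \<Rightarrow> nat" where
    "\<And>t u i. t < T \<Longrightarrow> u < n \<Longrightarrow> i < k \<Longrightarrow> a t u i \<in> heads n u \<and> g (u, a t u i) \<noteq> None"
    "\<And>t t' u i i'. t < T \<Longrightarrow> t' < T \<Longrightarrow> u < n \<Longrightarrow> i < k \<Longrightarrow> i' < k \<Longrightarrow> a t u i = a t' u i' \<Longrightarrow>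
       t = t' \<and> i = i'"
    "\<And>t u i u' i'. t < T \<Longrightarrow> u < n \<Longrightarrow> i < k \<Longrightarrow> u' < n \<Longrightarrow> i' < k \<Longrightarrow>
       g (u, a t u i) = g (u', a t u' i') \<Longrightarrow> u = u' \<and> i = i'"
proof (cases "T = 0")
  case True
  then show ?thesis using that[of "\<lambda>_ _ _. 0"] by simp
next
  case False
  have "\<exists>L. L ` {..<k * T} \<subseteq> {w \<in> heads n u. g (u, w) \<noteq> None} \<and> inj_on L {..<k * T}" if "u < n" for u
    using assms that unfolding balanced_def by (intro card_le_inj) auto
  then obtain L where L: "\<And>u. u < n \<Longrightarrow> L u ` {..<k * T} \<subseteq> {w \<in> heads n u. g (u, w) \<noteq> None}"
    "\<And>u. u < n \<Longrightarrow> inj_on (L u) {..<k * T}" by metis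
  define X where "X = {..<n} \<times> {..<k * T}"
  define l where "l = (\<lambda>(u :: nat, j). (u, j div T))"
  define r where "r = (\<lambda>(u, j). g (u, L u j))"
  have block: "{j. j div T = i} = {i * T..<i * T + T}" for i
  proof -
    have "j div T = i \<longleftrightarrow> j \<in> {i * T..<i * T + T}" for j
    proof
      assume "j div T = i"
      then have "j = i * T + j mod T" using div_mult_mod_eq[of j T] by simp
      moreover have "j mod T < T" using False by simp
      ultimately show "j \<in> {i * T..<i * T + T}" by (metis atLeastLessThan_iff le_add1 nat_add_left_cancel_less)
    next
      assume "j \<in> {i * T..<i * T + T}"
      then have "j = i * T + (j - i * T)" "j - i * T < T" by auto
      then show "j div T = i" by (metis False div_less div_mult_self3 add_0_right)
    qed
    then show ?thesis by blast
  qed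
  have "card {e \<in> X. l e = x} \<le> T" for x
  proof -
    have "{e \<in> X. l e = x} \<subseteq> {fst x} \<times> {j. j div T = snd x}" unfolding X_def l_def by auto
    then have "card {e \<in> X. l e = x} \<le> card ({fst x} \<times> {j. j div T = snd x})"
      unfolding block by (intro card_mono) auto
    then show ?thesis unfolding block by (simp add: card_cartesian_product)
  qed
  moreover have "card {e \<in> X. r e = y} \<le> T" for y
  proof (cases y)
    case None
    then have "{e \<in> X. r e = y} = {}" unfolding X_def r_def using L(1) by fastforce
    then have "card {e \<in> X. r e = y} = 0" by (simp only: card.empty)
    then show ?thesis by simp
  next
    case (Some c)
    have "card {e \<in> X. r e = y} \<le> card {x \<in> arcs n. g x = Some c}"
    proof (rule card_inj_on_le[where f = "\<lambda>(u, j). (u, L u j)"])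
      show "inj_on (\<lambda>(u, j). (u, L u j)) {e \<in> X. r e = y}"
        unfolding X_def using L(2) by (auto simp: inj_on_def)
      show "(\<lambda>(u, j). (u, L u j)) ` {e \<in> X. r e = y} \<subseteq> {x \<in> arcs n. g x = Some c}"
        unfolding X_def r_def arcs_def using L(1) Some by fastforce
    qed simp
    also have "\<dots> \<le> T" using assms unfolding balanced_def by simp
    finally show ?thesis .
  qed
  ultimately obtain \<kappa> where \<kappa>: "\<kappa> ` X \<subseteq> {..<T}" "proper_colouring X l r \<kappa>"
    using bipartite_edge_colouring[of X l T r] unfolding X_def by auto
  have ex: "\<exists>j. j < k * T \<and> j div T = i \<and> \<kappa> (u, j) = t" if "t < T" "u < n" "i < k" for t u i
  proof -
    let ?J = "{i * T..<i * T + T}"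
    have kT: "j < k * T" if "j \<in> ?J" for j
    proof -
      have "j < Suc i * T" using that by simp
      also have "\<dots> \<le> k * T" using \<open>i < k\<close> by (intro mult_right_mono) auto
      finally show ?thesis .
    qed
    have "inj_on (\<lambda>j. \<kappa> (u, j)) ?J"
    proof (rule inj_onI)
      fix j j' assume j: "j \<in> ?J" "j' \<in> ?J" "\<kappa> (u, j) = \<kappa> (u, j')"
      have "j div T = i" "j' div T = i" using j(1,2) block[of i] by blast+
      then have "l (u, j) = l (u, j')" unfolding l_def by simp
      moreover have "(u, j) \<in> X" "(u, j') \<in> X" unfolding X_def using kT j \<open>u < n\<close> by auto
      ultimately have "(u, j) = (u, j')" using \<kappa>(2) j(3) unfolding proper_colouring_def by blast
      then show "j = j'" by simp
    qed
    then have "card ((\<lambda>j. \<kappa> (u, j)) ` ?J) = card {..<T}" by (simp add: card_image)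
    moreover have "(\<lambda>j. \<kappa> (u, j)) ` ?J \<subseteq> {..<T}"
      using \<kappa>(1) kT \<open>u < n\<close> unfolding X_def by blast
    ultimately have "(\<lambda>j. \<kappa> (u, j)) ` ?J = {..<T}" by (intro card_subset_eq) auto
    then obtain j where "j \<in> ?J" "\<kappa> (u, j) = t" using \<open>t < T\<close> by (metis imageE lessThan_iff)
    then show ?thesis using kT block[of i] by blast
  qed
  then obtain J where J: "\<And>t u i. t < T \<Longrightarrow> u < n \<Longrightarrow> i < k \<Longrightarrow>
      J t u i < k * T \<and> J t u i div T = i \<and> \<kappa> (u, J t u i) = t" by metis
  show ?thesis
  proof (rule that[of "\<lambda>t u i. L u (J t u i)"])
    fix t u i assume "t < T" "u < n" "i < k"
    then show "L u (J t u i) \<in> heads n u \<and> g (u, L u (J t u i)) \<noteq> None"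
      using J L(1) by (metis (mono_tags, lifting) image_subset_iff lessThan_iff mem_Collect_eq)
  next
    fix t t' u i i'
    assume *: "t < T" "t' < T" "u < n" "i < k" "i' < k" "L u (J t u i) = L u (J t' u i')"
    then have "J t u i = J t' u i'" using J L(2) unfolding inj_on_def by (metis lessThan_iff)
    then show "t = t' \<and> i = i'" using J[of t u i] J[of t' u i'] * by metis
  next
    fix t u i u' i'
    assume *: "t < T" "u < n" "i < k" "u' < n" "i' < k" "g (u, L u (J t u i)) = g (u', L u' (J t u' i'))"
    have "(u, J t u i) \<in> X" "(u', J t u' i') \<in> X" unfolding X_def using J * by auto
    moreover have "\<kappa> (u, J t u i) = \<kappa> (u', J t u' i')" using J * by metis
    moreover have "r (u, J t u i) = r (u', J t u' i')" using * unfolding r_def by simp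
    ultimately have "(u, J t u i) = (u', J t u' i')" using \<kappa>(2) unfolding proper_colouring_def by blast
    then show "u = u' \<and> i = i'" using J[of t u i] J[of t u' i'] * by (metis prod.inject)
  qed
qed

section \<open>Arcs as edges, and invariance under shuffling\<close>

definition arc_edge :: "nat \<times> nat \<Rightarrow> nat set" where
  "arc_edge x = {fst x, snd x}"

lemma bij_arc_edge: "bij_betw arc_edge (arcs n) (complete_graph_edges n)"
proof (rule bij_betw_imageI)
  show "inj_on arc_edge (arcs n)"
  proof (rule inj_onI)
    fix x y assume x: "x \<in> arcs n" and y: "y \<in> arcs n" and eq: "arc_edge x = arc_edge y"
    obtain u w where xu: "x = (u, w)" "u < n" "w \<in> heads n u" "w < n" "u \<noteq> w"
      using x heads_less heads_neq unfolding arcs_def by fastforce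
    obtain u' w' where yu: "y = (u', w')" "u' < n" "w' \<in> heads n u'"
      using y unfolding arcs_def by auto
    have "u = u' \<and> w = w' \<or> u = w' \<and> w = u'"
      using eq unfolding arc_edge_def xu(1) yu(1) by (auto simp: doubleton_eq_iff)
    then show "x = y" using heads_tournament[OF xu(2,4,5)] xu yu by auto
  qed
  show "arc_edge ` arcs n = complete_graph_edges n"
  proof
    show "arc_edge ` arcs n \<subseteq> complete_graph_edges n"
    proof
      fix e assume "e \<in> arc_edge ` arcs n"
      then obtain u w where "u < n" "w \<in> heads n u" "e = {u, w}" unfolding arcs_def arc_edge_def by auto
      then show "e \<in> complete_graph_edges n"
        using heads_less[of w n u] heads_neq[of w n u] unfolding complete_graph_edges_def by auto
    qed
    show "complete_graph_edges n \<subseteq> arc_edge ` arcs n"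
    proof
      fix e assume "e \<in> complete_graph_edges n"
      then obtain u w where e: "e = {u, w}" "u \<noteq> w" "u < n" "w < n"
        unfolding complete_graph_edges_def by (auto simp: card_2_iff)
      then consider "w \<in> heads n u" | "u \<in> heads n w" using heads_tournament by blast
      then show "e \<in> arc_edge ` arcs n"
      proof cases
        case 1
        then show ?thesis using e unfolding arcs_def arc_edge_def by (intro image_eqI[of _ _ "(u, w)"]) auto
      next
        case 2
        then show ?thesis using e unfolding arcs_def arc_edge_def by (intro image_eqI[of _ _ "(w, u)"]) auto
      qed
    qed
  qed
qed

lemma arc_edge_inj:
  "u < n \<Longrightarrow> w \<in> heads n u \<Longrightarrow> u' < n \<Longrightarrow> w' \<in> heads n u' \<Longrightarrow> {u, w} = {u', w'} \<Longrightarrow> u = u' \<and> w = w'"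
  using bij_betw_imp_inj_on[OF bij_arc_edge[of n]] inj_onD[of arc_edge "arcs n" "(u, w)" "(u', w')"]
  unfolding arcs_def arc_edge_def by auto

text \<open>The arc of an edge; other sets are sent to \<open>(n, n)\<close>, which is not an arc.\<close>

definition arc_of :: "nat \<Rightarrow> nat set \<Rightarrow> nat \<times> nat" where
  "arc_of n e = (if e \<in> complete_graph_edges n then inv_into (arcs n) arc_edge e else (n, n))"

text \<open>Colourings are pulled back, so the inverse permutation is what moves the colour of
  \<open>(u, w)\<close> to \<open>(u, \<sigma> u w)\<close>. Off the arcs the map is the identity,
  which keeps the default \<open>None\<close> in place.\<close>

definition shuffle_arc :: "nat \<Rightarrow> (nat \<Rightarrow> nat \<Rightarrow> nat) \<Rightarrow> nat \<times> nat \<Rightarrow> nat \<times> nat" where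
  "shuffle_arc n \<sigma> x = (if x \<in> arcs n then (fst x, inv (\<sigma> (fst x)) (snd x)) else x)"

definition shuffled_graph ::
    "nat \<Rightarrow> (nat \<Rightarrow> nat \<Rightarrow> nat) \<Rightarrow> (nat \<times> nat \<Rightarrow> nat option) \<Rightarrow> edge_coloured_graph" where
  "shuffled_graph n \<sigma> g = g \<circ> shuffle_arc n \<sigma> \<circ> arc_of n"

lemma bij_shuffle_arc:
  assumes "\<sigma> \<in> head_perms n"
  shows "bij_betw (shuffle_arc n \<sigma>) (arcs n) (arcs n)"
proof (rule bij_betw_byWitness[where f' = "\<lambda>x. (fst x, \<sigma> (fst x) (snd x))"])
  note perm = head_perms_permutes[OF assms]
  have inv: "w \<in> heads n u \<Longrightarrow> inv (\<sigma> u) w \<in> heads n u" and fwd: "w \<in> heads n u \<Longrightarrow> \<sigma> u w \<in> heads n u"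
    if "u < n" for u w
    using permutes_in_image[OF permutes_inv[OF perm[OF that]]] permutes_in_image[OF perm[OF that]] by auto
  show "\<forall>x\<in>arcs n. (fst (shuffle_arc n \<sigma> x), \<sigma> (fst (shuffle_arc n \<sigma> x)) (snd (shuffle_arc n \<sigma> x))) = x"
    using permutes_inverses(1)[OF perm] unfolding shuffle_arc_def arcs_def by auto
  show "\<forall>x\<in>arcs n. shuffle_arc n \<sigma> (fst x, \<sigma> (fst x) (snd x)) = x"
    using permutes_inverses(2)[OF perm] fwd unfolding shuffle_arc_def arcs_def by auto
  show "shuffle_arc n \<sigma> ` arcs n \<subseteq> arcs n"
    using inv unfolding shuffle_arc_def arcs_def by auto
  show "(\<lambda>x. (fst x, \<sigma> (fst x) (snd x))) ` arcs n \<subseteq> arcs n"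
    using fwd unfolding arcs_def by auto
qed

text \<open>The arcs carry independent copies of one distribution, so reindexing by a bijection
  keeps the law. This holds for each fixed \<open>\<sigma>\<close>, which permits averaging over
  \<open>\<sigma>\<close>.\<close>

lemma random_coloured_graph_shuffled:
  assumes "\<sigma> \<in> head_perms n"
  shows "random_coloured_graph c n p =
    map_pmf (shuffled_graph n \<sigma>) (Pi_pmf (arcs n) None (\<lambda>_. random_edge c p))"
proof -
  have fin: "finite (complete_graph_edges n)"
    using bij_betw_finite[OF bij_arc_edge[of n]] by simp
  have "bij_betw (arc_of n) (complete_graph_edges n) (arcs n)"
    using bij_betw_inv_into[OF bij_arc_edge[of n]]
    by (rule bij_betw_cong[THEN iffD2, rotated]) (simp add: arc_of_def)
  then have 1: "random_coloured_graph c n p =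
      map_pmf (\<lambda>g. g \<circ> arc_of n) (Pi_pmf (arcs n) None (\<lambda>_. random_edge c p))"
    unfolding random_coloured_graph_def
    by (rule Pi_pmf_bij_betw[OF fin]) (simp add: arc_of_def arcs_def)
  have 2: "Pi_pmf (arcs n) None (\<lambda>_. random_edge c p) =
      map_pmf (\<lambda>g. g \<circ> shuffle_arc n \<sigma>) (Pi_pmf (arcs n) None (\<lambda>_. random_edge c p))"
    by (rule Pi_pmf_bij_betw[OF finite_arcs bij_shuffle_arc[OF assms]]) (simp add: shuffle_arc_def)
  show ?thesis
    unfolding 1 by (subst 2) (simp add: map_pmf_comp shuffled_graph_def[abs_def])
qed

lemma shuffled_graph_edge:
  assumes \<sigma>: "\<sigma> \<in> head_perms n" and u: "u < n" "w \<in> heads n u"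
  shows "\<sigma> u w \<in> heads n u" "shuffled_graph n \<sigma> g {u, \<sigma> u w} = g (u, w)"
proof -
  note perm = head_perms_permutes[OF \<sigma> u(1)]
  show *: "\<sigma> u w \<in> heads n u" using permutes_in_image[OF perm] u by simp
  have x: "(u, \<sigma> u w) \<in> arcs n" using * u unfolding arcs_def by simp
  have e: "{u, \<sigma> u w} = arc_edge (u, \<sigma> u w)" unfolding arc_edge_def by simp
  have "arc_of n {u, \<sigma> u w} = (u, \<sigma> u w)"
    unfolding e arc_of_def
    using bij_betw_apply[OF bij_arc_edge x] inv_into_f_f[OF bij_betw_imp_inj_on[OF bij_arc_edge] x] by simp
  then show "shuffled_graph n \<sigma> g {u, \<sigma> u w} = g (u, w)"
    unfolding shuffled_graph_def shuffle_arc_def using x permutes_inverses(2)[OF perm] by simp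
qed

text \<open>Arcs move together with their colours, so disjointness and rainbowness are inherited
  from \<open>a\<close> for every \<open>\<sigma>\<close>; only Hamiltonicity depends on
  \<open>\<sigma>\<close>.\<close>

lemma packing_from_choices:
  fixes a :: "nat \<Rightarrow> nat \<Rightarrow> nat \<Rightarrow> nat"
  assumes \<sigma>: "\<sigma> \<in> head_perms n"
    and a: "\<And>t u i. t < T \<Longrightarrow> u < n \<Longrightarrow> i < k \<Longrightarrow> a t u i \<in> heads n u \<and> g (u, a t u i) \<noteq> None"
    and inj: "\<And>t t' u i i'. t < T \<Longrightarrow> t' < T \<Longrightarrow> u < n \<Longrightarrow> i < k \<Longrightarrow> i' < k \<Longrightarrow> a t u i = a t' u i' \<Longrightarrow>
       t = t' \<and> i = i'"
    and col: "\<And>t u i u' i'. t < T \<Longrightarrow> u < n \<Longrightarrow> i < k \<Longrightarrow> u' < n \<Longrightarrow> i' < k \<Longrightarrow>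
       g (u, a t u i) = g (u', a t u' i') \<Longrightarrow> u = u' \<and> i = i'"
  defines "R \<equiv> {t. t < T \<and> hamiltonian n (picked_graph n (\<lambda>_. {..<k}) (\<lambda>u\<in>{..<n}. \<lambda>i\<in>{..<k}. \<sigma> u (a t u i)))}"
  shows "\<exists>H. rainbow_hamilton_packing n (shuffled_graph n \<sigma> g) H \<and> card H = card R"
proof -
  let ?G = "shuffled_graph n \<sigma> g"
  define E where "E t = picked_graph n (\<lambda>_. {..<k}) (\<lambda>u\<in>{..<n}. \<lambda>i\<in>{..<k}. \<sigma> u (a t u i))" for t
  have E: "\<exists>u i. u < n \<and> i < k \<and> e = {u, \<sigma> u (a t u i)}" if "e \<in> E t" for e t
    using that unfolding E_def picked_graph_def by fastforce
  have sh: "\<sigma> u (a t u i) \<in> heads n u" "?G {u, \<sigma> u (a t u i)} = g (u, a t u i)"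
    if "t < T" "u < n" "i < k" for t u i
    using shuffled_graph_edge[OF \<sigma> that(2)] a[OF that] by auto
  have dom: "E t \<subseteq> dom ?G" if "t < T" for t
    using E[of _ t] sh(2)[OF that] a[OF that] by fastforce
  have rb: "inj_on ?G (E t)" if "t < T" for t
  proof (rule inj_onI)
    fix e e' assume "e \<in> E t" "e' \<in> E t" and eq: "?G e = ?G e'"
    then obtain u i u' i' where *: "u < n" "i < k" "e = {u, \<sigma> u (a t u i)}"
      "u' < n" "i' < k" "e' = {u', \<sigma> u' (a t u' i')}" using E by metis
    then have "u = u' \<and> i = i'" using eq sh(2) that by (intro col[OF that]) auto
    then show "e = e'" using * by simp
  qed
  have disj: "t = t'" if t: "t < T" "t' < T" "e \<in> E t" "e \<in> E t'" for t t' e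
  proof -
    obtain u i u' i' where *: "u < n" "i < k" "e = {u, \<sigma> u (a t u i)}"
      "u' < n" "i' < k" "e = {u', \<sigma> u' (a t' u' i')}" using E t by metis
    then have eq: "u = u'" "\<sigma> u (a t u i) = \<sigma> u' (a t' u' i')"
      using arc_edge_inj[of u n "\<sigma> u (a t u i)" u' "\<sigma> u' (a t' u' i')"] sh(1) t by auto
    have "inj (\<sigma> u)" using permutes_inj[OF head_perms_permutes[OF \<sigma> *(1)]] .
    then have "a t u i = a t' u i'" using eq by (simp add: inj_eq)
    then show ?thesis using inj[of t t' u i i'] t * eq by auto
  qed
  \<comment> \<open>Disjoint sets are distinct only if nonempty, and \<open>card H = card R\<close>
    needs distinct cycles.\<close>
  have "\<exists>C. C \<subseteq> E t \<and> C \<noteq> {} \<and> (\<exists>vs. 3 \<le> length vs \<and> distinct vs \<and> set vs = {..<n} \<and> C = cycle_edges vs)"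
    if "t \<in> R" for t
  proof -
    have "hamiltonian n (E t)" using that unfolding R_def E_def by simp
    then obtain vs where vs: "3 \<le> length vs" "distinct vs" "set vs = {..<n}" "cycle_edges vs \<subseteq> E t"
      unfolding hamiltonian_def by auto
    then have "vs \<noteq> []" by auto
    then have "cycle_edges vs \<noteq> {}" by (simp add: cycle_edges_eq)
    then show ?thesis using vs by (intro exI[of _ "cycle_edges vs"]) blast
  qed
  then obtain C where C: "\<And>t. t \<in> R \<Longrightarrow> C t \<subseteq> E t \<and> C t \<noteq> {} \<and>
      (\<exists>vs. 3 \<le> length vs \<and> distinct vs \<and> set vs = {..<n} \<and> C t = cycle_edges vs)"
    by metis
  have RT: "t < T" if "t \<in> R" for t using that unfolding R_def by simp
  have Cdisj: "t = t'" if "t \<in> R" "t' \<in> R" "C t \<inter> C t' \<noteq> {}" for t t'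
    using disj[OF RT[OF that(1)] RT[OF that(2)]] C that by blast
  have "inj_on C R"
  proof (rule inj_onI)
    fix t t' assume "t \<in> R" "t' \<in> R" "C t = C t'"
    then show "t = t'" using Cdisj[of t t'] C[of t] by auto
  qed
  then have "card (C ` R) = card R" by (rule card_image)
  moreover have "finite R" unfolding R_def by simp
  moreover have "disjoint (C ` R)"
    unfolding disjoint_def using Cdisj by blast
  moreover have "hamilton_cycle n ?G (C t)" if "t \<in> R" for t
    unfolding hamilton_cycle_def using C[OF that] dom[OF RT[OF that]] by blast
  moreover have "rainbow ?G (C t)" if "t \<in> R" for t
    unfolding rainbow_def using C[OF that] dom[OF RT[OF that]] rb[OF RT[OF that]]
    by (meson inj_on_subset order_trans)
  ultimately show ?thesis unfolding rainbow_hamilton_packing_def by (intro exI[of _ "C ` R"]) auto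
qed

section \<open>Concentration\<close>

lemma prob_edge_kept:
  assumes "0 \<le> p" "p \<le> 1"
  shows "measure_pmf.prob (random_edge c p) {v. v \<noteq> None} = p"
proof -
  have 0: "pmf (map_pmf Some (pmf_of_set {1..c})) None = 0"
    by (simp add: pmf_eq_0_set_pmf)
  have "pmf (random_edge c p) None = 1 - p"
    unfolding random_edge_def using assms 0 by (simp add: pmf_bind)
  moreover have "measure_pmf.prob (random_edge c p) (UNIV - {None}) = 1 - measure_pmf.prob (random_edge c p) {None}"
    using measure_pmf.prob_compl[of "{None}" "random_edge c p"] by simp
  moreover have "{v. v \<noteq> None} = UNIV - {None :: nat option}" by auto
  ultimately show ?thesis by (simp add: measure_pmf_single)
qed

lemma prob_edge_colour:
  assumes "0 \<le> p" "p \<le> 1" "1 \<le> c"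
  shows "measure_pmf.prob (random_edge c p) {Some x} = (if x \<in> {1..c} then p / c else 0)"
proof -
  have "pmf (map_pmf Some (pmf_of_set {1..c})) (Some x) = pmf (pmf_of_set {1..c}) x"
    by (rule pmf_map_inj') simp
  also have "\<dots> = (if x \<in> {1..c} then 1 / c else 0)"
    using assms by (subst pmf_of_set) (auto simp: indicator_def)
  finally have "pmf (map_pmf Some (pmf_of_set {1..c})) (Some x) = (if x \<in> {1..c} then 1 / c else 0)" .
  then show ?thesis
    unfolding random_edge_def using assms by (simp add: measure_pmf_single pmf_bind)
qed

lemma integrable_pmf_indicator: "integrable (measure_pmf M) (indicator S :: _ \<Rightarrow> real)"
  by (rule measure_pmf.integrable_const_bound[where B = 1]) auto

lemma expectation_power_card:
  fixes z :: real
  assumes "finite D" "A \<subseteq> D" "0 \<le> z"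
  shows "measure_pmf.expectation (Pi_pmf D d (\<lambda>_. q)) (\<lambda>g. z ^ card {x \<in> A. g x \<in> E}) =
    (1 + (z - 1) * measure_pmf.prob q E) ^ card A"
proof -
  define h where "h x v = (if x \<in> A \<and> v \<in> E then z else 1)" for x v
  have fin: "finite A" using assms finite_subset by blast
  have "z ^ card {x \<in> A. g x \<in> E} = (\<Prod>x\<in>D. h x (g x))" for g
  proof -
    have "(\<Prod>x\<in>D. h x (g x)) = (\<Prod>x\<in>{x \<in> A. g x \<in> E}. z)"
      unfolding h_def using assms by (intro prod.mono_neutral_cong_right) auto
    then show ?thesis by simp
  qed
  then have "measure_pmf.expectation (Pi_pmf D d (\<lambda>_. q)) (\<lambda>g. z ^ card {x \<in> A. g x \<in> E}) =
      measure_pmf.expectation (Pi_pmf D d (\<lambda>_. q)) (\<lambda>g. \<Prod>x\<in>D. h x (g x))" by simp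
  also have "\<dots> = (\<Prod>x\<in>D. measure_pmf.expectation q (h x))"
  proof (rule expectation_prod_Pi_pmf[OF assms(1)])
    show "integrable (measure_pmf q) (h x)" for x
      using assms(3) by (intro measure_pmf.integrable_const_bound[where B = "1 + z"]) (auto simp: h_def)
    show "0 \<le> h x y" for x y using assms(3) by (simp add: h_def)
  qed
  also have "\<dots> = (\<Prod>x\<in>A. 1 + (z - 1) * measure_pmf.prob q E)"
  proof (rule prod.mono_neutral_cong_right[OF assms(1,2)])
    show "\<forall>x\<in>D - A. measure_pmf.expectation q (h x) = 1"
    proof
      fix x assume "x \<in> D - A"
      then have "h x = (\<lambda>_. 1)" by (auto simp: h_def)
      then show "measure_pmf.expectation q (h x) = 1" by simp
    qed
    fix x assume "x \<in> A"
    then have "measure_pmf.expectation q (h x) = measure_pmf.expectation q (\<lambda>v. 1 + (z - 1) * indicator E v)"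
      by (intro Bochner_Integration.integral_cong) (auto simp: h_def)
    also have "\<dots> = 1 + (z - 1) * measure_pmf.prob q E"
      using integrable_pmf_indicator[of q E] by (subst Bochner_Integration.integral_add) auto
    finally show "measure_pmf.expectation q (h x) = 1 + (z - 1) * measure_pmf.prob q E" .
  qed
  finally show ?thesis by simp
qed

text \<open>Chernoff's method. The last hypothesis serves both tails: \<open>z < 1\<close> for
  counts below \<open>b\<close>, \<open>z > 1\<close> for counts above \<open>b\<close>.\<close>

lemma prob_power_card_le:
  fixes z :: real
  assumes "finite D" "A \<subseteq> D" "0 < z"
    and "\<And>g. g \<in> S \<Longrightarrow> z ^ b \<le> z ^ card {x \<in> A. g x \<in> E}"
  shows "measure_pmf.prob (Pi_pmf D d (\<lambda>_. q)) S \<le> (1 + (z - 1) * measure_pmf.prob q E) ^ card A / z ^ b"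
proof -
  let ?M = "Pi_pmf D d (\<lambda>_. q)" and ?f = "\<lambda>g. z ^ card {x \<in> A. g x \<in> E}"
  have fin: "finite A" using assms finite_subset by blast
  have int: "integrable (measure_pmf ?M) ?f"
  proof (rule measure_pmf.integrable_const_bound[where B = "(1 + z) ^ card A"])
    have "?f g \<le> (1 + z) ^ card A" for g
    proof -
      have "?f g \<le> (1 + z) ^ card {x \<in> A. g x \<in> E}" using assms(3) by (intro power_mono) auto
      also have "\<dots> \<le> (1 + z) ^ card A" using assms(3) fin by (intro power_increasing card_mono) auto
      finally show ?thesis .
    qed
    then show "AE g in measure_pmf ?M. norm (?f g) \<le> (1 + z) ^ card A" using assms(3) by simp
  qed simp
  have "measure_pmf.prob ?M S = measure_pmf.expectation ?M (indicator S)" by simp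
  also have "\<dots> \<le> measure_pmf.expectation ?M (\<lambda>g. ?f g / z ^ b)"
  proof (rule integral_mono)
    show "indicator S g \<le> ?f g / z ^ b" for g
      using assms(3) assms(4)[of g] by (auto simp: indicator_def)
  qed (use int integrable_pmf_indicator in auto)
  also have "\<dots> = measure_pmf.expectation ?M ?f / z ^ b" by simp
  also have "measure_pmf.expectation ?M ?f = (1 + (z - 1) * measure_pmf.prob q E) ^ card A"
    using assms by (intro expectation_power_card) auto
  finally show ?thesis .
qed

text \<open>The mean is at least \<open>23 * X - 1\<close>, while
  \<open>22 * T \<le> 22.22 * X + 22\<close>. With \<open>z = 100/101\<close> the exponent is at
  most \<open>-(23 * X - 1) / 101 + 0.22 * (1.01 * X + 1)\<close>; the 1 in the conclusion absorbs
  the rounding.\<close>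

lemma prob_low_degree:
  fixes p :: real
  assumes n: "400 \<le> n" and p: "0 \<le> p" "p \<le> 1" and u: "u < n"
  defines "X \<equiv> real n * p / 46"
  defines "T \<equiv> nat \<lceil>101/100 * X\<rceil>"
  shows "measure_pmf.prob (Pi_pmf (arcs n) None (\<lambda>_. random_edge c p))
      {g. card {w \<in> heads n u. g (u, w) \<noteq> None} < 22 * T} \<le> exp (1 - X / 200)"
proof -
  let ?A = "{u} \<times> heads n u"
  have cardA: "card ?A = card (heads n u)" by (simp add: card_cartesian_product)
  have eq: "card {w \<in> heads n u. g (u, w) \<noteq> None} = card {x \<in> ?A. g x \<in> {v. v \<noteq> None}}"
    for g :: "nat \<times> nat \<Rightarrow> nat option"
    by (rule bij_betw_same_card[of "\<lambda>w. (u, w)"]) (auto simp: bij_betw_def inj_on_def)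
  have "measure_pmf.prob (Pi_pmf (arcs n) None (\<lambda>_. random_edge c p))
      {g. card {w \<in> heads n u. g (u, w) \<noteq> None} < 22 * T} \<le>
      (1 + (100/101 - 1) * measure_pmf.prob (random_edge c p) {v. v \<noteq> None}) ^ card ?A / (100/101) ^ (22 * T)"
    unfolding eq
    by (rule prob_power_card_le) (use u in \<open>auto simp: arcs_def intro!: power_decreasing\<close>)
  also have "\<dots> = (1 - p / 101) ^ card (heads n u) * (101/100) ^ (22 * T)"
    unfolding prob_edge_kept[OF p] cardA by (simp add: power_divide field_simps)
  also have "\<dots> \<le> exp (- p / 101) ^ card (heads n u) * exp (1/100) ^ (22 * T)"
    using exp_ge_add_one_self[of "- p / 101"] exp_ge_add_one_self[of "1/100 :: real"] p
    by (intro mult_mono power_mono) auto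
  also have "\<dots> = exp (- p * card (heads n u) / 101 + 22/100 * T)"
    by (simp add: mult_exp_exp mult.commute flip: exp_of_nat_mult)
  also have "\<dots> \<le> exp (1 - X / 200)"
  proof -
    have "p * ((real n - 2) / 2) \<le> p * card (heads n u)"
    proof (rule mult_left_mono[OF _ p(1)])
      have "real n \<le> 2 * real (card (heads n u)) + 2" using card_heads_ge[OF u] by linarith
      then show "(real n - 2) / 2 \<le> card (heads n u)" by simp
    qed
    then have 1: "23 * X - 1 \<le> p * card (heads n u)"
      using p unfolding X_def by (simp add: field_simps)
    have "0 \<le> X" unfolding X_def using p by simp
    then have "real T \<le> 101/100 * X + 1" unfolding T_def by linarith
    then show ?thesis using 1 \<open>0 \<le> X\<close> by simp
  qed
  finally show ?thesis .
qed

text \<open>The mean is at most \<open>X\<close>, one percent below \<open>T\<close>. With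
  \<open>z = 1001/1000\<close> and \<open>ln z \<ge> 0.000999\<close> the exponent is at most
  \<open>0.001 * X - 0.000999 * 1.01 * X\<close>.\<close>

lemma prob_frequent_colour:
  fixes p :: real
  assumes n: "400 \<le> n" and p: "0 \<le> p" "p \<le> 1" and x: "x \<in> {1..23 * n}"
  defines "X \<equiv> real n * p / 46"
  defines "T \<equiv> nat \<lceil>101/100 * X\<rceil>"
  shows "measure_pmf.prob (Pi_pmf (arcs n) None (\<lambda>_. random_edge (23 * n) p))
      {g. T < card {y \<in> arcs n. g y = Some x}} \<le> exp (- X / 200000)"
proof -
  have "measure_pmf.prob (Pi_pmf (arcs n) None (\<lambda>_. random_edge (23 * n) p))
      {g. T < card {y \<in> arcs n. g y = Some x}} \<le>
      (1 + (1001/1000 - 1) * measure_pmf.prob (random_edge (23 * n) p) {Some x}) ^ card (arcs n) / (1001/1000) ^ T"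
    by (rule prob_power_card_le) (auto intro!: power_increasing)
  also have "\<dots> = (1 + p / (23000 * n)) ^ card (arcs n) / (1001/1000) ^ T"
    using x n by (subst prob_edge_colour[OF p]) auto
  also have "\<dots> \<le> exp (X / 1000) / exp (999/1000000 * (101/100 * X))"
  proof (rule frac_le)
    have "card (arcs n) = (\<Sum>u<n. card (heads n u))" unfolding arcs_def by (simp add: card_SigmaI)
    then have "2 * card (arcs n) = (\<Sum>u<n. 2 * card (heads n u))" by (simp add: sum_distrib_left)
    also have "\<dots> \<le> (\<Sum>u<n. n)" using card_heads_le by (intro sum_mono) auto
    finally have "2 * card (arcs n) \<le> n * n" by simp
    then have arcs: "2 * real (card (arcs n)) \<le> real n * real n"
      by (metis of_nat_le_iff of_nat_mult of_nat_numeral)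
    have "(1 + p / (23000 * n)) ^ card (arcs n) \<le> exp (p / (23000 * n)) ^ card (arcs n)"
      using exp_ge_add_one_self p by (intro power_mono) auto
    also have "\<dots> = exp (card (arcs n) * (p / (23000 * n)))" by (simp flip: exp_of_nat_mult)
    also have "\<dots> \<le> exp (real n * real n / 2 * (p / (23000 * n)))"
      using arcs p by (subst exp_le_cancel_iff, intro mult_right_mono) auto
    also have "real n * real n / 2 * (p / (23000 * n)) = X / 1000"
      using n unfolding X_def by (simp add: field_simps)
    finally show "(1 + p / (23000 * n)) ^ card (arcs n) \<le> exp (X / 1000)" .
    have X: "0 \<le> X" unfolding X_def using p by simp
    have "1/1000 - (1/1000)\<^sup>2 \<le> ln (1 + 1/1000 :: real)"
      by (rule ln_one_plus_pos_lower_bound) auto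
    then have ln: "999/1000000 \<le> ln (1001/1000 :: real)" by (simp add: power2_eq_square)
    have "101/100 * X \<le> T" unfolding T_def by linarith
    then have "999/1000000 * (101/100 * X) \<le> ln (1001/1000) * T"
      using ln X by (intro mult_mono) auto
    then have "exp (999/1000000 * (101/100 * X)) \<le> exp (ln (1001/1000) * real T)" by simp
    also have "\<dots> = (1001/1000) ^ T"
      by (subst exp_of_nat2_mult) simp
    finally show "exp (999/1000000 * (101/100 * X)) \<le> (1001/1000) ^ T" .
  qed auto
  also have "\<dots> = exp (X / 1000 - 999/1000000 * (101/100 * X))" by (simp only: exp_diff)
  also have "\<dots> \<le> exp (- X / 200000)"
    using p unfolding X_def by (simp add: field_simps)
  finally show ?thesis .
qed

lemma prob_not_balanced:
  fixes p :: real
  assumes n: "400 \<le> n" and p: "0 \<le> p" "p \<le> 1"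
  defines "X \<equiv> real n * p / 46"
  defines "T \<equiv> nat \<lceil>101/100 * X\<rceil>"
  shows "measure_pmf.prob (Pi_pmf (arcs n) None (\<lambda>_. random_edge (23 * n) p)) {g. \<not> balanced n 22 T g}
    \<le> n * exp (1 - X / 200) + 23 * n * exp (- X / 200000)"
proof -
  let ?M = "Pi_pmf (arcs n) None (\<lambda>_. random_edge (23 * n) p)"
  let ?L = "\<lambda>u. {g. card {w \<in> heads n u. g (u, w) \<noteq> None} < 22 * T}"
  let ?U = "\<lambda>x. {g. T < card {y \<in> arcs n. g y = Some x}}"
  \<comment> \<open>\<open>balanced\<close> quantifies over all naturals as colours; intersecting
    with the support leaves \<open>23 * n\<close> of them for the union bound.\<close>
  have colours: "x \<in> {1..23 * n}" if g: "g \<in> set_pmf ?M" "y \<in> arcs n" "g y = Some x" for g y x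
  proof -
    have "g \<in> PiE_dflt (arcs n) None (set_pmf \<circ> (\<lambda>_. random_edge (23 * n) p))"
      using g(1) by (simp only: set_Pi_pmf finite_arcs)
    then have "g y \<in> set_pmf (random_edge (23 * n) p)"
      using g(2) unfolding PiE_dflt_def by (simp del: split_paired_All)
    then have "pmf (random_edge (23 * n) p) (Some x) \<noteq> 0" using g(3) by (simp add: set_pmf_iff)
    then show ?thesis using prob_edge_colour[OF p, of "23 * n" x] n
      by (auto simp: measure_pmf_single split: if_splits)
  qed
  have "{g. \<not> balanced n 22 T g} \<inter> set_pmf ?M \<subseteq> (\<Union>u<n. ?L u) \<union> (\<Union>x\<in>{1..23 * n}. ?U x)"
  proof
    fix g assume g: "g \<in> {g. \<not> balanced n 22 T g} \<inter> set_pmf ?M"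
    then consider u where "u < n" "card {w \<in> heads n u. g (u, w) \<noteq> None} < 22 * T"
      | x where "T < card {y \<in> arcs n. g y = Some x}"
      unfolding balanced_def by (auto simp: not_le)
    then show "g \<in> (\<Union>u<n. ?L u) \<union> (\<Union>x\<in>{1..23 * n}. ?U x)"
    proof cases
      case (2 x)
      then have "{y \<in> arcs n. g y = Some x} \<noteq> {}" by (metis card.empty not_less_zero)
      then have "x \<in> {1..23 * n}" using colours g by blast
      then show ?thesis using 2 by blast
    qed blast
  qed
  then have "measure_pmf.prob ?M ({g. \<not> balanced n 22 T g} \<inter> set_pmf ?M) \<le>
      measure_pmf.prob ?M ((\<Union>u<n. ?L u) \<union> (\<Union>x\<in>{1..23 * n}. ?U x))"
    by (rule measure_pmf.finite_measure_mono) simp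
  also have "\<dots> \<le> measure_pmf.prob ?M (\<Union>u<n. ?L u) + measure_pmf.prob ?M (\<Union>x\<in>{1..23 * n}. ?U x)"
    by (rule measure_Un_le) auto
  also have "\<dots> \<le> (\<Sum>u<n. measure_pmf.prob ?M (?L u)) + (\<Sum>x\<in>{1..23 * n}. measure_pmf.prob ?M (?U x))"
    by (intro add_mono measure_pmf.finite_measure_subadditive_finite) auto
  also have "\<dots> \<le> (\<Sum>u<n. exp (1 - X / 200)) + (\<Sum>x\<in>{1..23 * n}. exp (- X / 200000))"
    unfolding X_def T_def
    by (intro add_mono sum_mono prob_low_degree[OF n p] prob_frequent_colour[OF n p]) auto
  finally show ?thesis by (simp add: measure_Int_set_pmf)
qed

section \<open>Packing\<close>

text \<open>Markov's inequality by counting pairs \<open>(\<sigma>, t)\<close> where system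
  \<open>t\<close> fails under \<open>\<sigma>\<close>. A bad \<open>\<sigma>\<close> has at least
  \<open>T - X\<close> failures, and each system fails for a small proportion of the
  \<open>\<sigma>\<close>. The systems are dependent, but \<open>T - X\<close> is a fixed fraction
  of \<open>T\<close>, so their number cancels.\<close>

lemma card_bad_perms:
  fixes X :: real
  assumes n: "400 \<le> n" and X: "1 \<le> X" and bal: "balanced n 22 (nat \<lceil>101/100 * X\<rceil>) g"
  shows "real (card {\<sigma> \<in> head_perms n. \<not> (\<exists>H. rainbow_hamilton_packing n (shuffled_graph n \<sigma> g) H \<and> X \<le> card H)})
    \<le> 201 * exp 1936 * (6 / real n + exp (- real n / 25) + sqrt ((44 / 45) ^ n)) * card (head_perms n)"
    (is "real (card ?B) \<le> 201 * exp 1936 * ?\<eta> * _")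
proof -
  define T where "T = nat \<lceil>101/100 * X\<rceil>"
  let ?N = "card (head_perms n)"
  show ?thesis
  proof (rule balanced_decomposition[OF bal[folded T_def]])
    fix a :: "nat \<Rightarrow> nat \<Rightarrow> nat \<Rightarrow> nat"
    assume a:
      "\<And>t u i. t < T \<Longrightarrow> u < n \<Longrightarrow> i < 22 \<Longrightarrow> a t u i \<in> heads n u \<and> g (u, a t u i) \<noteq> None"
      "\<And>t t' u i i'. t < T \<Longrightarrow> t' < T \<Longrightarrow> u < n \<Longrightarrow> i < 22 \<Longrightarrow> i' < 22 \<Longrightarrow> a t u i = a t' u i' \<Longrightarrow>
         t = t' \<and> i = i'"
      "\<And>t u i u' i'. t < T \<Longrightarrow> u < n \<Longrightarrow> i < 22 \<Longrightarrow> u' < n \<Longrightarrow> i' < 22 \<Longrightarrow>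
         g (u, a t u i) = g (u', a t u' i') \<Longrightarrow> u = u' \<and> i = i'"
    define f where "f t \<sigma> = (\<lambda>u\<in>{..<n}. \<lambda>i\<in>{..<22}. \<sigma> u (a t u i))" for t and \<sigma> :: "nat \<Rightarrow> nat \<Rightarrow> nat"
    define NH where "NH = {f \<in> picks n 22. \<not> hamiltonian n (picked_graph n (\<lambda>_. {..<22}) f)}"
    define B where "B t = {\<sigma> \<in> head_perms n. f t \<sigma> \<in> NH}" for t
    have f_picks: "f t \<sigma> \<in> picks n 22" if "t < T" "\<sigma> \<in> head_perms n" for t \<sigma>
    proof -
      have "\<sigma> u (a t u i) \<in> heads n u" if "u < n" "i < 22" for u i
        using permutes_in_image[OF head_perms_permutes[OF \<open>\<sigma> \<in> head_perms n\<close> that(1)]] a(1)[OF \<open>t < T\<close> that] by simp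
      then show ?thesis unfolding f_def picks_def by (intro restrict_PiE_iff[THEN iffD2] ballI) simp
    qed
    have pos: "0 < card (picks n 22)"
    proof -
      have "0 < card (heads n u)" if "u < n" for u using card_heads_ge[OF that] n by linarith
      then show ?thesis unfolding card_picks by (intro prod_pos) auto
    qed
    have eta: "0 \<le> ?\<eta>" by simp
    have cardB: "real (card (B t)) \<le> exp 1936 * ?\<eta> * ?N" if "t < T" for t
    proof -
      have "real (card (B t)) * card (picks n 22) \<le> exp 1936 * card NH * ?N"
        unfolding B_def f_def
      proof (rule card_head_perms_into[OF n])
        show "NH \<subseteq> picks n 22" unfolding NH_def by auto
        show "inj_on (a t u) {..<22}" if "u < n" for u
          using a(2)[OF \<open>t < T\<close> \<open>t < T\<close> that] by (auto simp: inj_on_def)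
        show "a t u i \<in> heads n u" if "u < n" "i < 22" for u i using a(1)[OF \<open>t < T\<close> that] by simp
      qed
      also have "\<dots> \<le> exp 1936 * (card (picks n 22) * ?\<eta>) * ?N"
        using card_nonhamiltonian_picks[OF n] unfolding NH_def by (intro mult_right_mono mult_left_mono) auto
      finally show ?thesis using pos by (simp add: mult_ac)
    qed
    have bad: "real T - X \<le> card {t. t < T \<and> \<sigma> \<in> B t}" if \<sigma>: "\<sigma> \<in> ?B" for \<sigma>
    proof -
      define R where "R = {t. t < T \<and> hamiltonian n (picked_graph n (\<lambda>_. {..<22}) (f t \<sigma>))}"
      have "\<exists>H. rainbow_hamilton_packing n (shuffled_graph n \<sigma> g) H \<and> card H = card R"
        unfolding R_def f_def using \<sigma> a by (intro packing_from_choices) auto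
      then have "real (card R) < X" using \<sigma> by (auto simp: not_le)
      moreover have "{..<T} - R \<subseteq> {t. t < T \<and> \<sigma> \<in> B t}"
        unfolding R_def B_def NH_def using \<sigma> f_picks by auto
      then have "card ({..<T} - R) \<le> card {t. t < T \<and> \<sigma> \<in> B t}" by (intro card_mono) auto
      moreover have "R \<subseteq> {..<T}" unfolding R_def by auto
      then have "card ({..<T} - R) = T - card R" "card R \<le> T"
        using card_mono[of "{..<T}" R] by (auto simp: card_Diff_subset finite_subset)
      ultimately show ?thesis by linarith
    qed
    have "(real T - X) * card ?B = (\<Sum>\<sigma>\<in>?B. real T - X)" by simp
    also have "\<dots> \<le> (\<Sum>\<sigma>\<in>?B. real (card {t \<in> {..<T}. \<sigma> \<in> B t}))"
      using bad by (intro sum_mono) simp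
    also have "\<dots> \<le> (\<Sum>\<sigma>\<in>head_perms n. real (card {t \<in> {..<T}. \<sigma> \<in> B t}))"
      by (intro sum_mono2) auto
    also have "\<dots> = (\<Sum>t<T. real (card {\<sigma> \<in> head_perms n. \<sigma> \<in> B t}))"
      using sum_multicount_gen[of "head_perms n" "{..<T}" "\<lambda>\<sigma> t. \<sigma> \<in> B t" "\<lambda>t. card {\<sigma> \<in> head_perms n. \<sigma> \<in> B t}"]
      by (simp flip: of_nat_sum)
    also have "\<dots> \<le> (\<Sum>t<T. exp 1936 * ?\<eta> * ?N)"
    proof (rule sum_mono)
      fix t assume "t \<in> {..<T}"
      moreover have "{\<sigma> \<in> head_perms n. \<sigma> \<in> B t} = B t" unfolding B_def by auto
      ultimately show "real (card {\<sigma> \<in> head_perms n. \<sigma> \<in> B t}) \<le> exp 1936 * ?\<eta> * ?N"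
        using cardB by simp
    qed
    also have "\<dots> = T * (exp 1936 * ?\<eta> * ?N)" by simp
    also have "\<dots> \<le> (201 * (real T - X)) * (exp 1936 * ?\<eta> * ?N)"
    proof (rule mult_right_mono)
      have "101/100 * X \<le> T" "real T \<le> 101/100 * X + 1" using X unfolding T_def by linarith+
      \<comment> \<open>From \<open>T \<ge> 1.01 * X\<close> one gets
        \<open>200 * T \<ge> 202 * X \<ge> 201 * X\<close>.\<close>
      then show "real T \<le> 201 * (real T - X)" using X by argo
    qed (use eta in simp)
    finally have "(real T - X) * card ?B \<le> (real T - X) * (201 * exp 1936 * ?\<eta> * ?N)"
      by (simp only: ac_simps)
    moreover have "0 < real T - X" using X unfolding T_def by linarith
    ultimately show ?thesis by (simp only: mult_le_cancel_left_pos)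
  qed
qed

text \<open>The failure probability is the same for every shuffle. Averaging over
  \<open>\<sigma>\<close> and exchanging this with the expectation over \<open>g\<close> reduces the
  claim to counting bad \<open>\<sigma>\<close> for one balanced \<open>g\<close>; unbalanced
  \<open>g\<close> are charged in full.\<close>

lemma prob_no_packing:
  fixes p :: real
  assumes n: "400 \<le> n" and p: "0 \<le> p" "p \<le> 1" and X: "1 \<le> real n * p / 46"
  shows "measure_pmf.prob (random_coloured_graph (23 * n) n p)
      {G. \<not> (\<exists>H. rainbow_hamilton_packing n G H \<and> real n * p / 46 \<le> card H)}
    \<le> n * exp (1 - real n * p / 46 / 200) + 23 * n * exp (- (real n * p / 46) / 200000) +
      201 * exp 1936 * (6 / real n + exp (- real n / 25) + sqrt ((44 / 45) ^ n))"
    (is "measure_pmf.prob _ ?Bad \<le> ?b + ?e")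
proof -
  define X where "X = real n * p / 46"
  define M where "M = Pi_pmf (arcs n) None (\<lambda>_. random_edge (23 * n) p)"
  define Bal where "Bal = {g. balanced n 22 (nat \<lceil>101/100 * X\<rceil>) g}"
  let ?P = "measure_pmf.prob (random_coloured_graph (23 * n) n p) ?Bad"
  let ?S = "head_perms n"
  have pos: "0 < card ?S" unfolding card_head_perms by (intro prod_pos) simp
  have e: "0 \<le> ?e" by simp
  have "card ?S * ?P = (\<Sum>\<sigma>\<in>?S. measure_pmf.prob M (shuffled_graph n \<sigma> -` ?Bad))"
  proof -
    have "card ?S * ?P = (\<Sum>\<sigma>\<in>?S. ?P)" by (simp only: sum_constant)
    also have "\<dots> = (\<Sum>\<sigma>\<in>?S. measure_pmf.prob M (shuffled_graph n \<sigma> -` ?Bad))"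
    proof (rule sum.cong[OF refl])
      fix \<sigma> assume "\<sigma> \<in> ?S"
      then show "?P = measure_pmf.prob M (shuffled_graph n \<sigma> -` ?Bad)"
        unfolding random_coloured_graph_shuffled[OF \<open>\<sigma> \<in> ?S\<close>] M_def by (simp only: measure_map_pmf)
    qed
    finally show ?thesis .
  qed
  also have "\<dots> = (\<Sum>\<sigma>\<in>?S. measure_pmf.expectation M (indicator (shuffled_graph n \<sigma> -` ?Bad)))"
    by simp
  also have "\<dots> = measure_pmf.expectation M (\<lambda>g. \<Sum>\<sigma>\<in>?S. indicator (shuffled_graph n \<sigma> -` ?Bad) g)"
    by (subst Bochner_Integration.integral_sum) (auto simp only: integrable_pmf_indicator)
  also have "\<dots> \<le> measure_pmf.expectation M (\<lambda>g. real (card ?S) * indicator (- Bal) g + card ?S * ?e)"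
  proof (rule integral_mono)
    fix g
    have *: "(\<Sum>\<sigma>\<in>?S. indicator (shuffled_graph n \<sigma> -` ?Bad) g) =
        real (card {\<sigma> \<in> ?S. shuffled_graph n \<sigma> g \<in> ?Bad})"
      by (simp add: indicator_def sum.If_cases Int_def)
    show "(\<Sum>\<sigma>\<in>?S. indicator (shuffled_graph n \<sigma> -` ?Bad) g) \<le> real (card ?S) * indicator (- Bal) g + card ?S * ?e"
    proof (cases "g \<in> Bal")
      case True
      then have "balanced n 22 (nat \<lceil>101/100 * X\<rceil>) g" unfolding Bal_def by simp
      from card_bad_perms[OF n X[folded X_def] this] show ?thesis
        unfolding * using True by (simp add: X_def mult_ac)
    next
      case False
      have 1: "real (card {\<sigma> \<in> ?S. shuffled_graph n \<sigma> g \<in> ?Bad}) \<le> card ?S"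
        by (intro of_nat_mono card_mono) auto
      have 2: "0 \<le> card ?S * ?e" using e by simp
      have 3: "indicator (- Bal) g = (1 :: real)" using False by simp
      show ?thesis using add_mono[OF 1 2] unfolding * 3 by (simp only: add_0_right mult_1_right)
    qed
  qed (intro Bochner_Integration.integrable_sum Bochner_Integration.integrable_add
      integrable_mult_right integrable_pmf_indicator measure_pmf.integrable_const)+
  also have "\<dots> = card ?S * measure_pmf.prob M (- Bal) + card ?S * ?e"
    using integrable_pmf_indicator[of M "- Bal"] by (subst Bochner_Integration.integral_add) auto
  finally have "card ?S * ?P \<le> card ?S * (measure_pmf.prob M (- Bal) + ?e)"
    by (simp only: distrib_left)
  then have "?P \<le> measure_pmf.prob M (- Bal) + ?e" using pos by (simp only: mult_le_cancel_left_pos of_nat_0_less_iff)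
  moreover have "- Bal = {g. \<not> balanced n 22 (nat \<lceil>101/100 * X\<rceil>) g}" unfolding Bal_def by auto
  ultimately show ?thesis
    using prob_not_balanced[OF n p] unfolding M_def X_def by simp
qed

theorem theorem1p5:
  fixes p :: "nat \<Rightarrow> real"
  assumes "\<And>n. 0 \<le> p n \<and> p n \<le> 1"
    and "filterlim (\<lambda>n. p n * real n / ln (real n)) at_top sequentially"
  shows "\<exists>\<epsilon> :: nat \<Rightarrow> real. \<epsilon> \<longlonglongrightarrow> 0 \<and>
    (\<lambda>n. measure_pmf.prob (random_coloured_graph (23 * n) n (p n))
       {G. \<exists>H. rainbow_hamilton_packing n G H \<and>
               real (card H) \<ge> (1 - \<epsilon> n) * (real n * p n / 46)})
      \<longlonglongrightarrow> 1"
proof (intro exI conjI)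
  \<comment> \<open>The zero sequence will do: the systems lost are covered by taking
    \<open>T\<close> one percent above \<open>np/46\<close>.\<close>
  show "(\<lambda>n. 0 :: real) \<longlonglongrightarrow> 0" by simp
  define X where "X n = real n * p n / 46" for n
  define \<delta> where "\<delta> n = n * exp (1 - X n / 200) + 23 * real n * exp (- X n / 200000) +
      201 * exp 1936 * (6 / real n + exp (- real n / 25) + sqrt ((44 / 45) ^ n))" for n :: nat
  let ?P = "\<lambda>n. measure_pmf.prob (random_coloured_graph (23 * n) n (p n))
       {G. \<exists>H. rainbow_hamilton_packing n G H \<and> real (card H) \<ge> (1 - 0) * (real n * p n / 46)}"
  have large: "eventually (\<lambda>n. C * ln (real n) \<le> X n) sequentially" for C
  proof -
    have "eventually (\<lambda>n. 46 * C \<le> p n * real n / ln (real n)) sequentially"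
      using assms(2) by (simp add: filterlim_at_top)
    then show ?thesis using eventually_ge_at_top[of 2]
    proof eventually_elim
      case (elim n)
      then have "0 < ln (real n)" by simp
      then have "46 * C * ln (real n) \<le> p n * real n" using elim by (simp only: pos_le_divide_eq)
      then have "46 * (C * ln (real n)) \<le> real n * p n" by (simp only: mult.assoc mult.commute[of "p n"])
      then show ?case unfolding X_def by linarith
    qed
  qed
  \<comment> \<open>Eventually \<open>X n \<ge> (2 / c) * ln n\<close>, so the exponential is at
    most \<open>1 / n^2\<close> and beats the factor \<open>n\<close> of the union bound. It is
    applied with \<open>c\<close> as small as \<open>1/200000\<close>.\<close>
  have exp_lim: "(\<lambda>n. real n * exp (- c * X n)) \<longlonglongrightarrow> 0" if "0 < c" for c
  proof (rule tendsto_sandwich[where f = "\<lambda>_. 0" and h = "\<lambda>n. 1 / real n"])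
    show "eventually (\<lambda>n. real n * exp (- c * X n) \<le> 1 / real n) sequentially"
      using large[of "2 / c"] eventually_ge_at_top[of 1]
    proof eventually_elim
      case (elim n)
      then have "2 * ln (real n) \<le> c * X n" using that by (simp add: field_simps)
      then have "exp (- c * X n) \<le> exp (- (2 * ln (real n)))" by simp
      also have "\<dots> = 1 / (real n * real n)"
        using elim by (simp add: exp_minus exp_double power2_eq_square divide_inverse)
      finally have "real n * exp (- c * X n) \<le> real n * (1 / (real n * real n))"
        by (intro mult_left_mono) auto
      then show ?case using elim by simp
    qed
    show "(\<lambda>n. 1 / real n) \<longlonglongrightarrow> 0" by (rule lim_1_over_n)
  qed auto
  have "\<delta> \<longlonglongrightarrow> exp 1 * 0 + 23 * 0 + 201 * exp 1936 * (6 * 0 + 0 + sqrt 0)"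
  proof -
    have "(\<lambda>n. (44 / 45 :: real) ^ n) \<longlonglongrightarrow> 0" by (intro LIMSEQ_power_zero) simp
    moreover have "(\<lambda>n. exp (- real n / 25)) \<longlonglongrightarrow> 0"
    proof -
      have "(\<lambda>n. exp (- 1 / 25 :: real) ^ n) \<longlonglongrightarrow> 0" by (intro LIMSEQ_power_zero) simp
      then show ?thesis by (simp flip: exp_of_nat_mult)
    qed
    ultimately have lim: "(\<lambda>n. exp 1 * (real n * exp (- (1/200) * X n)) + 23 * (real n * exp (- (1/200000) * X n)) +
        201 * exp 1936 * (6 * (1 / real n) + exp (- real n / 25) + sqrt ((44 / 45) ^ n)))
        \<longlonglongrightarrow> exp 1 * 0 + 23 * 0 + 201 * exp 1936 * (6 * 0 + 0 + sqrt 0)"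
      by (intro tendsto_add tendsto_mult tendsto_const tendsto_real_sqrt exp_lim lim_1_over_n) simp_all
    have "\<delta> n = exp 1 * (real n * exp (- (1/200) * X n)) + 23 * (real n * exp (- (1/200000) * X n)) +
        201 * exp 1936 * (6 * (1 / real n) + exp (- real n / 25) + sqrt ((44 / 45) ^ n))" for n
    proof -
      have "exp (1 - X n / 200) = exp 1 * exp (- (1/200) * X n)" by (simp flip: exp_add)
      moreover have "exp (- X n / 200000) = exp (- (1/200000) * X n)" by simp
      moreover have "6 / real n = 6 * (1 / real n)" by simp
      ultimately show ?thesis unfolding \<delta>_def by (simp only: ac_simps)
    qed
    then have "\<delta> = (\<lambda>n. exp 1 * (real n * exp (- (1/200) * X n)) + 23 * (real n * exp (- (1/200000) * X n)) +
        201 * exp 1936 * (6 * (1 / real n) + exp (- real n / 25) + sqrt ((44 / 45) ^ n)))" by (rule ext)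
    with lim show ?thesis by (simp only:)
  qed
  then have lim: "(\<lambda>n. 1 - \<delta> n) \<longlonglongrightarrow> 1 - 0" by (intro tendsto_diff) auto
  have lower: "eventually (\<lambda>n. 1 - \<delta> n \<le> ?P n) sequentially"
    using large[of 1] eventually_ge_at_top[of 400]
  proof eventually_elim
    case (elim n)
    have "1 \<le> ln (real n)" using elim ln_ge_iff[of "real n" 1] exp_le by simp
    then have X: "1 \<le> real n * p n / 46" using elim unfolding X_def by simp
    let ?G = "{G. \<exists>H. rainbow_hamilton_packing n G H \<and> real n * p n / 46 \<le> card H}"
    have "measure_pmf.prob (random_coloured_graph (23 * n) n (p n)) (- ?G) \<le> \<delta> n"
      using prob_no_packing[OF elim(2) _ _ X] assms(1)[of n] unfolding \<delta>_def X_def Collect_neg_eq by blast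
    then show ?case
      using measure_pmf.prob_compl[of ?G "random_coloured_graph (23 * n) n (p n)"]
      by (simp add: Compl_eq_Diff_UNIV)
  qed
  show "?P \<longlonglongrightarrow> 1"
  proof (rule tendsto_sandwich[OF lower _ _ tendsto_const])
    show "eventually (\<lambda>n. ?P n \<le> 1) sequentially" by (rule always_eventually) simp
    show "(\<lambda>n. 1 - \<delta> n) \<longlonglongrightarrow> 1" using lim by (simp only: diff_zero)
  qed
qed

end
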